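(* Let $n\ge2$ be an integer and let $x(u),y(u)$ be the coordinates of the point of $\mathscr{E}$ with $u=\int_\infty^{(x(u),y(u))}\omega_1$. Put $\psi_n(u)=\sigma(nu)/\sigma(u)^{n^2}$. (i) If $n$ is odd, then $\psi_n$ is a polynomial in $x(u),y(u)$ of the form $$\psi_n(u)=n\,x^{\frac{n^2-1}2}+C_1x^{\frac{n^2-5}2}y+C_2x^{\frac{n^2-3}2}+C_3x^{\frac{n^2-7}2}y+C_4x^{\frac{n^2-5}2}+\cdots+C_{n^2-1},$$ with $C_1=C_3=C_5=0$ and $$C_2=\tfrac1{24}n(n^2-1)\mu_1^2+\tfrac16n(n^2-1)\mu_2,$$ $$\begin{aligned}C_4&=\tfrac1{1920}n(n^2-1)(n^2-9)\mu_1^4+\tfrac1{240}n(n^2-1)(n^2-9)\mu_2\mu_1^2+\tfrac1{120}n(n^2-1)(n^2+6)\mu_3\mu_1\\&\quad+\tfrac1{120}n(n^2-1)(n^2-9)\mu_2^2+\tfrac1{60}n(n^2-1)(n^2+6)\mu_4,\end{aligned}$$ $$\begin{aligned}C_6&=\tfrac1{322560}n(n^2-1)(n^2-3^2)(n^2-5^2)\mu_1^6+\tfrac1{26880}n(n^2-1)(n^2-3^2)(n^2-5^2)\mu_2\mu_1^4\\&\quad+\tfrac1{6720}n(n^2-1)(n^2-3^2)(n^2+10)\mu_3\mu_1^3+\tfrac1{6720}n(n^2-1)(n^2-3^2)(n^2-5^2)\mu_2^2\mu_1^2\\&\quad+\tfrac1{3360}n(n^2-1)(n^2-3^2)(n^2+10)\mu_4\mu_1^2+\tfrac1{1680}n(n^2-1)(n^2-3^2)(n^2+10)\mu_3\mu_2\mu_1\\&\quad+\tfrac1{5040}n(n^2-1)(n^2-3^2)(n^2-5^2)\mu_2^3+\tfrac1{840}n(n^2-1)(n^2-3^2)(n^2+10)\mu_4\mu_2\\&\quad+\tfrac1{840}n(n^2-1)(n^4+n^2+15)\mu_3^2+\tfrac1{210}n(n^2-1)(n^4+n^2+15)\mu_6.\end{aligned}$$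 (ii) If $n$ is even, then $\psi_n$ is a polynomial in $x(u),y(u)$ of the form $$\psi_n(u)=-n\,x^{\frac{n^2-4}2}y+C_1x^{\frac{n^2-2}2}+C_2x^{\frac{n^2-6}2}y+C_3x^{\frac{n^2-4}2}+C_4x^{\frac{n^2-8}2}y+\cdots+C_{n^2-1},$$ with $$C_1=-\tfrac12n\mu_1,\qquad C_2=-\tfrac1{24}n(n^2-2^2)\mu_1^2-\tfrac16n(n^2-2^2)\mu_2,$$ $$C_3=-\tfrac1{48}n(n^2-2^2)\mu_1^3-\tfrac1{12}n(n^2-2^2)\mu_2\mu_1-\tfrac12n\mu_3,$$ $$\begin{aligned}C_4&=-\tfrac1{1920}n(n^2-2^2)(n^2-4^2)\mu_1^4-\tfrac1{240}n(n^2-2^2)(n^2-4^2)\mu_2\mu_1^2-\tfrac1{120}n(n^2-2^2)(n^2+9)\mu_3\mu_1\\&\quad-\tfrac1{120}n(n^2-2^2)(n^2-4^2)\mu_2^2-\tfrac1{60}n(n^2-2^2)(n^2+9)\mu_4,\end{aligned}$$ $$\begin{aligned}C_5&=-\tfrac1{3840}n(n^2-2^2)(n^2-4^2)\mu_1^5-\tfrac1{480}n(n^2-2^2)(n^2-4^2)\mu_2\mu_1^3-\tfrac1{240}n(n^2-2^2)(n^2+14)\mu_3\mu_1^2\\&\quad-\tfrac1{240}n(n^2-2^2)(n^2-4^2)\mu_2^2\mu_1-\tfrac1{120}n(n^2-2^2)(n^2+9)\mu_4\mu_1-\tfrac1{12}n(n^2-2^2)\mu_3\mu_2.\end{aligned}$$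 In both cases the zeros $(x(u),y(u))$ of this polynomial on $\mathscr{E}$ are exactly the $n$-torsion points of $\mathscr{E}$ other than $\infty$, and the coefficients $C_j$ listed above are elements of $\mathbb{Z}[\mu_1,\mu_2,\mu_3,\mu_4,\mu_6]$.
   Context: Let $\mathscr{E}: y^2+(\mu_1x+\mu_3)y=x^3+\mu_2x^2+\mu_4x+\mu_6$ be a (nonsingular) elliptic curve over $\mathbb{C}$ with origin $\infty$; the coefficients $C_j$ depend on $n$ and are polynomials in the $\mu_j$. In (i), for even $j$ the term of $C_j$ is $C_jx^{(n^2-1-j)/2}$ and for odd $j$ it is $C_jx^{(n^2-4-j)/2}y$; in (ii), for odd $j$ it is $C_jx^{(n^2-1-j)/2}$ and for even $j$ it is $C_jx^{(n^2-4-j)/2}y$. Only terms with nonnegative exponents occur (listed coefficients of terms with a negative exponent are $0$). Put $\omega_1=\frac{dx}{2y+\mu_1x+\mu_3}$, $\eta_1=\frac{-x\,dx}{2y+\mu_1x+\mu_3}$. Let $\alpha,\beta$ be closed paths generating the fundamental group of $\mathscr{E}$ with intersection number $\alpha\cdot\beta=1$, $\omega'=\int_\alpha\omega_1$, $\omega''=\int_\beta\omega_1$, $\eta'=\int_\alpha\eta_1$, $\operatorname{Im}(\omega''/\omega')>0$. Then $$\sigma(u)=c\,\exp\!\big(\tfrac12u^2\eta'/\omega'\big)\sum_{m\in\mathbb{Z}}\exp\!\big(\pi i\tfrac{\omega''}{\omega'}(m+\tfrac12)^2+2\pi i(m+\tfrac12)(\tfrac{u}{\omega'}+\tfrac12)\big),$$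 with the nonzero constant $c$ fixed by $\sigma(u)=u+O(u^2)$. *)

theory Defs
  imports "HOL-Analysis.Analysis" "HOL-Library.Landau_Symbols"
begin

(* The coefficients of the Weierstrass equation are \<mu> 1, \<mu> 2, \<mu> 3, \<mu> 4, \<mu> 6; the values of \<mu>
   at all other indices are irrelevant. *)

section \<open>The curve and its group law\<close>

definition affine_curve :: "(nat \<Rightarrow> complex) \<Rightarrow> (complex \<times> complex) set" where
  "affine_curve \<mu> =
     {(x, y). y^2 + (\<mu> 1 * x + \<mu> 3) * y = x^3 + \<mu> 2 * x^2 + \<mu> 4 * x + \<mu> 6}"

(* The two partial derivatives of the equation have no common zero on the curve; the point at
   infinity of a Weierstrass cubic is always smooth. *)
definition nonsingular :: "(nat \<Rightarrow> complex) \<Rightarrow> bool" where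
  "nonsingular \<mu> \<longleftrightarrow>
     (\<forall>(x, y) \<in> affine_curve \<mu>.
        2 * y + \<mu> 1 * x + \<mu> 3 \<noteq> 0 \<or> 3 * x^2 + 2 * \<mu> 2 * x + \<mu> 4 - \<mu> 1 * y \<noteq> 0)"

(* Points of the projective curve: None is the origin \<infinity>, Some (x, y) an affine point. The
   projective curve is compact Hausdorff and has a single point at infinity, so its classical
   topology is that of the one-point compactification of the affine part. *)
definition curve_topology :: "(nat \<Rightarrow> complex) \<Rightarrow> (complex \<times> complex) option topology" where
  "curve_topology \<mu> = Alexandroff_compactification (top_of_set (affine_curve \<mu>))"

(* Chord and tangent law with origin \<infinity>: the line y = \<lambda> x + \<nu> through the two points meets the
   curve in a third point, whose negative (x, y) \<mapsto> (x, - y - \<mu> 1 x - \<mu> 3) is the sum. *)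
fun point_add ::
  "(nat \<Rightarrow> complex) \<Rightarrow> (complex \<times> complex) option \<Rightarrow> (complex \<times> complex) option
     \<Rightarrow> (complex \<times> complex) option" where
  "point_add \<mu> None Q = Q"
| "point_add \<mu> P None = P"
| "point_add \<mu> (Some (x1, y1)) (Some (x2, y2)) =
     (if x1 = x2 \<and> y1 + y2 + \<mu> 1 * x2 + \<mu> 3 = 0 then None
      else
        let l = (if x1 = x2
                 then (3 * x1^2 + 2 * \<mu> 2 * x1 + \<mu> 4 - \<mu> 1 * y1) / (2 * y1 + \<mu> 1 * x1 + \<mu> 3)
                 else (y2 - y1) / (x2 - x1));
            v = y1 - l * x1;
            x3 = l^2 + \<mu> 1 * l - \<mu> 2 - x1 - x2
        in Some (x3, - (l + \<mu> 1) * x3 - v - \<mu> 3))"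

definition point_mult ::
  "(nat \<Rightarrow> complex) \<Rightarrow> nat \<Rightarrow> (complex \<times> complex) option \<Rightarrow> (complex \<times> complex) option" where
  "point_mult \<mu> n P = (point_add \<mu> P ^^ n) None"

section \<open>Differential forms and their integrals\<close>

(* Value of the form at an affine point on the tangent vector (dx, dy). On the curve
   (2 y + \<mu> 1 x + \<mu> 3) dy = (3 x^2 + 2 \<mu> 2 x + \<mu> 4 - \<mu> 1 y) dx, which gives the second expression at the
   branch points of x, where dx / (2 y + \<mu> 1 x + \<mu> 3) reads 0 / 0. *)
definition omega1 ::
  "(nat \<Rightarrow> complex) \<Rightarrow> complex \<times> complex \<Rightarrow> complex \<times> complex \<Rightarrow> complex" where
  "omega1 \<mu> = (\<lambda>(x, y) (dx, dy).
     if 2 * y + \<mu> 1 * x + \<mu> 3 \<noteq> 0 then dx / (2 * y + \<mu> 1 * x + \<mu> 3)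
     else dy / (3 * x^2 + 2 * \<mu> 2 * x + \<mu> 4 - \<mu> 1 * y))"

definition eta1 ::
  "(nat \<Rightarrow> complex) \<Rightarrow> complex \<times> complex \<Rightarrow> complex \<times> complex \<Rightarrow> complex" where
  "eta1 \<mu> p d = - fst p * omega1 \<mu> p d"

definition form_integral ::
  "(complex \<times> complex \<Rightarrow> complex \<times> complex \<Rightarrow> complex) \<Rightarrow> real \<Rightarrow> real \<Rightarrow> (real \<Rightarrow> complex \<times> complex)
     \<Rightarrow> complex" where
  "form_integral \<phi> a b \<gamma> = integral {a..b} (\<lambda>t. \<phi> (\<gamma> t) (vector_derivative \<gamma> (at t)))"

(* u is one of the values of the integral of omega1 from \<infinity> to the affine point p: the path \<gamma>
   leaves \<infinity> at time 0 and then stays in the affine part. *)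
definition integral_from_infinity ::
  "(nat \<Rightarrow> complex) \<Rightarrow> complex \<times> complex \<Rightarrow> complex \<Rightarrow> bool" where
  "integral_from_infinity \<mu> p u \<longleftrightarrow>
     (\<exists>\<gamma>. \<gamma> ` {0<..1} \<subseteq> affine_curve \<mu> \<and> \<gamma> 1 = p \<and>
          (\<forall>\<epsilon>\<in>{0<..<1}. \<gamma> piecewise_C1_differentiable_on {\<epsilon>..1}) \<and>
          filterlim \<gamma> at_infinity (at_right 0) \<and>
          ((\<lambda>\<epsilon>. form_integral (omega1 \<mu>) \<epsilon> 1 \<gamma>) \<longlongrightarrow> u) (at_right 0))"

definition coordinates :: "(nat \<Rightarrow> complex) \<Rightarrow> complex \<Rightarrow> complex \<times> complex" where
  "coordinates \<mu> u = (THE p. integral_from_infinity \<mu> p u)"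

section \<open>Generators of the fundamental group\<close>

(* The loops avoid \<infinity>, where eta1 has a pole. *)
definition affine_loop :: "(nat \<Rightarrow> complex) \<Rightarrow> (real \<Rightarrow> complex \<times> complex) \<Rightarrow> bool" where
  "affine_loop \<mu> \<gamma> \<longleftrightarrow>
     \<gamma> piecewise_C1_differentiable_on {0..1} \<and> \<gamma> ` {0..1} \<subseteq> affine_curve \<mu> \<and> \<gamma> 1 = \<gamma> 0"

inductive_set loop_words ::
  "(real \<Rightarrow> complex \<times> complex) \<Rightarrow> (real \<Rightarrow> complex \<times> complex) \<Rightarrow> (real \<Rightarrow> complex \<times> complex) set"
  for \<alpha> \<beta> where
  "(\<lambda>t. \<alpha> 0) \<in> loop_words \<alpha> \<beta>"
| "\<alpha> \<in> loop_words \<alpha> \<beta>"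
| "\<beta> \<in> loop_words \<alpha> \<beta>"
| "\<gamma> \<in> loop_words \<alpha> \<beta> \<Longrightarrow> reversepath \<gamma> \<in> loop_words \<alpha> \<beta>"
| "\<gamma> \<in> loop_words \<alpha> \<beta> \<Longrightarrow> \<delta> \<in> loop_words \<alpha> \<beta> \<Longrightarrow> \<gamma> +++ \<delta> \<in> loop_words \<alpha> \<beta>"

(* Every loop on the projective curve, through \<infinity> or not, is homotopic in the projective curve,
   relative to the base point, to a word in \<alpha> and \<beta>. *)
definition generate_fundamental_group ::
  "(nat \<Rightarrow> complex) \<Rightarrow> (real \<Rightarrow> complex \<times> complex) \<Rightarrow> (real \<Rightarrow> complex \<times> complex) \<Rightarrow> bool" where
  "generate_fundamental_group \<mu> \<alpha> \<beta> \<longleftrightarrow>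
     \<alpha> 0 = \<beta> 0 \<and>
     (\<forall>\<gamma>. continuous_map (top_of_set {0..1}) (curve_topology \<mu>) \<gamma> \<and>
          \<gamma> 0 = Some (\<alpha> 0) \<and> \<gamma> 1 = Some (\<alpha> 0) \<longrightarrow>
        (\<exists>\<delta>\<in>loop_words \<alpha> \<beta>.
           homotopic_with (\<lambda>h. h 0 = Some (\<alpha> 0) \<and> h 1 = Some (\<alpha> 0))
             (top_of_set {0..1}) (curve_topology \<mu>) \<gamma> (Some \<circ> \<delta>)))"

definition freely_homotopic ::
  "(nat \<Rightarrow> complex) \<Rightarrow> (real \<Rightarrow> complex \<times> complex) \<Rightarrow> (real \<Rightarrow> complex \<times> complex) \<Rightarrow> bool" where
  "freely_homotopic \<mu> \<gamma> \<delta> \<longleftrightarrow>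
     homotopic_with (\<lambda>h. h 1 = h 0) (top_of_set {0..1}) (curve_topology \<mu>)
       (Some \<circ> \<gamma>) (Some \<circ> \<delta>)"

definition crossings ::
  "(real \<Rightarrow> complex \<times> complex) \<Rightarrow> (real \<Rightarrow> complex \<times> complex) \<Rightarrow> (real \<times> real) set" where
  "crossings \<gamma> \<delta> = {(s, t). s \<in> {0..1} \<and> t \<in> {0..1} \<and> \<gamma> s = \<delta> t}"

(* omega1 is a complex-linear isomorphism from each tangent line to the complex plane, so it
   preserves orientation: positive (negative) value means that the pair of velocity vectors is
   positively (negatively) oriented, zero that the crossing is not transversal. *)
definition crossing_orientation ::
  "(nat \<Rightarrow> complex) \<Rightarrow> (real \<Rightarrow> complex \<times> complex) \<Rightarrow> (real \<Rightarrow> complex \<times> complex) \<Rightarrow> real \<times> real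
     \<Rightarrow> real" where
  "crossing_orientation \<mu> \<gamma> \<delta> = (\<lambda>(s, t).
     Im (cnj (omega1 \<mu> (\<gamma> s) (vector_derivative \<gamma> (at s)))
           * omega1 \<mu> (\<delta> t) (vector_derivative \<delta> (at t))))"

definition transversal ::
  "(nat \<Rightarrow> complex) \<Rightarrow> (real \<Rightarrow> complex \<times> complex) \<Rightarrow> (real \<Rightarrow> complex \<times> complex) \<Rightarrow> bool" where
  "transversal \<mu> \<gamma> \<delta> \<longleftrightarrow>
     finite (crossings \<gamma> \<delta>) \<and>
     (\<forall>(s, t) \<in> crossings \<gamma> \<delta>.
        s \<in> {0<..<1} \<and> t \<in> {0<..<1} \<and>
        \<gamma> differentiable at s \<and> \<delta> differentiable at t \<and>
        crossing_orientation \<mu> \<gamma> \<delta> (s, t) \<noteq> 0)"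

(* Signed count of the crossings of transversal representatives of the free homotopy classes. *)
definition has_intersection_number ::
  "(nat \<Rightarrow> complex) \<Rightarrow> (real \<Rightarrow> complex \<times> complex) \<Rightarrow> (real \<Rightarrow> complex \<times> complex) \<Rightarrow> real
     \<Rightarrow> bool" where
  "has_intersection_number \<mu> \<alpha> \<beta> k \<longleftrightarrow>
     (\<exists>\<gamma> \<delta>. affine_loop \<mu> \<gamma> \<and> affine_loop \<mu> \<delta> \<and>
            freely_homotopic \<mu> \<alpha> \<gamma> \<and> freely_homotopic \<mu> \<beta> \<delta> \<and>
            transversal \<mu> \<gamma> \<delta> \<and>
            k = (\<Sum>p\<in>crossings \<gamma> \<delta>. sgn (crossing_orientation \<mu> \<gamma> \<delta> p)))"

section \<open>The sigma function\<close>

definition unnormalized_sigma :: "complex \<Rightarrow> complex \<Rightarrow> complex \<Rightarrow> complex \<Rightarrow> complex" where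
  "unnormalized_sigma \<omega>' \<omega>'' \<eta>' u =
     exp (1/2 * u^2 * \<eta>' / \<omega>') *
     (\<Sum>\<^sub>\<infinity>m\<in>(UNIV :: int set).
        exp (of_real pi * \<i> * (\<omega>'' / \<omega>') * (of_int m + 1/2)^2
             + 2 * of_real pi * \<i> * (of_int m + 1/2) * (u / \<omega>' + 1/2)))"

definition sigma_constant :: "complex \<Rightarrow> complex \<Rightarrow> complex \<Rightarrow> complex" where
  "sigma_constant \<omega>' \<omega>'' \<eta>' =
     (THE c. c \<noteq> 0 \<and>
        (\<lambda>u. c * unnormalized_sigma \<omega>' \<omega>'' \<eta>' u - u) \<in> O[at 0](\<lambda>u. u^2))"

definition sigma :: "complex \<Rightarrow> complex \<Rightarrow> complex \<Rightarrow> complex \<Rightarrow> complex" where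
  "sigma \<omega>' \<omega>'' \<eta>' u = sigma_constant \<omega>' \<omega>'' \<eta>' * unnormalized_sigma \<omega>' \<omega>'' \<eta>' u"

definition psi :: "complex \<Rightarrow> complex \<Rightarrow> complex \<Rightarrow> nat \<Rightarrow> complex \<Rightarrow> complex" where
  "psi \<omega>' \<omega>'' \<eta>' n u = sigma \<omega>' \<omega>'' \<eta>' (of_nat n * u) / sigma \<omega>' \<omega>'' \<eta>' u ^ (n^2)"

(* At the points of this lattice the point of the curve with parameter u is \<infinity>, and the
   denominator of psi vanishes. *)
definition period_lattice :: "complex \<Rightarrow> complex \<Rightarrow> complex set" where
  "period_lattice \<omega>' \<omega>'' = {of_int a * \<omega>' + of_int b * \<omega>'' | a b. True}"

section \<open>The shape of the division polynomials\<close>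

(* The ring generated over the integers by \<mu> 1, \<mu> 2, \<mu> 3, \<mu> 4, \<mu> 6, its elements being regarded as
   functions of \<mu>; over the complex numbers a polynomial is determined by its values. *)
inductive_set int_polynomials :: "((nat \<Rightarrow> complex) \<Rightarrow> complex) set" where
  "(\<lambda>\<mu>. of_int k) \<in> int_polynomials"
| "j \<in> {1, 2, 3, 4, 6} \<Longrightarrow> (\<lambda>\<mu>. \<mu> j) \<in> int_polynomials"
| "f \<in> int_polynomials \<Longrightarrow> g \<in> int_polynomials \<Longrightarrow> (\<lambda>\<mu>. f \<mu> + g \<mu>) \<in> int_polynomials"
| "f \<in> int_polynomials \<Longrightarrow> g \<in> int_polynomials \<Longrightarrow> (\<lambda>\<mu>. f \<mu> * g \<mu>) \<in> int_polynomials"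

(* The divisions of the exponents are exact. Terms whose exponent would be negative (j + 4 > n^2 in
   the terms with y) do not occur. *)
definition division_form :: "nat \<Rightarrow> (nat \<Rightarrow> complex) \<Rightarrow> complex \<Rightarrow> complex \<Rightarrow> complex" where
  "division_form n c x y =
     (if odd n then
        of_nat n * x ^ ((n^2 - 1) div 2)
        + (\<Sum>j = 1..n^2 - 1.
             if even j then c j * x ^ ((n^2 - 1 - j) div 2)
             else if j + 4 \<le> n^2 then c j * x ^ ((n^2 - 4 - j) div 2) * y
             else 0)
      else
        - of_nat n * x ^ ((n^2 - 4) div 2) * y
        + (\<Sum>j = 1..n^2 - 1.
             if odd j then c j * x ^ ((n^2 - 1 - j) div 2)
             else if j + 4 \<le> n^2 then c j * x ^ ((n^2 - 4 - j) div 2) * y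
             else 0))"

end

(*
Put Y = 2y + mu1 x + mu3, so that Y^2 = F(x) = 4x^3 + b2 x^2 + 2 b4 x + b6 and u = int dx/Y.
Near u = 0 the function x is 1/S(u)^2, where S inverts the integral in the chart x = 1/s^2; the duplication
formula, an algebraic identity for the differential equation of S, continues x from a disc to the disc of twice
the radius, hence to a meromorphic function on the plane with pole set L. The addition theorem holds because
the x-coordinate of the third intersection point of the chord through the points with parameters w and c - w
has derivative 0 in w; it makes L a group and u |-> (x(u), Y(u)) a bijection from (C - L)/L to the affine curve.
This parametrization is a covering map, so loops lift: the periods of the two generating loops lie in L, and
conversely each l in L is a period, because characters of C/L detect homotopy classes through winding numbers.
Hence L is the period lattice. Theta functions of order two form a space of dimension two, which gives
sigma(u+a) sigma(u-a) = -sigma(a)^2 sigma(u)^2 (x(u) - x(a)), and from it the recursion of elliptic divisibility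
sequences for psi_n. The coefficients and their low-order terms follow by induction along this recursion.
*)

theory Submission
  imports Defs "HOL-Complex_Analysis.Complex_Analysis" "HOL-Computational_Algebra.Fundamental_Theorem_Algebra"
begin

section \<open>Elliptic divisibility sequences\<close>

text \<open>The curve is the datum and the lattice the result: summing over a given lattice would
  leave open whether the prescribed cubic arises at all, so \<open>x\<close> comes from the
  differential equation, and at first nothing is known about its pole set \<open>L\<close>.
  Duplication can be iterated because it is a morphism of the projective line: numerator and
  denominator have no common zero, the cubic having simple roots. The zeros of theta are never
  counted; that they form exactly \<open>L\<close> is drawn from the product identity itself. The
  inclusion of \<open>L\<close> in the period lattice is where generation of the fundamental group
  enters. Real coordinates with respect to the two periods are at first only rational on
  \<open>L\<close>; as the period lattice has finite index in \<open>L\<close>, a common multiple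
  turns them into integral characters. On the algebraic side, dividing the even entries by
  \<open>\<psi>\<^sub>2\<close> leaves polynomials in x alone, since
  \<open>\<psi>\<^sub>2 ^ 2\<close> is the cubic in x. Read from the top degree, the first four
  coefficients of a product depend only on those of its factors, so closed forms in n pass through
  the recursion as finitely many polynomial identities.\<close>

text \<open>The recursion of the division polynomials \<open>\<psi>\<^sub>n\<close> after the factor \<open>\<psi>\<^sub>2\<close> has been removed from those of even
  index; \<open>F\<close> stands for \<open>\<psi>\<^sub>2\<^sup>2\<close>, and \<open>c\<close>, \<open>d\<close> for \<open>\<psi>\<^sub>3\<close> and \<open>\<psi>\<^sub>4 / \<psi>\<^sub>2\<close>.\<close>

function eds :: "'a::comm_ring_1 \<Rightarrow> 'a \<Rightarrow> 'a \<Rightarrow> nat \<Rightarrow> 'a" where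
  "eds F c d n =
     (if n = 0 then 0 else if n \<le> 2 then 1 else if n = 3 then c else if n = 4 then d
      else let m = n div 2 in
        if even n then
          eds F c d m * (eds F c d (m + 2) * eds F c d (m - 1) ^ 2
                         - eds F c d (m - 2) * eds F c d (m + 1) ^ 2)
        else if even m then
          F ^ 2 * eds F c d (m + 2) * eds F c d m ^ 3 - eds F c d (m - 1) * eds F c d (m + 1) ^ 3
        else
          eds F c d (m + 2) * eds F c d m ^ 3 - F ^ 2 * eds F c d (m - 1) * eds F c d (m + 1) ^ 3)"
  by pat_completeness auto
termination
  by (relation "Wellfounded.measure (\<lambda>(F, c, d, n). n)") auto

declare eds.simps [simp del]

lemma eds_base [simp]:
  "eds F c d 0 = 0" "eds F c d 1 = 1" "eds F c d (Suc 0) = 1" "eds F c d 2 = 1" "eds F c d 3 = c" "eds F c d 4 = d"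
  by (simp_all add: eds.simps)

lemma eds_even:
  assumes "m \<ge> 3"
  shows "eds F c d (2 * m) =
    eds F c d m * (eds F c d (m + 2) * eds F c d (m - 1) ^ 2 - eds F c d (m - 2) * eds F c d (m + 1) ^ 2)"
  using assms by (subst eds.simps) (simp add: Let_def)

lemma eds_odd:
  assumes "m \<ge> 2"
  shows "eds F c d (2 * m + 1) =
    (if even m then
       F ^ 2 * eds F c d (m + 2) * eds F c d m ^ 3 - eds F c d (m - 1) * eds F c d (m + 1) ^ 3
     else
       eds F c d (m + 2) * eds F c d m ^ 3 - F ^ 2 * eds F c d (m - 1) * eds F c d (m + 1) ^ 3)"
  using assms by (subst eds.simps) (simp add: Let_def)

text \<open>The even step starts at m = 3 and the odd one at m = 2, so every index on the right of
  the recursion is positive and smaller than the one on the left.\<close>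

lemma eds_induct [consumes 1, case_names base even odd]:
  fixes n :: nat
  assumes "n \<ge> 1"
    and base: "\<And>n. n \<in> {1, 2, 3, 4} \<Longrightarrow> P n"
    and even: "\<And>m. m \<ge> 3 \<Longrightarrow> P m \<Longrightarrow> P (m + 2) \<Longrightarrow> P (m - 1) \<Longrightarrow> P (m - 2) \<Longrightarrow> P (m + 1) \<Longrightarrow> P (2 * m)"
    and odd: "\<And>m. m \<ge> 2 \<Longrightarrow> P m \<Longrightarrow> P (m + 2) \<Longrightarrow> P (m - 1) \<Longrightarrow> P (m + 1) \<Longrightarrow> P (2 * m + 1)"
  shows "P n"
  using \<open>n \<ge> 1\<close>
proof (induction n rule: less_induct)
  case (less n)
  consider "n \<in> {1, 2, 3, 4}" | "n \<ge> 5" using less.prems by fastforce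
  then show ?case
  proof cases
    case 1
    then show ?thesis by (rule base)
  next
    case 2
    define m where "m = n div 2"
    show ?thesis
    proof (cases "even n")
      case True
      then have nm: "n = 2 * m" by (simp add: m_def)
      show ?thesis unfolding nm
        by (rule even) (use nm 2 in \<open>auto intro!: less.IH\<close>)
    next
      case False
      then have nm: "n = 2 * m + 1" by (simp add: m_def)
      show ?thesis unfolding nm
        by (rule odd) (use nm 2 in \<open>auto intro!: less.IH\<close>)
    qed
  qed
qed

section \<open>Leading coefficients along the recursion\<close>

text \<open>A polynomial modulo degree 4. With the coefficients in reverse order these are the four
  leading ones of a division polynomial, and sums and products act on such truncations.\<close>

definition low :: "complex poly \<Rightarrow> complex \<Rightarrow> complex \<Rightarrow> complex \<Rightarrow> complex \<Rightarrow> bool" where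
  "low p a b c d \<longleftrightarrow> coeff p 0 = a \<and> coeff p 1 = b \<and> coeff p 2 = c \<and> coeff p 3 = d"

lemma low_mult:
  assumes "low p a b c d" "low q a' b' c' d'"
  shows "low (p * q) (a * a') (a * b' + b * a') (a * c' + b * b' + c * a')
           (a * d' + b * c' + c * b' + d * a')"
proof -
  have [simp]: "{..(0::nat)} = {0}" "{..(1::nat)} = {0, 1}" "{..(2::nat)} = {0, 1, 2}" "{..(3::nat)} = {0, 1, 2, 3}"
    by auto
  show ?thesis using assms by (simp add: low_def coeff_mult)
qed

lemma low_diff:
  "low p a b c d \<Longrightarrow> low q a' b' c' d' \<Longrightarrow> low (p - q) (a - a') (b - b') (c - c') (d - d')"
  by (simp add: low_def)

lemma low_eq: "low p a b c d \<Longrightarrow> a = a' \<Longrightarrow> b = b' \<Longrightarrow> c = c' \<Longrightarrow> d = d' \<Longrightarrow> low p a' b' c' d'"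
  by simp

lemma low_numeral: "low (numeral k) (numeral k) 0 0 0"
  by (simp add: low_def numeral_poly coeff_pCons numeral_2_eq_2 numeral_3_eq_3 split: nat.split)

text \<open>The closed forms of the low coefficients for odd index (\<open>O\<close>) and, after multiplication by 2, for even index (\<open>E\<close>).
  The normalization \<open>b\<^sub>2 = 1680 p\<close>, \<open>b\<^sub>4 = 120 q\<close>, \<open>b\<^sub>6 = 840 r\<close> makes all numerical coefficients integral.\<close>

definition O1 where "O1 p N = 70 * (N * (N^2 - 1)) * (p::complex)"
definition O2 where "O2 p q N = 1470 * (N * (N^2-1) * (N^2-9)) * (p::complex)^2 + (N * (N^2-1) * (N^2+6)) * q"
definition O3 where "O3 p q r N = 14700 * (N * (N^2-1) * (N^2-9) * (N^2-25)) * (p::complex)^3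
   + 30 * (N * (N^2-1) * (N^2-9) * (N^2+10)) * p * q + (N * (N^2-1) * (N^4+N^2+15)) * r"
definition E1 where "E1 p N = 70 * (N * (N^2 - 4)) * (p::complex)"
definition E2 where "E2 p q N = 1470 * (N * (N^2-4) * (N^2-16)) * (p::complex)^2 + (N * (N^2-4) * (N^2+9)) * q"
definition E3 where "E3 p q r N = 14700 * (N * (N^2-4) * (N^2-16) * (N^2-36)) * (p::complex)^3
   + 30 * (N * (N^2-4) * (N^2-16) * (N^2+13)) * p * q + (N * (N^2-4) * (N^4+4*N^2+30)) * r"
lemmas low_coeff_defs = O1_def O2_def O3_def E1_def E2_def E3_def
definition lowO where "lowO p q r N P = low P N (O1 p N) (O2 p q N) (O3 p q r N)"
definition lowE where "lowE p q r N P = low P N (E1 p N) (E2 p q N) (E3 p q r N)"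
definition lowF where "lowF p q r P = low P 4 (1680*p) (240*q) (840*r)"

text \<open>Each \<open>lowE\<close> argument stands for twice an entry of the sequence. Two of them
  in each product give four times the entry of index 2m, which is twice its own doubled value; hence
  the factor 2. What remains are four polynomial identities in M, p, q, r.\<close>

lemma step_even_even:
  assumes "lowE p q r M f" "lowE p q r (M+2) f2" "lowE p q r (M-2) f2'"
    "lowO p q r (M+1) f1" "lowO p q r (M-1) f1'"
  shows "low (f * (f2 * f1'^2 - f2' * f1^2)) (2*(2*M)) (2*E1 p (2*M)) (2*E2 p q (2*M)) (2*E3 p q r (2*M))"
  apply (rule low_eq)
  unfolding power2_eq_square
      apply (rule low_mult low_diff assms[unfolded lowE_def lowO_def])+
  unfolding low_coeff_defs
     apply algebra
  apply algebra
  apply algebra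
  apply algebra
  done

text \<open>Now the doubled entries are the neighbours of index m - 1 and m + 1. They enter squared,
  so the total factor is 4 again.\<close>

lemma step_even_odd:
  assumes "lowO p q r M f" "lowO p q r (M+2) f2" "lowO p q r (M-2) f2'"
    "lowE p q r (M+1) f1" "lowE p q r (M-1) f1'"
  shows "low (f * (f2 * f1'^2 - f2' * f1^2)) (2*(2*M)) (2*E1 p (2*M)) (2*E2 p q (2*M)) (2*E3 p q r (2*M))"
  apply (rule low_eq)
  unfolding power2_eq_square
      apply (rule low_mult low_diff assms[unfolded lowE_def lowO_def])+
  unfolding low_coeff_defs
     apply algebra
  apply algebra
  apply algebra
  apply algebra
  done

text \<open>The four doubled factors in \<open>f2\<close> and \<open>f^3\<close> produce 16; the
  other product consists of undoubled odd entries and is multiplied by 16 to match.\<close>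

lemma step_odd_even:
  assumes "lowE p q r M f" "lowE p q r (M+2) f2"
    "lowO p q r (M+1) f1" "lowO p q r (M-1) f1'" "lowF p q r F"
  shows "low (F^2 * f2 * f^3 - 16 * (f1' * f1^3)) (16*(2*M+1)) (16*O1 p (2*M+1)) (16*O2 p q (2*M+1)) (16*O3 p q r (2*M+1))"
  apply (rule low_eq)
  unfolding power2_eq_square power3_eq_cube
      apply (rule low_mult low_diff low_numeral assms[unfolded lowE_def lowO_def lowF_def])+
  unfolding low_coeff_defs
     apply algebra
  apply algebra
  apply algebra
  apply algebra
  done

lemma step_odd_odd:
  assumes "lowO p q r M f" "lowO p q r (M+2) f2"
    "lowE p q r (M+1) f1" "lowE p q r (M-1) f1'" "lowF p q r F"
  shows "low (16 * (f2 * f^3) - F^2 * f1' * f1^3) (16*(2*M+1)) (16*O1 p (2*M+1)) (16*O2 p q (2*M+1)) (16*O3 p q r (2*M+1))"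
  apply (rule low_eq)
  unfolding power2_eq_square power3_eq_cube
      apply (rule low_mult low_diff low_numeral assms[unfolded lowE_def lowO_def lowF_def])+
  unfolding low_coeff_defs
     apply algebra
  apply algebra
  apply algebra
  apply algebra
  done

section \<open>Weights, homogeneity and degrees\<close>

text \<open>The degree in x: a pole of order n^2 - 1 at the origin, less the order 3 of
  \<open>2 y + \<mu> 1 x + \<mu> 3\<close> when that factor is removed, halved because x has a
  double pole.\<close>

definition wt :: "nat \<Rightarrow> nat" where
  "wt n = (if even n then (n^2 - 4) div 2 else (n^2 - 1) div 2)"

lemma wt_odd: "wt (2*j+1) = 2*j*(j+1)" and wt_even: "wt (2*j+2) = 2*j*(j+2)"
proof -
  have "(2*j+1)^2 - 1 = 2*(2*j*(j+1))" "(2*j+2)^2 - 4 = 2*(2*j*(j+2))"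
    by (simp_all add: power2_eq_square algebra_simps)
  then show "wt (2*j+1) = 2*j*(j+1)" "wt (2*j+2) = 2*j*(j+2)"
    unfolding wt_def by (metis (no_types) even_plus_one_iff even_mult_iff even_numeral nonzero_mult_div_cancel_left zero_neq_numeral even_add)+
qed

lemma wt_small: "wt 1 = 0" "wt (Suc 0) = 0" "wt 2 = 0" "wt 3 = 4" "wt 4 = 6"
  by (simp_all add: wt_def)

lemma wt_rec_even:
  assumes "m \<ge> 3"
  shows "wt m + wt (m+2) + 2 * wt (m-1) = wt (2*m)" "wt m + wt (m-2) + 2 * wt (m+1) = wt (2*m)"
proof -
  have "(\<exists>j. m = 2*j+4) \<or> (\<exists>j. m = 2*j+3)" using assms by presburger
  then have "wt m + wt (m+2) + 2 * wt (m-1) = wt (2*m) \<and> wt m + wt (m-2) + 2 * wt (m+1) = wt (2*m)"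
  proof (elim disjE exE)
    fix j assume m: "m = 2*j+4"
    have e: "m = 2*(j+1)+2" "m+2 = 2*(j+2)+2" "m-1 = 2*(j+1)+1" "m-2=2*j+2" "m+1=2*(j+2)+1" "2*m = 2*(2*j+3)+2"
      using m by auto
    show ?thesis by (simp only: e(2-6), simp only: e(1), simp only: wt_odd wt_even) (simp add: algebra_simps)
  next
    fix j assume m: "m = 2*j+3"
    have e: "m = 2*(j+1)+1" "m+2 = 2*(j+2)+1" "m-1 = 2*j+2" "m-2=2*j+1" "m+1=2*(j+1)+2" "2*m = 2*(2*j+2)+2"
      using m by auto
    show ?thesis by (simp only: e(2-6), simp only: e(1), simp only: wt_odd wt_even) (simp add: algebra_simps)
  qed
  then show "wt m + wt (m+2) + 2 * wt (m-1) = wt (2*m)" "wt m + wt (m-2) + 2 * wt (m+1) = wt (2*m)" by auto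
qed

text \<open>The 6 is the weight of \<open>F ^ 2\<close>, where F is a cubic in x.\<close>

lemma wt_rec_odd:
  assumes "m \<ge> 2"
  shows "(if even m then 6 else 0) + wt (m+2) + 3 * wt m = wt (2*m+1)"
        "(if even m then 0 else 6) + wt (m-1) + 3 * wt (m+1) = wt (2*m+1)"
proof -
  have "(\<exists>j. m = 2*j+2) \<or> (\<exists>j. m = 2*j+3)" using assms by presburger
  then have "(if even m then 6 else 0) + wt (m+2) + 3 * wt m = wt (2*m+1) \<and> (if even m then 0 else 6) + wt (m-1) + 3 * wt (m+1) = wt (2*m+1)"
  proof (elim disjE exE)
    fix j assume m: "m = 2*j+2"
    have e: "m = 2*j+2" "m+2 = 2*(j+1)+2" "m-1 = 2*j+1" "m+1=2*(j+1)+1" "2*m+1 = 2*(2*j+2)+1"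
      using m by auto
    have "even m" using m by simp
    then show ?thesis by (simp only: e(2-5), simp only: e(1), simp only: wt_odd wt_even) (simp add: algebra_simps)
  next
    fix j assume m: "m = 2*j+3"
    have e: "m = 2*(j+1)+1" "m+2 = 2*(j+2)+1" "m-1 = 2*j+2" "m+1=2*(j+1)+2" "2*m+1 = 2*(2*j+3)+1"
      using m by auto
    have "odd m" using m by simp
    then show ?thesis by (simp only: e(2-5), simp only: e(1), simp only: wt_odd wt_even) (simp add: algebra_simps)
  qed
  then show "(if even m then 6 else 0) + wt (m+2) + 3 * wt m = wt (2*m+1)"
        "(if even m then 0 else 6) + wt (m-1) + 3 * wt (m+1) = wt (2*m+1)" by auto
qed

text \<open>The two products in a recursion step have equal weight, so the powers of x factor out.
  Evaluated at 1/x, this is what reverses the order of the coefficients.\<close>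

lemma eds_homogeneous:
  fixes x :: "'a::comm_ring_1"
  assumes "n \<ge> 1"
  shows "eds (x^3 * F) (x^4 * c) (x^6 * d) n = x ^ wt n * eds F c d n"
  using assms
proof (induction n rule: eds_induct)
  case (base n)
  then show ?case by (auto simp: wt_small)
next
  case (even m)
  have *: "(x^a*A)*((x^b*B)*(x^c*C)^2 - (x^d*D)*(x^e*E)^2) = x^N * (A*(B*C^2-D*E^2))"
    if "a + b + 2 * c = N" "a + d + 2 * e = N" for a b c d e N and A B C D E :: 'a
  proof -
    have "x^N = x^a * x^b * (x^c)^2"
      unfolding that(1) [symmetric] by (simp add: power_add power_mult [symmetric] mult.commute)
    moreover have "x^N = x^a * x^d * (x^e)^2"
      unfolding that(2) [symmetric] by (simp add: power_add power_mult [symmetric] mult.commute)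
    ultimately have "x^N * (A*(B*C^2)) - x^N * (A*(D*E^2)) = (x^a * x^b * (x^c)^2) * (A*(B*C^2)) - (x^a * x^d * (x^e)^2) * (A*(D*E^2))"
      by simp
    then show ?thesis by (simp add: algebra_simps power_mult_distrib)
  qed
  show ?case
    unfolding eds_even [OF even(1)] even.IH by (rule *) (rule wt_rec_even [OF even(1)])+
next
  case (odd m)
  have *: "x^u * F * ((x^b*B)*(x^a*A)^3) - x^v * G * ((x^d*D)*(x^e*E)^3) = x^N * (F*(B*A^3) - G*(D*E^3))"
    if "u + b + 3 * a = N" "v + d + 3 * e = N" for u v a b d e N and F G A B D E :: 'a
  proof -
    have "x^N = x^u * x^b * (x^a)^3"
      unfolding that(1) [symmetric] by (simp add: power_add power_mult [symmetric] mult.commute)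
    moreover have "x^N = x^v * x^d * (x^e)^3"
      unfolding that(2) [symmetric] by (simp add: power_add power_mult [symmetric] mult.commute)
    ultimately have "x^N * (F*(B*A^3)) - x^N * (G*(D*E^3)) = (x^u * x^b * (x^a)^3) * (F*(B*A^3)) - (x^v * x^d * (x^e)^3) * (G * (D*E^3))"
      by simp
    then show ?thesis by (simp add: algebra_simps power_mult_distrib)
  qed
  show ?case
    using *[OF wt_rec_odd[OF odd(1)], of "if even m then F^2 else 1" "eds F c d (m+2)" "eds F c d m"
           "if even m then 1 else F^2" "eds F c d (m-1)" "eds F c d (m+1)"]
    unfolding eds_odd [OF odd(1)] odd.IH
    by (auto simp: power_mult_distrib power_mult [symmetric] mult.assoc split: if_splits)
qed

lemma poly_eds: "poly (eds F c d n) z = eds (poly F z) (poly c z) (poly d z) n"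
proof (cases "n = 0")
  case False
  then have "n \<ge> 1" by simp
  then show ?thesis
  proof (induction n rule: eds_induct)
    case (base n)
    then show ?case by auto
  next
    case (even m)
    then show ?case by (simp add: eds_even)
  next
    case (odd m)
    show ?case unfolding eds_odd[OF odd(1)]
      by (cases "even m") (simp_all only: if_True if_False poly_mult poly_diff poly_power odd.IH)
  qed
qed auto

lemma degree_eds:
  fixes F c d :: "complex poly"
  assumes "n \<ge> 1" "degree F \<le> 3" "degree c \<le> 4" "degree d \<le> 6"
  shows "degree (eds F c d n) \<le> wt n"
  using assms(1)
proof (induction n rule: eds_induct)
  case (base n)
  then show ?case using assms by (auto simp: wt_small)
next
  case (even m)
  have *: "degree (A*(B*C^2-D*E^2)) \<le> N"
    if "a + b + 2 * c = N" "a + d + 2 * e = N" "degree A \<le> a" "degree B \<le> b" "degree C \<le> c" "degree D \<le> d" "degree E \<le> e"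
    for a b c d e N and A B C D E :: "complex poly"
  proof -
    have "degree (B * C^2) \<le> b + 2*c" "degree (D * E^2) \<le> d + 2 * e"
      using that degree_mult_le[of B "C^2"] degree_power_le[of C 2] degree_mult_le[of D "E^2"] degree_power_le[of E 2]
      by linarith+
    then have "degree (B*C^2-D*E^2) \<le> b + 2*c"
      using that by (intro degree_diff_le) auto
    then show ?thesis using that degree_mult_le[of A "B*C^2-D*E^2"] by linarith
  qed
  show ?case
    unfolding eds_even [OF even(1)] by (rule *) (rule wt_rec_even[OF even(1)] even.IH)+
next
  case (odd m)
  have *: "degree (F*(B*A^3) - G*(D*E^3)) \<le> N"
    if "u + b + 3 * a = N" "v + d + 3 * e = N" "degree F \<le> u" "degree G \<le> v" "degree A \<le> a" "degree B \<le> b" "degree D \<le> d" "degree E \<le> e"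
    for u v a b d e N and A B D E F G :: "complex poly"
  proof -
    have "degree (F * (B * A^3)) \<le> u + b + 3 * a" "degree (G * (D * E^3)) \<le> v + d + 3 * e"
      using that degree_mult_le[of F "B*A^3"] degree_mult_le[of B "A^3"] degree_power_le[of A 3]
       degree_mult_le[of G "D*E^3"] degree_mult_le[of D "E^3"] degree_power_le[of E 3]
      by linarith+
    then show ?thesis using that by (intro degree_diff_le) auto
  qed
  have F2: "degree (F^2) \<le> 6" using degree_power_le[of F 2] assms by linarith
  show ?case
    using *[OF wt_rec_odd[OF odd(1)], of "if even m then F^2 else 1" "if even m then 1 else F^2" "eds F c d m" "eds F c d (m+2)"
           "eds F c d (m-1)" "eds F c d (m+1)"] odd.IH F2
    unfolding eds_odd [OF odd(1)]
    by (auto simp: mult.assoc split: if_splits)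
qed

lemma sum_homogenize:
  fixes p :: "complex poly" and x :: complex
  assumes "degree p \<le> e" "x \<noteq> 0"
  shows "x ^ e * poly p (1/x) = (\<Sum>k\<le>e. coeff p k * x ^ (e - k))"
proof -
  have "poly p (1/x) = (\<Sum>k\<le>e. coeff p k * (1/x)^k)"
    unfolding poly_altdef by (rule sum.mono_neutral_left) (use assms in \<open>auto simp: coeff_eq_0\<close>)
  then show ?thesis using assms(2) by (simp add: sum_distrib_left power_diff field_simps)
qed

lemma eds_eval_eq_sum:
  fixes x b2 b4 b6 b8 :: complex
  assumes "n \<ge> 1"
  defines "G \<equiv> eds [:4, b2, 2*b4, b6:] [:3, b2, 3*b4, 3*b6, b8:] [:2, b2, 5*b4, 10*b6, 10*b8, b2*b8 - b4*b6, b4*b8 - b6^2:] n"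
  shows "eds (4*x^3 + b2*x^2 + 2*b4*x + b6) (3*x^4 + b2*x^3 + 3*b4*x^2 + 3*b6*x + b8)
     (2*x^6 + b2*x^5 + 5*b4*x^4 + 10*b6*x^3 + 10*b8*x^2 + (b2*b8 - b4*b6)*x + (b4*b8 - b6^2)) n
    = (\<Sum>k\<le>wt n. coeff G k * x ^ (wt n - k))" (is "?L x = ?R x")
proof -
  have deg: "degree G \<le> wt n"
    unfolding G_def by (rule degree_eds[OF assms(1)]) (auto intro: order.trans[OF degree_pCons_le])
  have nz: "?L x = ?R x" if "x \<noteq> 0" for x
  proof -
    have "?L x = eds (x^3 * poly [:4, b2, 2*b4, b6:] (1/x)) (x^4 * poly [:3, b2, 3*b4, 3*b6, b8:] (1/x))
        (x^6 * poly [:2, b2, 5*b4, 10*b6, 10*b8, b2*b8 - b4*b6, b4*b8 - b6^2:] (1/x)) n"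
      using that by (intro arg_cong3[where f = "\<lambda>a b c. eds a b c n"]) (simp_all add: field_simps power_numeral_reduce)
    also have "\<dots> = x ^ wt n * poly G (1/x)"
      unfolding eds_homogeneous[OF assms(1)] G_def poly_eds ..
    also have "\<dots> = ?R x" by (rule sum_homogenize[OF deg that])
    finally show ?thesis .
  qed
  have L: "?L = poly (eds [:b6, 2*b4, b2, 4:] [:b8, 3*b6, 3*b4, b2, 3:] [:b4*b8 - b6^2, b2*b8 - b4*b6, 10*b8, 10*b6, 5*b4, b2, 2:] n)"
    unfolding poly_eds by (intro ext arg_cong3[where f = "\<lambda>a b c. eds a b c n"]) (simp_all add: algebra_simps power_numeral_reduce)
  \<comment> \<open>The reversal divides by x; both sides are polynomial in x, so the missing value
    at 0 follows by continuity.\<close>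
  have "isCont ?L 0" unfolding L by (rule poly_isCont)
  then have lim: "(?L \<longlongrightarrow> ?L 0) (at 0)" unfolding isCont_def .
  have ev: "\<forall>\<^sub>F x in at 0. ?L x = ?R x"
    unfolding eventually_at_filter using nz by simp
  have "(?R \<longlongrightarrow> ?R 0) (at 0)"
    by (intro tendsto_intros)
  with Lim_transform_eventually[OF lim ev] have "?L 0 = ?R 0"
    by (rule tendsto_unique[OF at_neq_bot])
  then show ?thesis using nz[of x] by (cases "x = 0") (simp_all only: simp_thms)
qed

section \<open>Integrality and explicit form of the coefficients\<close>

text \<open>All polynomials are written in reverse order: the coefficient of degree \<open>k\<close> of \<open>divpoly n \<mu>\<close> is that of
  \<open>x ^ (wt n - k)\<close> in \<open>\<psi>\<^sub>n\<close> or \<open>\<psi>\<^sub>n / \<psi>\<^sub>2\<close>.\<close>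

definition divpoly :: "nat \<Rightarrow> (nat \<Rightarrow> complex) \<Rightarrow> complex poly" where
  "divpoly n \<mu> = (let b2 = \<mu> 1^2 + 4 * \<mu> 2; b4 = 2 * \<mu> 4 + \<mu> 1 * \<mu> 3; b6 = \<mu> 3^2 + 4 * \<mu> 6;
      b8 = \<mu> 1^2 * \<mu> 6 + 4 * \<mu> 2 * \<mu> 6 - \<mu> 1 * \<mu> 3 * \<mu> 4 + \<mu> 2 * \<mu> 3^2 - \<mu> 4^2 in
    eds [:4, b2, 2*b4, b6:] [:3, b2, 3*b4, 3*b6, b8:]
        [:2, b2, 5*b4, 10*b6, 10*b8, b2*b8 - b4*b6, b4*b8 - b6^2:] n)"

text \<open>For even n the polynomial in x is multiplied by
  \<open>- (2 y + \<mu> 1 x + \<mu> 3)\<close>. The terms without y collect \<open>\<mu> 1 x\<close>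
  at one coefficient and \<open>\<mu> 3\<close> at the preceding one, whence the shift by
  \<open>pCons 0\<close>.\<close>

definition divcoeff :: "nat \<Rightarrow> nat \<Rightarrow> (nat \<Rightarrow> complex) \<Rightarrow> complex" where
  "divcoeff n j \<mu> =
     (if odd n then (if even j then coeff (divpoly n \<mu>) (j div 2) else 0)
      else if even j then - 2 * coeff (divpoly n \<mu>) (j div 2)
      else - (\<mu> 1 * coeff (divpoly n \<mu>) (j div 2) + \<mu> 3 * coeff (pCons 0 (divpoly n \<mu>)) (j div 2)))"

lemma int_polynomials_minus:
  assumes "f \<in> int_polynomials" "g \<in> int_polynomials"
  shows "(\<lambda>\<mu>. f \<mu> - g \<mu>) \<in> int_polynomials"
  using int_polynomials.intros(3)[OF assms(1) int_polynomials.intros(4)[OF int_polynomials.intros(1)[of "-1"] assms(2)]]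
  by simp

lemma int_polynomials_numeral:
  "(\<lambda>\<mu>. 0) \<in> int_polynomials" "(\<lambda>\<mu>. 1) \<in> int_polynomials" "(\<lambda>\<mu>. numeral k) \<in> int_polynomials"
  using int_polynomials.intros(1)[of 0] int_polynomials.intros(1)[of 1] int_polynomials.intros(1)[of "numeral k"] by simp_all

lemma int_polynomials_var:
  "(\<lambda>\<mu>. \<mu> 1) \<in> int_polynomials" "(\<lambda>\<mu>. \<mu> (Suc 0)) \<in> int_polynomials" "(\<lambda>\<mu>. \<mu> 2) \<in> int_polynomials" "(\<lambda>\<mu>. \<mu> 3) \<in> int_polynomials"
  "(\<lambda>\<mu>. \<mu> 4) \<in> int_polynomials" "(\<lambda>\<mu>. \<mu> 6) \<in> int_polynomials"
  using int_polynomials.intros(2)[of 1] int_polynomials.intros(2)[of 2] int_polynomials.intros(2)[of 3] int_polynomials.intros(2)[of 4] int_polynomials.intros(2)[of 6]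
  by simp_all

lemma int_polynomials_power:
  "f \<in> int_polynomials \<Longrightarrow> (\<lambda>\<mu>. f \<mu> ^ k) \<in> int_polynomials"
  by (induction k) (auto intro: int_polynomials.intros int_polynomials_numeral)

lemma int_polynomials_uminus:
  "f \<in> int_polynomials \<Longrightarrow> (\<lambda>\<mu>. - f \<mu>) \<in> int_polynomials"
  using int_polynomials_minus[OF int_polynomials_numeral(1)] by simp

lemma int_polynomials_sum:
  "(\<And>i. i \<in> A \<Longrightarrow> f i \<in> int_polynomials) \<Longrightarrow> (\<lambda>\<mu>. \<Sum>i\<in>A. f i \<mu>) \<in> int_polynomials"
  by (induction A rule: infinite_finite_induct) (auto intro: int_polynomials.intros int_polynomials_numeral)

lemmas int_polynomials_intros = int_polynomials_minus int_polynomials_numeral int_polynomials_var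
  int_polynomials_power int_polynomials_uminus int_polynomials_sum int_polynomials.intros(3,4)

definition int_coeffs :: "((nat \<Rightarrow> complex) \<Rightarrow> complex poly) \<Rightarrow> bool" where
  "int_coeffs p \<longleftrightarrow> (\<forall>k. (\<lambda>\<mu>. coeff (p \<mu>) k) \<in> int_polynomials)"

lemma int_coeffs_0: "int_coeffs (\<lambda>\<mu>. 0)"
  by (simp add: int_coeffs_def int_polynomials_numeral)

lemma int_coeffs_pCons: "f \<in> int_polynomials \<Longrightarrow> int_coeffs p \<Longrightarrow> int_coeffs (\<lambda>\<mu>. pCons (f \<mu>) (p \<mu>))"
  unfolding int_coeffs_def
proof
  fix k assume "f \<in> int_polynomials" "\<forall>k. (\<lambda>\<mu>. coeff (p \<mu>) k) \<in> int_polynomials"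
  then show "(\<lambda>\<mu>. coeff (pCons (f \<mu>) (p \<mu>)) k) \<in> int_polynomials" by (cases k) auto
qed

lemma int_coeffs_diff: "int_coeffs p \<Longrightarrow> int_coeffs q \<Longrightarrow> int_coeffs (\<lambda>\<mu>. p \<mu> - q \<mu>)"
  by (auto simp: int_coeffs_def int_polynomials_minus)

lemma int_coeffs_mult: "int_coeffs p \<Longrightarrow> int_coeffs q \<Longrightarrow> int_coeffs (\<lambda>\<mu>. p \<mu> * q \<mu>)"
  by (auto simp: int_coeffs_def coeff_mult intro!: int_polynomials_intros)

lemma int_coeffs_1: "int_coeffs (\<lambda>\<mu>. 1)"
  unfolding one_pCons by (intro int_coeffs_pCons int_coeffs_0 int_polynomials_numeral)

lemma int_coeffs_power: "int_coeffs p \<Longrightarrow> int_coeffs (\<lambda>\<mu>. p \<mu> ^ k)"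
  by (induction k) (auto intro: int_coeffs_mult int_coeffs_1)

lemma int_coeffs_eds:
  assumes "n \<ge> 1" "int_coeffs F" "int_coeffs c" "int_coeffs d"
  shows "int_coeffs (\<lambda>\<mu>. eds (F \<mu>) (c \<mu>) (d \<mu>) n)"
  using assms(1)
proof (induction n rule: eds_induct)
  case (base n)
  then show ?case using assms by (auto simp: int_coeffs_1)
next
  case (even m)
  show ?case unfolding eds_even[OF even(1)] by (intro int_coeffs_mult int_coeffs_diff int_coeffs_power even.IH)
next
  case (odd m)
  show ?case unfolding eds_odd[OF odd(1)]
    by (cases "even m") (simp_all only: if_True if_False, (intro int_coeffs_mult int_coeffs_diff int_coeffs_power odd.IH assms)+)
qed

lemma int_coeffs_divpoly:
  assumes "n \<ge> 1"
  shows "int_coeffs (divpoly n)"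
  unfolding divpoly_def Let_def
  by (intro int_coeffs_eds[OF assms] int_coeffs_pCons int_coeffs_0 int_polynomials_intros)

lemma divcoeff_int:
  assumes "n \<ge> 1"
  shows "divcoeff n j \<in> int_polynomials"
proof -
  have *: "(\<lambda>\<mu>. coeff (divpoly n \<mu>) k) \<in> int_polynomials"
      "(\<lambda>\<mu>. coeff (pCons 0 (divpoly n \<mu>)) k) \<in> int_polynomials" for k
    using int_coeffs_divpoly[OF assms] int_coeffs_pCons[OF int_polynomials_numeral(1) int_coeffs_divpoly[OF assms]]
    by (auto simp: int_coeffs_def)
  have "(\<lambda>\<mu>. divcoeff n j \<mu>) \<in> int_polynomials"
    unfolding divcoeff_def
    by (cases "odd n"; cases "even j"; simp only: if_True if_False not_False_eq_True not_True_eq_False)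
       (intro int_polynomials_intros *)+
  then show ?thesis by simp
qed

lemma low_pCons: "low (pCons a (pCons b (pCons c (pCons d p)))) a b c d"
  by (simp add: low_def numeral_2_eq_2 numeral_3_eq_3)

lemma low_one: "low 1 1 0 0 0"
  by (simp add: low_def)

lemma low_cancel: "low (a * p) (k * b0) (k * b1) (k * b2) (k * b3) \<Longrightarrow> a = [:k:] \<Longrightarrow> k \<noteq> 0 \<Longrightarrow> low p b0 b1 b2 b3"
  by (auto simp: low_def)

text \<open>The entry \<open>b8\<close> first occurs in degree 4 of the initial polynomials, beyond
  the truncation; therefore the closed forms involve \<open>b2\<close>, \<open>b4\<close>,
  \<open>b6\<close> only. They are checked at the four initial indices and carried on by the step
  identities.\<close>

lemma low_eds:
  fixes b2 b4 b6 b8 :: complex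
  assumes "n \<ge> 1"
  defines "G \<equiv> eds [:4, b2, 2*b4, b6:] [:3, b2, 3*b4, 3*b6, b8:] [:2, b2, 5*b4, 10*b6, 10*b8, b2*b8 - b4*b6, b4*b8 - b6^2:]"
  shows "if even n then lowE (b2/1680) (b4/120) (b6/840) (of_nat n) (2 * G n)
         else lowO (b2/1680) (b4/120) (b6/840) (of_nat n) (G n)"
  using assms(1)
proof (induction n rule: eds_induct)
  case (base n)
  have g: "G 1 = 1" "G 2 = 1" "G 3 = [:3, b2, 3*b4, 3*b6, b8:]" "G 4 = [:2, b2, 5*b4, 10*b6, 10*b8, b2*b8 - b4*b6, b4*b8 - b6^2:]"
    by (simp_all add: G_def)
  consider "n = 1" | "n = 2" | "n = 3" | "n = 4" using base by auto
  then show ?case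
  proof cases
    case 1
    have "lowO (b2/1680) (b4/120) (b6/840) 1 (G 1)"
      unfolding lowO_def g by (rule low_eq[OF low_one]) (simp_all add: low_coeff_defs)
    then show ?thesis using 1 by simp
  next
    case 2
    have "lowE (b2/1680) (b4/120) (b6/840) 2 (2 * 1)"
      unfolding lowE_def by (rule low_eq[OF low_mult[OF low_numeral low_one]]) (simp_all add: low_coeff_defs)
    then show ?thesis using 2 by (simp add: g)
  next
    case 3
    have "lowO (b2/1680) (b4/120) (b6/840) 3 (G 3)"
      unfolding lowO_def g by (rule low_eq[OF low_pCons]) (simp_all add: low_coeff_defs)
    then show ?thesis using 3 by simp
  next
    case 4
    have "lowE (b2/1680) (b4/120) (b6/840) 4 (2 * G 4)"
      unfolding lowE_def g by (rule low_eq[OF low_mult[OF low_numeral low_pCons]]) (simp_all add: low_coeff_defs)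
    then show ?thesis using 4 by simp
  qed
next
  case (even m)
  note r = eds_even[OF even(1), of "[:4, b2, 2*b4, b6:]" "[:3, b2, 3*b4, 3*b6, b8:]" "[:2, b2, 5*b4, 10*b6, 10*b8, b2*b8 - b4*b6, b4*b8 - b6^2:]", folded G_def]
  have n: "of_nat (m + 2) = of_nat m + (2::complex)" "of_nat (m + 1) = of_nat m + (1::complex)"
    "of_nat (m - 2) = of_nat m - (2::complex)" "of_nat (m - 1) = of_nat m - (1::complex)" "of_nat (2 * m) = 2 * (of_nat m :: complex)"
    using even(1) by (auto simp: of_nat_diff)
  have par: "even (m+2) \<longleftrightarrow> even m" "even (m-2) \<longleftrightarrow> even m" "even (m+1) \<longleftrightarrow> odd m" "even (m-1) \<longleftrightarrow> odd m"
    using even(1) by presburger+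
  note IH = even.IH[unfolded n par]
  have res: "lowE p q r (2*M) P" if "low P' (2*(2*M)) (2*E1 p (2*M)) (2*E2 p q (2*M)) (2*E3 p q r (2*M))" "P' = 2 * P" for p q r M P P'
    unfolding lowE_def by (rule low_cancel[OF that(1)[unfolded that(2)]]) (simp_all add: numeral_poly)
  show ?case
  proof (cases "even m")
    case True
    have "low ((2 * G m) * ((2 * G (m+2)) * G (m-1)^2 - (2 * G (m-2)) * G (m+1)^2)) (2*(2 * of_nat m)) (2*E1 (b2/1680) (2 * of_nat m)) (2*E2 (b2/1680) (b4/120) (2 * of_nat m)) (2*E3 (b2/1680) (b4/120) (b6/840) (2 * of_nat m))"
      by (rule step_even_even) (use IH True in auto)
    moreover have "(2 * G m) * ((2 * G (m+2)) * G (m-1)^2 - (2 * G (m-2)) * G (m+1)^2) = 2 * (2 * G (2*m))"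
      unfolding r by algebra
    ultimately have "lowE (b2/1680) (b4/120) (b6/840) (2 * of_nat m) (2 * G (2*m))"
      by (rule res)
    then show ?thesis by (simp add: n)
  next
    case False
    have "low (G m * (G (m+2) * (2 * G (m-1))^2 - G (m-2) * (2 * G (m+1))^2)) (2*(2 * of_nat m)) (2*E1 (b2/1680) (2 * of_nat m)) (2*E2 (b2/1680) (b4/120) (2 * of_nat m)) (2*E3 (b2/1680) (b4/120) (b6/840) (2 * of_nat m))"
      by (rule step_even_odd) (use IH False in auto)
    moreover have "G m * (G (m+2) * (2 * G (m-1))^2 - G (m-2) * (2 * G (m+1))^2) = 2 * (2 * G (2*m))"
      unfolding r by algebra
    ultimately have "lowE (b2/1680) (b4/120) (b6/840) (2 * of_nat m) (2 * G (2*m))"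
      by (rule res)
    then show ?thesis by (simp add: n)
  qed
next
  case (odd m)
  note r = eds_odd[OF odd(1), of "[:4, b2, 2*b4, b6:]" "[:3, b2, 3*b4, 3*b6, b8:]" "[:2, b2, 5*b4, 10*b6, 10*b8, b2*b8 - b4*b6, b4*b8 - b6^2:]", folded G_def]
  have n: "of_nat (m + 2) = of_nat m + (2::complex)" "of_nat (m + 1) = of_nat m + (1::complex)"
    "of_nat (m - 1) = of_nat m - (1::complex)" "of_nat (2 * m + 1) = 2 * (of_nat m :: complex) + 1"
    using odd(1) by (auto simp: of_nat_diff)
  have par: "even (m+2) \<longleftrightarrow> even m" "even (m+1) \<longleftrightarrow> odd m" "even (m-1) \<longleftrightarrow> odd m"
    using odd(1) by presburger+
  note IH = odd.IH[unfolded n par]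
  let ?M = "of_nat m :: complex"
  \<comment> \<open>An opaque name keeps the coefficients of the cubic out of the polynomial
    identities that follow.\<close>
  obtain F where F_eq: "F = [:4, b2, 2*b4, b6:]" by simp
  note r = r [folded F_eq]
  have F: "lowF (b2/1680) (b4/120) (b6/840) F"
    unfolding F_eq lowF_def by (rule low_eq[OF low_pCons]) simp_all
  have res: "lowO p q r (2*M+1) P" if "low P' (16*(2*M+1)) (16*O1 p (2*M+1)) (16*O2 p q (2*M+1)) (16*O3 p q r (2*M+1))" "P' = 16 * P" for p q r M P P'
    unfolding lowO_def by (rule low_cancel[OF that(1)[unfolded that(2)]]) (simp_all add: numeral_poly)
  have "lowO (b2/1680) (b4/120) (b6/840) (2 * ?M + 1) (G (2*m+1))"
  proof (cases "even m")
    case True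
    have "low (F^2 * (2 * G (m+2)) * (2 * G m)^3 - 16 * (G (m-1) * G (m+1)^3)) (16*(2*?M+1)) (16*O1 (b2/1680) (2*?M+1))
       (16*O2 (b2/1680) (b4/120) (2*?M+1)) (16*O3 (b2/1680) (b4/120) (b6/840) (2*?M+1))"
      by (rule step_odd_even[OF _ _ _ _ F]) (use IH True in auto)
    then show ?thesis
      by (rule res) (simp only: r True if_True if_False, algebra)
  next
    case False
    have "low (16 * (G (m+2) * G m^3) - F^2 * (2 * G (m-1)) * (2 * G (m+1))^3) (16*(2*?M+1)) (16*O1 (b2/1680) (2*?M+1))
       (16*O2 (b2/1680) (b4/120) (2*?M+1)) (16*O3 (b2/1680) (b4/120) (b6/840) (2*?M+1))"
      by (rule step_odd_odd[OF _ _ _ _ F]) (use IH False in auto)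
    then show ?thesis
      by (rule res) (simp only: r False if_True if_False, algebra)
  qed
  then show ?case unfolding n by simp
qed

lemma power6_eq: "(x::complex)^6 = x*x*x*x*x*x"
  by (simp add: eval_nat_numeral)

lemma power5_eq: "(x::complex)^5 = x*x*x*x*x"
  by (simp add: eval_nat_numeral)

lemmas power_expand = power2_eq_square power3_eq_cube power4_eq_xxxx power6_eq

lemma divcoeff_odd:
  fixes N :: complex
  assumes "odd n" and N: "N = of_nat n"
  shows "divcoeff n 1 \<mu> = 0" "divcoeff n 3 \<mu> = 0" "divcoeff n 5 \<mu> = 0"
    "divcoeff n 2 \<mu> = 1/24 * N * (N^2 - 1) * \<mu> 1 ^ 2 + 1/6 * N * (N^2 - 1) * \<mu> 2"
    "divcoeff n 4 \<mu> = 1/1920 * N * (N^2 - 1) * (N^2 - 9) * \<mu> 1 ^ 4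
             + 1/240 * N * (N^2 - 1) * (N^2 - 9) * \<mu> 2 * \<mu> 1 ^ 2
             + 1/120 * N * (N^2 - 1) * (N^2 + 6) * \<mu> 3 * \<mu> 1
             + 1/120 * N * (N^2 - 1) * (N^2 - 9) * \<mu> 2 ^ 2
             + 1/60 * N * (N^2 - 1) * (N^2 + 6) * \<mu> 4"
    "divcoeff n 6 \<mu> = 1/322560 * N * (N^2 - 1) * (N^2 - 3^2) * (N^2 - 5^2) * \<mu> 1 ^ 6
             + 1/26880 * N * (N^2 - 1) * (N^2 - 3^2) * (N^2 - 5^2) * \<mu> 2 * \<mu> 1 ^ 4
             + 1/6720 * N * (N^2 - 1) * (N^2 - 3^2) * (N^2 + 10) * \<mu> 3 * \<mu> 1 ^ 3
             + 1/6720 * N * (N^2 - 1) * (N^2 - 3^2) * (N^2 - 5^2) * \<mu> 2 ^ 2 * \<mu> 1 ^ 2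
             + 1/3360 * N * (N^2 - 1) * (N^2 - 3^2) * (N^2 + 10) * \<mu> 4 * \<mu> 1 ^ 2
             + 1/1680 * N * (N^2 - 1) * (N^2 - 3^2) * (N^2 + 10) * \<mu> 3 * \<mu> 2 * \<mu> 1
             + 1/5040 * N * (N^2 - 1) * (N^2 - 3^2) * (N^2 - 5^2) * \<mu> 2 ^ 3
             + 1/840 * N * (N^2 - 1) * (N^2 - 3^2) * (N^2 + 10) * \<mu> 4 * \<mu> 2
             + 1/840 * N * (N^2 - 1) * (N^4 + N^2 + 15) * \<mu> 3 ^ 2
             + 1/210 * N * (N^2 - 1) * (N^4 + N^2 + 15) * \<mu> 6"
proof -
  define b2 b4 b6 where b: "b2 = \<mu> 1^2 + 4 * \<mu> 2" "b4 = 2 * \<mu> 4 + \<mu> 1 * \<mu> 3" "b6 = \<mu> 3^2 + 4 * \<mu> 6"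
  have "n \<ge> 1" using assms by presburger
  from low_eds[OF this, of b2 b4 b6 "\<mu> 1^2 * \<mu> 6 + 4 * \<mu> 2 * \<mu> 6 - \<mu> 1 * \<mu> 3 * \<mu> 4 + \<mu> 2 * \<mu> 3^2 - \<mu> 4^2"] \<open>odd n\<close>
  have "lowO (b2/1680) (b4/120) (b6/840) N (divpoly n \<mu>)"
    by (simp add: divpoly_def Let_def N b)
  then have c: "coeff (divpoly n \<mu>) 1 = O1 (b2/1680) N" "coeff (divpoly n \<mu>) 2 = O2 (b2/1680) (b4/120) N"
    "coeff (divpoly n \<mu>) 3 = O3 (b2/1680) (b4/120) (b6/840) N"
    by (auto simp: lowO_def low_def)
  show "divcoeff n 1 \<mu> = 0" "divcoeff n 3 \<mu> = 0" "divcoeff n 5 \<mu> = 0"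
    using assms by (auto simp: divcoeff_def)
  show "divcoeff n 2 \<mu> = 1/24 * N * (N^2 - 1) * \<mu> 1 ^ 2 + 1/6 * N * (N^2 - 1) * \<mu> 2"
  proof -
    have e: "divcoeff n 2 \<mu> = O1 (b2/1680) N"
      using \<open>odd n\<close> c(1) by (simp add: divcoeff_def)
    show ?thesis unfolding e O1_def b by (simp add: field_simps)
  qed
  have e: "divcoeff n 4 \<mu> = O2 (b2/1680) (b4/120) N" "divcoeff n 6 \<mu> = O3 (b2/1680) (b4/120) (b6/840) N"
    using \<open>odd n\<close> c by (simp_all add: divcoeff_def)
  \<comment> \<open>The products in N are treated as atoms, so that only polynomials in the \<mu>
    are expanded and compared.\<close>
  define A2 B2 A3 B3 C3 where opq: "A2 = N * (N^2 - 1) * (N^2 - 9)" "B2 = N * (N^2 - 1) * (N^2 + 6)"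
    "A3 = N * (N^2-1) * (N^2-9) * (N^2-25)" "B3 = N * (N^2-1) * (N^2-9) * (N^2+10)" "C3 = N * (N^2-1) * (N^4+N^2+15)"
  have opaque: "N * (N^2-1) * (N^2-9) = A2" "N * (N^2 - 1) * (N^2 + 6) = B2" "A2 * (N^2-25) = A3" "A2 * (N^2+10) = B3"
    "N * (N^2-1) * (N^4+N^2+15) = C3" "k * N * (N^2 - 1) * (N^2 - 9) = k * A2" "k * N * (N^2 - 1) * (N^2 + 6) = k * B2"
    "k * N * (N^2-1) * (N^2-3^2) = k * A2" "k * A2 * (N^2-5^2) = k * A3" "k * A2 * (N^2+10) = k * B3"
    "k * N * (N^2-1) * (N^4+N^2+15) = k * C3" for k
    by (simp_all add: opq mult.assoc)
  show "divcoeff n 4 \<mu> = 1/1920 * N * (N^2 - 1) * (N^2 - 9) * \<mu> 1 ^ 4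
             + 1/240 * N * (N^2 - 1) * (N^2 - 9) * \<mu> 2 * \<mu> 1 ^ 2
             + 1/120 * N * (N^2 - 1) * (N^2 + 6) * \<mu> 3 * \<mu> 1
             + 1/120 * N * (N^2 - 1) * (N^2 - 9) * \<mu> 2 ^ 2
             + 1/60 * N * (N^2 - 1) * (N^2 + 6) * \<mu> 4"
    "divcoeff n 6 \<mu> = 1/322560 * N * (N^2 - 1) * (N^2 - 3^2) * (N^2 - 5^2) * \<mu> 1 ^ 6
             + 1/26880 * N * (N^2 - 1) * (N^2 - 3^2) * (N^2 - 5^2) * \<mu> 2 * \<mu> 1 ^ 4
             + 1/6720 * N * (N^2 - 1) * (N^2 - 3^2) * (N^2 + 10) * \<mu> 3 * \<mu> 1 ^ 3
             + 1/6720 * N * (N^2 - 1) * (N^2 - 3^2) * (N^2 - 5^2) * \<mu> 2 ^ 2 * \<mu> 1 ^ 2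
             + 1/3360 * N * (N^2 - 1) * (N^2 - 3^2) * (N^2 + 10) * \<mu> 4 * \<mu> 1 ^ 2
             + 1/1680 * N * (N^2 - 1) * (N^2 - 3^2) * (N^2 + 10) * \<mu> 3 * \<mu> 2 * \<mu> 1
             + 1/5040 * N * (N^2 - 1) * (N^2 - 3^2) * (N^2 - 5^2) * \<mu> 2 ^ 3
             + 1/840 * N * (N^2 - 1) * (N^2 - 3^2) * (N^2 + 10) * \<mu> 4 * \<mu> 2
             + 1/840 * N * (N^2 - 1) * (N^4 + N^2 + 15) * \<mu> 3 ^ 2
             + 1/210 * N * (N^2 - 1) * (N^4 + N^2 + 15) * \<mu> 6"
    unfolding e O2_def O3_def b by (simp_all only: opaque) (simp_all add: power_expand algebra_simps add_divide_distrib)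
qed

lemma divcoeff_even:
  fixes N :: complex
  assumes "even n" "n \<ge> 2" and N: "N = of_nat n"
  shows "divcoeff n 1 \<mu> = - 1/2 * N * \<mu> 1"
       "divcoeff n 2 \<mu> = - 1/24 * N * (N^2 - 2^2) * \<mu> 1 ^ 2 - 1/6 * N * (N^2 - 2^2) * \<mu> 2"
       "divcoeff n 3 \<mu> = - 1/48 * N * (N^2 - 2^2) * \<mu> 1 ^ 3
             - 1/12 * N * (N^2 - 2^2) * \<mu> 2 * \<mu> 1
             - 1/2 * N * \<mu> 3"
       "divcoeff n 4 \<mu> = - 1/1920 * N * (N^2 - 2^2) * (N^2 - 4^2) * \<mu> 1 ^ 4
             - 1/240 * N * (N^2 - 2^2) * (N^2 - 4^2) * \<mu> 2 * \<mu> 1 ^ 2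
             - 1/120 * N * (N^2 - 2^2) * (N^2 + 9) * \<mu> 3 * \<mu> 1
             - 1/120 * N * (N^2 - 2^2) * (N^2 - 4^2) * \<mu> 2 ^ 2
             - 1/60 * N * (N^2 - 2^2) * (N^2 + 9) * \<mu> 4"
       "divcoeff n 5 \<mu> = - 1/3840 * N * (N^2 - 2^2) * (N^2 - 4^2) * \<mu> 1 ^ 5
             - 1/480 * N * (N^2 - 2^2) * (N^2 - 4^2) * \<mu> 2 * \<mu> 1 ^ 3
             - 1/240 * N * (N^2 - 2^2) * (N^2 + 14) * \<mu> 3 * \<mu> 1 ^ 2
             - 1/240 * N * (N^2 - 2^2) * (N^2 - 4^2) * \<mu> 2 ^ 2 * \<mu> 1
             - 1/120 * N * (N^2 - 2^2) * (N^2 + 9) * \<mu> 4 * \<mu> 1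
             - 1/12 * N * (N^2 - 2^2) * \<mu> 3 * \<mu> 2"
proof -
  define b2 b4 b6 where b: "b2 = \<mu> 1^2 + 4 * \<mu> 2" "b4 = 2 * \<mu> 4 + \<mu> 1 * \<mu> 3" "b6 = \<mu> 3^2 + 4 * \<mu> 6"
  have "n \<ge> 1" using assms by presburger
  from low_eds[OF this, of b2 b4 b6 "\<mu> 1^2 * \<mu> 6 + 4 * \<mu> 2 * \<mu> 6 - \<mu> 1 * \<mu> 3 * \<mu> 4 + \<mu> 2 * \<mu> 3^2 - \<mu> 4^2"] \<open>even n\<close>
  have "lowE (b2/1680) (b4/120) (b6/840) N (2 * divpoly n \<mu>)"
    by (simp add: divpoly_def Let_def N b)
  moreover have "coeff (2 * divpoly n \<mu>) k = 2 * coeff (divpoly n \<mu>) k" for k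
    by (simp add: numeral_poly)
  ultimately have "2 * coeff (divpoly n \<mu>) 0 = N" "2 * coeff (divpoly n \<mu>) 1 = E1 (b2/1680) N" "2 * coeff (divpoly n \<mu>) 2 = E2 (b2/1680) (b4/120) N"
    unfolding lowE_def low_def by metis+
  moreover have "z = e / 2" if "2 * z = e" for z e :: complex using that by auto
  ultimately have c: "coeff (divpoly n \<mu>) 0 = N / 2" "coeff (divpoly n \<mu>) 1 = E1 (b2/1680) N / 2" "coeff (divpoly n \<mu>) 2 = E2 (b2/1680) (b4/120) N / 2"
    by blast+
  have e: "divcoeff n 1 \<mu> = - (\<mu> 1 * (N / 2))" "divcoeff n 2 \<mu> = - E1 (b2/1680) N"
    "divcoeff n 3 \<mu> = - (\<mu> 1 * (E1 (b2/1680) N / 2) + \<mu> 3 * (N / 2))" "divcoeff n 4 \<mu> = - E2 (b2/1680) (b4/120) N"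
    using \<open>even n\<close> by (simp_all add: divcoeff_def c[unfolded One_nat_def])
  have e5: "divcoeff n 5 \<mu> = - (\<mu> 1 * (E2 (b2/1680) (b4/120) N / 2) + \<mu> 3 * (E1 (b2/1680) N / 2))"
  proof -
    have "coeff (pCons 0 (divpoly n \<mu>)) 2 = coeff (divpoly n \<mu>) 1" by (simp add: numeral_2_eq_2)
    then show ?thesis using \<open>even n\<close> by (simp add: divcoeff_def c[unfolded One_nat_def])
  qed
  \<comment> \<open>The last of the rules below accounts for the factor N^2 + 14 = (N^2 + 9) + 5:
    the monomial in \<mu> 3 and the square of \<mu> 1 arises both from \<mu> 1 times the
    \<open>b4\<close> term and from \<mu> 3 times the \<open>b2\<close> term.\<close>
  define D A B where opq: "D = N * (N^2 - 4)" "A = N * (N^2 - 4) * (N^2 - 16)" "B = N * (N^2 - 4) * (N^2 + 9)"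
  have opaque: "N * (N^2 - 4) = D" "D * (N^2 - 16) = A" "D * (N^2 + 9) = B" "k * N * (N^2 - 2^2) = k * D"
    "k * D * (N^2 - 4^2) = k * A" "k * D * (N^2 + 9) = k * B"
    "k * D * (N^2 + 14) = k * (B + 5 * D)" for k
    by (simp_all add: opq mult.assoc) (simp add: algebra_simps)
  show "divcoeff n 1 \<mu> = - 1/2 * N * \<mu> 1"
       "divcoeff n 2 \<mu> = - 1/24 * N * (N^2 - 2^2) * \<mu> 1 ^ 2 - 1/6 * N * (N^2 - 2^2) * \<mu> 2"
       "divcoeff n 3 \<mu> = - 1/48 * N * (N^2 - 2^2) * \<mu> 1 ^ 3
             - 1/12 * N * (N^2 - 2^2) * \<mu> 2 * \<mu> 1
             - 1/2 * N * \<mu> 3"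
       "divcoeff n 4 \<mu> = - 1/1920 * N * (N^2 - 2^2) * (N^2 - 4^2) * \<mu> 1 ^ 4
             - 1/240 * N * (N^2 - 2^2) * (N^2 - 4^2) * \<mu> 2 * \<mu> 1 ^ 2
             - 1/120 * N * (N^2 - 2^2) * (N^2 + 9) * \<mu> 3 * \<mu> 1
             - 1/120 * N * (N^2 - 2^2) * (N^2 - 4^2) * \<mu> 2 ^ 2
             - 1/60 * N * (N^2 - 2^2) * (N^2 + 9) * \<mu> 4"
       "divcoeff n 5 \<mu> = - 1/3840 * N * (N^2 - 2^2) * (N^2 - 4^2) * \<mu> 1 ^ 5
             - 1/480 * N * (N^2 - 2^2) * (N^2 - 4^2) * \<mu> 2 * \<mu> 1 ^ 3
             - 1/240 * N * (N^2 - 2^2) * (N^2 + 14) * \<mu> 3 * \<mu> 1 ^ 2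
             - 1/240 * N * (N^2 - 2^2) * (N^2 - 4^2) * \<mu> 2 ^ 2 * \<mu> 1
             - 1/120 * N * (N^2 - 2^2) * (N^2 + 9) * \<mu> 4 * \<mu> 1
             - 1/12 * N * (N^2 - 2^2) * \<mu> 3 * \<mu> 2"
    unfolding e e5 E1_def E2_def b
    by (simp_all only: opaque) (simp_all add: power_expand power5_eq algebra_simps add_divide_distrib)
qed

section \<open>Matching the prescribed shape of the division polynomials\<close>

lemma sum_pairs_odd: fixes w :: nat shows "(\<Sum>j=1..2*w. h j) = (\<Sum>k=1..w. h (2*k-1) + (h (2*k) :: complex))"
  by (induction w) (simp_all add: add_ac)

lemma sum_pairs_even: fixes w :: nat shows "(\<Sum>j=1..2*w+3. h j) = h 1 + (\<Sum>k=1..w+1. h (2*k) + (h (2*k+1) :: complex))"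
  by (induction w) (simp_all add: add_ac numeral_3_eq_3 numeral_2_eq_2)

text \<open>After pairing consecutive indices, for even n every coefficient is met three times: with
  factor -2 beside y, with - \<mu> 1 one power of x higher, and with - \<mu> 3 in the next pair.
  These are the three summands of the factor in front.\<close>

lemma division_form_divcoeff:
  assumes "n \<ge> 2"
  shows "division_form n (\<lambda>j. divcoeff n j \<mu>) x y =
    (if odd n then 1 else - (2 * y + \<mu> 1 * x + \<mu> 3)) * (\<Sum>k\<le>wt n. coeff (divpoly n \<mu>) k * x ^ (wt n - k))"
proof -
  define c where "c = coeff (divpoly n \<mu>)"
  define w where "w = wt n"
  have c0: "c 0 = (if odd n then of_nat n else of_nat n / 2)"
    using low_eds[of n "\<mu> 1^2 + 4 * \<mu> 2" "2 * \<mu> 4 + \<mu> 1 * \<mu> 3" "\<mu> 3^2 + 4 * \<mu> 6" "\<mu> 1^2 * \<mu> 6 + 4 * \<mu> 2 * \<mu> 6 - \<mu> 1 * \<mu> 3 * \<mu> 4 + \<mu> 2 * \<mu> 3^2 - \<mu> 4^2"] assms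
    by (auto simp: c_def divpoly_def Let_def lowE_def lowO_def low_def numeral_poly)
  have "degree (divpoly n \<mu>) \<le> w"
    unfolding divpoly_def Let_def w_def using assms
    by (intro degree_eds) (auto intro: order.trans[OF degree_pCons_le])
  \<comment> \<open>The last index n^2 - 1 equals 2 (w + 1) + 1 for even n, so it asks for the
    coefficient of degree w + 1, which lies beyond the degree.\<close>
  then have cw: "c (Suc w) = 0" by (simp add: c_def coeff_eq_0)
  have S: "(\<Sum>k\<le>w. c k * x ^ (w - k)) = c 0 * x^w + (\<Sum>k=1..w. c k * x ^ (w - k))"
  proof -
    have "{..w} = insert 0 {1..w}" by auto
    then show ?thesis by simp
  qed
  show ?thesis
  proof (cases "odd n")
    case True
    then obtain j where j: "n = 2*j+1" using oddE by blast
    have w1: "w = 2*j*(j+1)" unfolding w_def j by (rule wt_odd)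
    have w: "n^2 = 2*w + 1" unfolding j w1 by (simp_all add: power2_eq_square algebra_simps)
    have "division_form n (\<lambda>j. divcoeff n j \<mu>) x y =
       of_nat n * x^w + (\<Sum>k=1..w. (c k * x ^ (w - k)))"
      using True unfolding division_form_def w add_diff_cancel_right' sum_pairs_odd
      by (auto intro!: sum.cong arg_cong2[where f = "(+)"] simp: divcoeff_def c_def simp flip: diff_mult_distrib2)
    then show ?thesis using True S c0 by (simp add: w_def c_def)
  next
    case False
    have "n = 2 * (n div 2 - 1) + 2" using False assms by presburger
    then obtain j where j: "n = 2*j+2" by blast
    have w1: "w = 2*j*(j+2)" unfolding w_def j by (rule wt_even)
    have w: "n^2 = 2*w + 4" unfolding j w1 by (simp_all add: power2_eq_square algebra_simps)
    have w': "2*w+4-1 = 2*w+3" by simp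
    let ?d = "\<lambda>k. divcoeff n k \<mu>"
    have d: "?d (2*k) = - 2 * c k" "?d (2*k+1) = - (\<mu> 1 * c k + (if k = 0 then 0 else \<mu> 3 * c (k - 1)))" for k
      using False by (auto simp: divcoeff_def c_def coeff_pCons split: nat.split)
    have "division_form n ?d x y =
       - of_nat n * x^w * y + (- \<mu> 1 * c 0 * x^(w+1) + (\<Sum>k=1..w+1. (if k \<le> w then - 2 * c k * x ^ (w - k) * y else 0)
           + - (\<mu> 1 * c k + \<mu> 3 * c (k - 1)) * x ^ (w+1-k)))"
    proof -
      have h: "(Suc (Suc (2 * w)) - 2 * k) div 2 = Suc w - k" "(2 * w - 2 * k) div 2 = w - k" for k
        by presburger+
      show ?thesis
        using False d[of 0] d(2) unfolding division_form_def w w' sum_pairs_even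
        by (auto intro!: sum.cong arg_cong2[where f = "(+)"] simp: d(1) h)
    qed
    also have "\<dots> = - 2 * y * (c 0 * x^w + (\<Sum>k=1..w. c k * x ^ (w-k))) - \<mu> 1 * (c 0 * x^(w+1) + (\<Sum>k=1..w. c k * x^(w+1-k)))
        - \<mu> 3 * (\<Sum>k=1..w+1. c (k-1) * x^(w+1-k))"
    proof -
      have "(\<Sum>k=1..w+1. (if k \<le> w then - 2 * c k * x ^ (w - k) * y else 0)) = - 2 * y * (\<Sum>k=1..w. c k * x ^ (w-k))"
        by (auto simp: sum_distrib_left intro!: sum.cong)
      moreover have "(\<Sum>k=1..w+1. - (\<mu> 1 * c k + \<mu> 3 * c (k - 1)) * x ^ (w+1-k)) =
         - \<mu> 1 * (\<Sum>k=1..w+1. c k * x^(w+1-k)) - \<mu> 3 * (\<Sum>k=1..w+1. c (k-1) * x^(w+1-k))"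
        by (simp only: sum_distrib_left sum_subtractf [symmetric]) (auto intro!: sum.cong simp: algebra_simps)
      moreover have "(\<Sum>k=1..w+1. c k * x^(w+1-k)) = (\<Sum>k=1..w. c k * x^(w+1-k))"
        using cw by simp
      ultimately show ?thesis using c0 False by (simp only: sum.distrib) (simp add: algebra_simps)
    qed
    also have "(\<Sum>k=1..w+1. c (k-1) * x^(w+1-k)) = (\<Sum>k\<le>w. c k * x^(w-k))"
      by (rule sum.reindex_bij_witness[of _ Suc "\<lambda>k. k-1"]) auto
    also have "c 0 * x^(w+1) + (\<Sum>k=1..w. c k * x^(w+1-k)) = x * (\<Sum>k\<le>w. c k * x^(w-k))"
      unfolding S by (auto simp: sum_distrib_left algebra_simps Suc_diff_le intro!: sum.cong)
    finally have df: "division_form n ?d x y = - 2 * y * (c 0 * x^w + (\<Sum>k=1..w. c k * x ^ (w-k))) - \<mu> 1 * (x * (\<Sum>k\<le>w. c k * x^(w-k)))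
        - \<mu> 3 * (\<Sum>k\<le>w. c k * x^(w-k))" .
    have "division_form n ?d x y = - (2 * y + \<mu> 1 * x + \<mu> 3) * (\<Sum>k\<le>w. c k * x^(w-k))"
    proof -
      have "- 2 * y * T - a * (x * T) - b * T = - (2 * y + a * x + b) * T" for a b T by (simp add: algebra_simps)
      then show ?thesis unfolding df S[symmetric] by metis
    qed
    then show ?thesis using False by (simp add: w_def c_def)
  qed
qed

theorem division_form_eq_eds:
  fixes x y :: complex
  assumes "n \<ge> 2"
  defines "b2 \<equiv> \<lambda>\<mu> :: nat \<Rightarrow> complex. \<mu> 1^2 + 4 * \<mu> 2" and "b4 \<equiv> \<lambda>\<mu> :: nat \<Rightarrow> complex. 2 * \<mu> 4 + \<mu> 1 * \<mu> 3" and "b6 \<equiv> \<lambda>\<mu> :: nat \<Rightarrow> complex. \<mu> 3^2 + 4 * \<mu> 6"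
   and "b8 \<equiv> \<lambda>\<mu>. \<mu> 1^2 * \<mu> 6 + 4 * \<mu> 2 * \<mu> 6 - \<mu> 1 * \<mu> 3 * \<mu> 4 + \<mu> 2 * \<mu> 3^2 - \<mu> 4^2"
  shows "division_form n (\<lambda>j. divcoeff n j \<mu>) x y =
    (if odd n then 1 else - (2 * y + \<mu> 1 * x + \<mu> 3)) *
      eds (4*x^3 + b2 \<mu>*x^2 + 2*b4 \<mu>*x + b6 \<mu>) (3*x^4 + b2 \<mu>*x^3 + 3*b4 \<mu>*x^2 + 3*b6 \<mu>*x + b8 \<mu>)
     (2*x^6 + b2 \<mu>*x^5 + 5*b4 \<mu>*x^4 + 10*b6 \<mu>*x^3 + 10*b8 \<mu>*x^2 + (b2 \<mu>*b8 \<mu> - b4 \<mu>*b6 \<mu>)*x + (b4 \<mu>*b8 \<mu> - b6 \<mu>^2)) n"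
proof -
  have "n \<ge> 1" using assms by simp
  show ?thesis
    unfolding division_form_divcoeff[OF assms(1)] eds_eval_eq_sum[OF \<open>n \<ge> 1\<close>] by (simp add: divpoly_def Let_def b2_def b4_def b6_def b8_def)
qed

section \<open>The Weierstrass function of a cubic\<close>

text \<open>The second polynomial is half the derivative of the first, so the roots of the cubic are
  simple. It will also be the right-hand side of the second-order equation of
  \<open>x\<close>.\<close>

locale weierstrass_cubic =
  fixes b2 b4 b6 :: complex
  assumes no_double_root: "4 * e^3 + b2 * e^2 + 2 * b4 * e + b6 = 0 \<Longrightarrow> 6 * e^2 + b2 * e + b4 \<noteq> 0"
begin

definition b8 where "b8 = (b2 * b6 - b4^2) / 4"

definition cubic :: "complex \<Rightarrow> complex" where "cubic x = 4 * x^3 + b2 * x^2 + 2 * b4 * x + b6"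
definition quad :: "complex \<Rightarrow> complex" where "quad x = 6 * x^2 + b2 * x + b4"
definition quart :: "complex \<Rightarrow> complex" where "quart x = x^4 - b4 * x^2 - 2 * b6 * x - b8"

text \<open>The cubic and the numerator of the duplication formula in the coordinate \<open>x = 1 / s\<^sup>2\<close> at infinity.\<close>

definition rcubic :: "complex \<Rightarrow> complex" where "rcubic s = 1 + b2/4 * s^2 + b4/2 * s^4 + b6/4 * s^6"
definition rquart :: "complex \<Rightarrow> complex" where "rquart s = 1 - b4 * s^4 - 2 * b6 * s^6 - b8 * s^8"

text \<open>The tangent form of the duplication formula cleared of denominators. It shows at once
  that \<open>quart\<close> and \<open>cubic\<close> have no common zero, as such a zero would be a
  root of \<open>quad\<close> too.\<close>

lemma quart_eq: "4 * quart x = (quad x)^2 - (b2 + 8 * x) * cubic x"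
  by (simp add: quart_def quad_def cubic_def b8_def) algebra

text \<open>\<open>S\<close> inverts \<open>U\<close>, the integral of ds over the square root of
  \<open>rcubic s\<close>, on a disc where \<open>rcubic\<close> stays off the branch cut. The final
  clause is uniqueness for the squared equation: the condition on the derivative at 0 selects the
  root, and then \<open>U (t u) - u\<close> is constant.\<close>

lemma local_inverse:
  obtains S r where "r > 0" "S holomorphic_on ball 0 r" "S 0 = 0" "deriv S 0 = 1"
    "\<And>u. u \<in> ball 0 r \<Longrightarrow> S u = 0 \<Longrightarrow> u = 0"
    "\<And>u. u \<in> ball 0 r \<Longrightarrow> S (- u) = - S u"
    "\<And>u. u \<in> ball 0 r \<Longrightarrow> (deriv S u)^2 = rcubic (S u)"
    "\<And>u. u \<in> ball 0 r \<Longrightarrow> deriv S u \<noteq> 0"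
    "\<And>t \<rho>. \<rho> > 0 \<Longrightarrow> t holomorphic_on ball 0 \<rho> \<Longrightarrow> t 0 = 0 \<Longrightarrow> deriv t 0 = 1 \<Longrightarrow>
       (\<And>u. u \<in> ball 0 \<rho> \<Longrightarrow> (deriv t u)^2 = rcubic (t u)) \<Longrightarrow> \<forall>\<^sub>F u in nhds 0. t u = S u"
proof -
  have cont: "isCont rcubic 0" unfolding rcubic_def by (intro continuous_intros)
  then have "(rcubic \<longlongrightarrow> 1) (nhds 0)" by (simp add: isCont_def tendsto_nhds_iff rcubic_def)
  then have "\<forall>\<^sub>F s in nhds 0. dist (rcubic s) 1 < 1" by (rule tendstoD) simp
  then obtain r0 where r0: "r0 > 0" "\<And>s. s \<in> ball 0 r0 \<Longrightarrow> dist (rcubic s) 1 < 1"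
    unfolding eventually_nhds_metric by (auto simp: dist_commute)
  have nonneg: "rcubic s \<notin> \<real>\<^sub>\<le>\<^sub>0" if "s \<in> ball 0 r0" for s
  proof
    assume "rcubic s \<in> \<real>\<^sub>\<le>\<^sub>0"
    then have "Re (rcubic s - 1) \<le> -1" by (simp add: complex_nonpos_Reals_iff)
    then have "norm (rcubic s - 1) \<ge> 1" using abs_Re_le_cmod[of "rcubic s - 1"] by linarith
    then show False using r0(2)[OF that] by (simp add: dist_norm)
  qed
  define k where "k = (\<lambda>s. 1 / csqrt (rcubic s))"
  have nz: "csqrt (rcubic s) \<noteq> 0" if "s \<in> ball 0 r0" for s
    using nonneg[OF that] by auto
  have rhol: "rcubic holomorphic_on A" for A unfolding rcubic_def by (intro holomorphic_intros)
  have k: "k holomorphic_on ball 0 r0"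
    unfolding k_def using nonneg nz by (intro holomorphic_intros holomorphic_on_csqrt' rhol) auto
  obtain U0 where U0: "\<And>s. s \<in> ball 0 r0 \<Longrightarrow> (U0 has_field_derivative k s) (at s within ball 0 r0)"
    using holomorphic_convex_primitive'[OF convex_ball open_ball k] by metis
  define U where "U = (\<lambda>s. U0 s - U0 0)"
  have U: "(U has_field_derivative k s) (at s)" if "s \<in> ball 0 r0" for s
    using U0[OF that] that unfolding U_def by (auto intro!: derivative_eq_intros simp: at_within_open[OF that open_ball])
  have U_0: "U 0 = 0" by (simp add: U_def)
  have U_hol: "U holomorphic_on ball 0 r0"
    unfolding holomorphic_on_open[OF open_ball] using U by blast
  have even: "k (- s) = k s" for s by (simp add: k_def rcubic_def)
  \<comment> \<open>The integrand is even, so its primitive vanishing at 0 is odd; this is the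
    source of the evenness of \<open>x\<close>.\<close>
  have odd: "U (- s) = - U s" if "s \<in> ball 0 r0" for s
  proof -
    have "((\<lambda>s. U s + U (- s)) has_field_derivative 0) (at s within ball 0 r0)" if s: "s \<in> ball 0 r0" for s
    proof -
      have "((\<lambda>s. U (- s)) has_field_derivative (k (- s) * (-1))) (at s)"
        by (rule DERIV_chain2[OF U]) (use s in \<open>auto intro!: derivative_eq_intros\<close>)
      from DERIV_add[OF U[OF s] this] show ?thesis by (simp add: even has_field_derivative_at_within)
    qed
    then have "\<exists>c. \<forall>s\<in>ball 0 r0. U s + U (- s) = c"
      by (intro has_field_derivative_zero_constant) auto
    then obtain c where c: "\<forall>s\<in>ball 0 r0. U s + U (- s) = c" by blast
    have "0 \<in> ball (0::complex) r0" using r0(1) by simp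
    from bspec[OF c that] bspec[OF c this] have "U s + U (- s) = c" "U 0 + U (- 0) = c" .
    then have "U (- s) + U s = 0" by (simp add: U_0 add.commute)
    then show ?thesis by (rule eq_neg_iff_add_eq_0[THEN iffD2])
  qed
  have k0: "k 0 = 1" by (simp add: k_def rcubic_def)
  have in0: "0 \<in> ball (0::complex) r0" using r0(1) by simp
  have dU: "deriv U 0 \<noteq> 0" using DERIV_imp_deriv[OF U[OF in0]] by (simp add: k0)
  obtain r1 where r1: "r1 > 0" "ball (0::complex) r1 \<subseteq> ball 0 r0" "inj_on U (ball 0 r1)"
    by (rule has_complex_derivative_locally_injective[OF U_hol in0 open_ball dU]) (rule that)
  have U_hol1: "U holomorphic_on ball 0 r1" using U_hol r1(2) by (rule holomorphic_on_subset)
  obtain S where S: "S holomorphic_on (U ` ball 0 r1)"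
      "\<And>z. z \<in> ball 0 r1 \<Longrightarrow> deriv U z * deriv S (U z) = 1" "\<And>z. z \<in> ball 0 r1 \<Longrightarrow> S (U z) = z"
    using holomorphic_has_inverse[OF U_hol1 open_ball r1(3)] by metis
  have "open (U ` ball 0 r1)" by (rule open_mapping_thm3[OF U_hol1 open_ball r1(3)])
  moreover have "0 \<in> U ` ball 0 r1" using r1(1) U_0 by (intro image_eqI[of _ _ 0]) auto
  ultimately obtain r where r: "r > 0" "ball 0 r \<subseteq> U ` ball 0 r1" by (meson open_contains_ball)
  have key: "S u \<in> ball 0 r1 \<and> U (S u) = u \<and> deriv S u = csqrt (rcubic (S u))" if uu: "u \<in> ball 0 r" for u
  proof -
    obtain s where s: "s \<in> ball 0 r1" "u = U s" using r(2) uu by blast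
    have "deriv U s = k s" using U s r1(2) by (intro DERIV_imp_deriv) blast
    then show ?thesis using s S(2)[OF s(1)] S(3)[OF s(1)] nz[of s] r1(2) by (auto simp: k_def field_simps)
  qed
  show ?thesis
  proof (rule that[of r S])
    show "r > 0" by fact
    show "S holomorphic_on ball 0 r" using S(1) r(2) by (rule holomorphic_on_subset)
    show S0: "S 0 = 0" using S(3)[of 0] r1(1) U_0 by simp
    show "deriv S 0 = 1" using key[of 0] r(1) by (simp add: S0 rcubic_def)
    show "u = 0" if "u \<in> ball 0 r" "S u = 0" for u using key[OF that(1)] that(2) U_0 by simp
    show "S (- u) = - S u" if "u \<in> ball 0 r" for u
    proof -
      have "U (- S u) = - u" using key[OF that] odd r1(2) by auto
      then show ?thesis using S(3)[of "- S u"] key[OF that] by auto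
    qed
    show "(deriv S u)^2 = rcubic (S u)" if "u \<in> ball 0 r" for u using key[OF that] by simp
    show "deriv S u \<noteq> 0" if "u \<in> ball 0 r" for u using key[OF that] nz r1(2) by auto
    fix t :: "complex \<Rightarrow> complex" and \<rho> :: real
    assume \<rho>: "\<rho> > 0" and t: "t holomorphic_on ball 0 \<rho>" "t 0 = 0" "deriv t 0 = 1"
      and ode: "\<And>u. u \<in> ball 0 \<rho> \<Longrightarrow> (deriv t u)^2 = rcubic (t u)"
    have "isCont t 0" "isCont (deriv t) 0"
      using t(1) \<rho> holomorphic_deriv[OF t(1)] holomorphic_on_imp_continuous_on[of _ "ball 0 \<rho>"]
      by (auto simp: continuous_on_eq_continuous_at)
    then have lims: "(t \<longlongrightarrow> 0) (nhds 0)" "(deriv t \<longlongrightarrow> 1) (nhds 0)"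
      using t by (auto simp: isCont_def tendsto_nhds_iff)
    note tendstoD[OF lims(1) r1(1)] tendstoD[OF lims(2) zero_less_one]
    moreover have "\<forall>\<^sub>F u in nhds 0. u \<in> ball 0 \<rho>" using \<rho> by (intro eventually_nhds_in_open) auto
    ultimately have "\<forall>\<^sub>F u in nhds 0. dist (t u) 0 < r1 \<and> dist (deriv t u) 1 < 1 \<and> u \<in> ball 0 \<rho>"
      by eventually_elim auto
    then obtain d where d: "d > 0" "\<And>u. u \<in> ball 0 d \<Longrightarrow> dist (t u) 0 < r1 \<and> dist (deriv t u) 1 < 1 \<and> u \<in> ball 0 \<rho>"
      unfolding eventually_nhds_metric by (auto simp: dist_commute)
    have der: "((\<lambda>u. U (t u) - u) has_field_derivative 0) (at u within ball 0 d)" if u: "u \<in> ball 0 d" for u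
    proof -
      have tu: "t u \<in> ball 0 r1" "u \<in> ball 0 \<rho>" using d(2)[OF u] by auto
      \<comment> \<open>A derivative within distance 1 of 1 has positive real part, hence is the
        principal root of its square.\<close>
      have "Re (1 - deriv t u) < 1" using d(2)[OF u] complex_Re_le_cmod[of "1 - deriv t u"] by (auto simp: dist_norm norm_minus_commute)
      then have "deriv t u = csqrt (rcubic (t u))"
        unfolding ode[OF tu(2), symmetric] by (simp add: csqrt_square)
      moreover have "(t has_field_derivative deriv t u) (at u)"
        using t(1) tu by (simp add: holomorphic_derivI)
      then have "((\<lambda>u. U (t u)) has_field_derivative (k (t u) * deriv t u)) (at u)"
        using tu r1(2) by (intro DERIV_chain2[OF U]) auto
      ultimately have "((\<lambda>u. U (t u)) has_field_derivative 1) (at u)"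
        using nz[of "t u"] tu r1(2) by (auto simp: k_def)
      from DERIV_diff[OF this DERIV_ident] show ?thesis by (simp add: has_field_derivative_at_within)
    qed
    have "\<exists>c. \<forall>u\<in>ball 0 d. U (t u) - u = c"
      by (intro has_field_derivative_zero_constant der) auto
    then obtain c where c: "\<forall>u\<in>ball 0 d. U (t u) - u = c" by blast
    have "(0::complex) \<in> ball 0 d" using d(1) by simp
    from bspec[OF c this] have "U (t 0) - 0 = c" .
    then have "c = 0" using t U_0 by simp
    have "t u = S u" if "u \<in> ball 0 d" for u
    proof -
      have "U (t u) = u" using bspec[OF c that] \<open>c = 0\<close> by simp
      moreover have "t u \<in> ball 0 r1" using d(2)[OF that] by (simp add: dist_commute)
      ultimately show ?thesis using S(3)[of "t u"] by simp
    qed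
    then show "\<forall>\<^sub>F u in nhds 0. t u = S u"
      using d(1) by (auto simp: eventually_nhds_metric dist_commute intro!: exI[of _ d])
  qed
qed

text \<open>If \<open>p ^ 2 = Q\<close>, the left side is the square of the numerator of the
  derivative of \<open>2 s p\<close> divided by a root of N. The right side is
  \<open>N ^ 3 * rcubic z\<close> for \<open>z ^ 2 = 4 s ^ 2 Q / N\<close>. Thus doubling reproduces
  the differential equation.\<close>

lemma duplication_identity:
  fixes s :: complex
  defines "Q \<equiv> rcubic s" and "Q' \<equiv> b2/2 * s + 2 * b4 * s^3 + 3 * b6 / 2 * s^5"
    and "N \<equiv> rquart s" and "N' \<equiv> - 4 * b4 * s^3 - 12 * b6 * s^5 - 8 * b8 * s^7"
  shows "((Q + s * Q' / 2) * N - s * Q * N' / 2)^2 = N^3 + b2 * s^2 * Q * N^2 + 8 * b4 * s^4 * Q^2 * N + 16 * b6 * s^6 * Q^3"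
proof -
  obtain p q r where b: "b2 = 4 * p" "b4 = 2 * q" "b6 = 4 * r" using that[of "b2/4" "b4/2" "b6/4"] by simp
  have b8: "b8 = 4 * p * r - q^2" unfolding b8_def unfolding b by (simp add: field_simps power2_eq_square)
  have Q: "Q = 1 + p * s^2 + q * s^4 + r * s^6" unfolding Q_def unfolding rcubic_def unfolding b by simp
  have Q': "Q' / 2 = p * s + 2 * q * s^3 + 3 * r * s^5" unfolding Q'_def b by (simp add: add_divide_distrib)
  have N: "N = 1 - 2 * q * s^4 - 8 * r * s^6 - (4 * p * r - q^2) * s^8" unfolding N_def unfolding rquart_def unfolding b8 unfolding b by simp
  have N': "N' / 2 = - 4 * q * s^3 - 24 * r * s^5 - 4 * (4 * p * r - q^2) * s^7" unfolding N'_def unfolding b8 unfolding b by (simp add: diff_divide_distrib algebra_simps)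
  have "((Q + s * (Q' / 2)) * N - s * Q * (N' / 2))^2 = N^3 + b2 * s^2 * Q * N^2 + 8 * b4 * s^4 * Q^2 * N + 16 * b6 * s^6 * Q^3"
    unfolding Q Q' N N' unfolding b by algebra
  then show ?thesis by simp
qed

text \<open>The map from a to \<open>quart a / cubic a\<close> in homogeneous coordinates with a = A
  / B.\<close>

definition dupl :: "complex \<times> complex \<Rightarrow> complex \<times> complex" where
  "dupl = (\<lambda>(A, B). (A^4 - b4 * A^2 * B^2 - 2 * b6 * A * B^3 - b8 * B^4,
                  B * (4 * A^3 + b2 * A^2 * B + 2 * b4 * A * B^2 + b6 * B^3)))"

text \<open>A common zero of \<open>cubic\<close> and \<open>quart\<close> would be a double root of
  the cubic, so the duplication map has no point of indeterminacy.\<close>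

lemma dupl_nonzero: "dupl p = (0, 0) \<Longrightarrow> p = (0, 0)"
proof -
  assume d: "dupl p = (0, 0)"
  obtain A B where p: "p = (A, B)" by force
  show ?thesis
  proof (cases "B = 0")
    case True
    then show ?thesis using d by (simp add: p dupl_def)
  next
    case False
    have "cubic (A / B) * B^3 = 4 * A^3 + b2 * A^2 * B + 2 * b4 * A * B^2 + b6 * B^3"
      "quart (A / B) * B^4 = A^4 - b4 * A^2 * B^2 - 2 * b6 * A * B^3 - b8 * B^4"
      using False by (simp_all add: cubic_def quart_def field_simps eval_nat_numeral)
    then have "cubic (A / B) = 0" "quart (A / B) = 0" using d False by (auto simp: p dupl_def)
    then show ?thesis using quart_eq[of "A / B"] no_double_root[of "A / B"] by (auto simp: cubic_def quad_def)
  qed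
qed

lemma dupl_scale: "dupl (c * A, c * B) = (c^4 * fst (dupl (A, B)), c^4 * snd (dupl (A, B)))"
  unfolding dupl_def by (simp add: power_mult_distrib) algebra

lemma dupl_proportional:
  assumes "A' * B = A * B'" "(A, B) \<noteq> (0, 0)"
  shows "fst (dupl (A', B')) * snd (dupl (A, B)) = fst (dupl (A, B)) * snd (dupl (A', B'))"
proof -
  obtain c where "A' = c * A" "B' = c * B"
  proof (cases "A = 0")
    case True
    then have "B \<noteq> 0" "A' = 0" using assms by auto
    then show ?thesis using True that[of "B' / B"] by simp
  next
    case False
    have "B' = A' / A * B" using assms(1) False by (simp add: field_simps)
    then show ?thesis using False that[of "A' / A"] by simp
  qed
  then show ?thesis by (simp add: dupl_scale)
qed

end

section \<open>Continuation of the local solution by repeated duplication\<close>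

locale local_inverse_solution = weierstrass_cubic +
  fixes S :: "complex \<Rightarrow> complex" and r :: real
  assumes r: "r > 0" and S: "S holomorphic_on ball 0 r" and S0: "S 0 = 0" and S1: "deriv S 0 = 1"
    and Snz: "\<And>u. u \<in> ball 0 r \<Longrightarrow> S u = 0 \<Longrightarrow> u = 0"
    and Sodd: "\<And>u. u \<in> ball 0 r \<Longrightarrow> S (- u) = - S u"
    and Sode: "\<And>u. u \<in> ball 0 r \<Longrightarrow> (deriv S u)^2 = rcubic (S u)"
    and Sdnz: "\<And>u. u \<in> ball 0 r \<Longrightarrow> deriv S u \<noteq> 0"
    and Suniq: "\<And>t \<rho>. \<rho> > 0 \<Longrightarrow> t holomorphic_on ball 0 \<rho> \<Longrightarrow> t 0 = 0 \<Longrightarrow> deriv t 0 = 1 \<Longrightarrow>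
       (\<And>u. u \<in> ball 0 \<rho> \<Longrightarrow> (deriv t u)^2 = rcubic (t u)) \<Longrightarrow> \<forall>\<^sub>F u in nhds 0. t u = S u"
begin

lemma S_deriv: "u \<in> ball 0 r \<Longrightarrow> (S has_field_derivative deriv S u) (at u)"
  using holomorphic_derivI[OF S open_ball] .

lemma S_deriv2:
  assumes u: "u \<in> ball 0 r"
  shows "(deriv S has_field_derivative (b2/2 * S u + 2 * b4 * S u^3 + 3 * b6 / 2 * S u^5) / 2) (at u)"
proof -
  have hol: "deriv S holomorphic_on ball 0 r" by (rule holomorphic_deriv[OF S open_ball])
  define q where "q = deriv (deriv S) u"
  have q: "(deriv S has_field_derivative q) (at u)" unfolding q_def by (rule holomorphic_derivI[OF hol open_ball u])
  have "((\<lambda>u. (deriv S u)^2) has_field_derivative (2 * deriv S u * q)) (at u)"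
    using DERIV_power[OF q, of 2] by (simp add: mult_ac)
  moreover have "((\<lambda>u. rcubic (S u)) has_field_derivative (b2/2 * S u + 2 * b4 * S u^3 + 3 * b6 / 2 * S u^5) * deriv S u) (at u)"
    unfolding rcubic_def by (rule derivative_eq_intros S_deriv[OF u] refl)+ (simp add: algebra_simps)
  then have "((\<lambda>u. (deriv S u)^2) has_field_derivative (b2/2 * S u + 2 * b4 * S u^3 + 3 * b6 / 2 * S u^5) * deriv S u) (at u)"
    by (rule has_field_derivative_transform_within_open[OF _ open_ball u]) (simp add: Sode)
  ultimately have "2 * deriv S u * q = (b2/2 * S u + 2 * b4 * S u^3 + 3 * b6 / 2 * S u^5) * deriv S u"
    by (rule DERIV_unique)
  then have "deriv S u * (2 * q) = deriv S u * (b2/2 * S u + 2 * b4 * S u^3 + 3 * b6 / 2 * S u^5)"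
    by (simp only: mult_ac)
  then have "2 * q = b2/2 * S u + 2 * b4 * S u^3 + 3 * b6 / 2 * S u^5"
    using Sdnz[OF u] by (simp only: mult_cancel_left) simp
  note e = this
  have "q = (2 * q) / 2" by simp
  also have "\<dots> = (b2/2 * S u + 2 * b4 * S u^3 + 3 * b6 / 2 * S u^5) / 2" unfolding e ..
  finally have eq: "q = (b2/2 * S u + 2 * b4 * S u^3 + 3 * b6 / 2 * S u^5) / 2" .
  show ?thesis by (rule q[unfolded eq])
qed

text \<open>The function \<open>t\<close> below, built from the values of \<open>S\<close> and its
  derivative at v/2, solves the same initial value problem as \<open>S\<close>, by
  \<open>duplication_identity\<close>; uniqueness gives \<open>t = S\<close> near 0. Squaring then
  removes the root of \<open>rquart\<close>.\<close>

lemma local_duplication: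
  assumes "u \<in> ball 0 (r / 2)"
  shows "rquart (S u) * (S (2 * u))^2 = 4 * (S u)^2 * rcubic (S u)"
proof -
  have "isCont (\<lambda>u. rquart (S u)) 0" unfolding rquart_def
    using S_deriv[of 0] r by (intro continuous_intros) (auto intro: DERIV_isCont)
  then have "((\<lambda>u. rquart (S u)) \<longlongrightarrow> 1) (nhds 0)" by (simp add: isCont_def tendsto_nhds_iff rquart_def S0)
  then have "\<forall>\<^sub>F s in nhds 0. dist (rquart (S s)) 1 < 1" by (rule tendstoD) simp
  then obtain d where d: "d > 0" "\<And>s. s \<in> ball 0 d \<Longrightarrow> dist (rquart (S s)) 1 < 1"
    unfolding eventually_nhds_metric by (auto simp: dist_commute)
  have nonneg: "rquart (S s) \<notin> \<real>\<^sub>\<le>\<^sub>0" if "s \<in> ball 0 d" for s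
  proof
    assume "rquart (S s) \<in> \<real>\<^sub>\<le>\<^sub>0"
    then have "Re (rquart (S s) - 1) \<le> -1" by (simp add: complex_nonpos_Reals_iff)
    then have "norm (rquart (S s) - 1) \<ge> 1" using abs_Re_le_cmod[of "rquart (S s) - 1"] by linarith
    then show False using d(2)[OF that] by (simp add: dist_norm)
  qed
  define \<rho> where "\<rho> = min d r"
  define t where "t = (\<lambda>v. 2 * S (v/2) * deriv S (v/2) / csqrt (rquart (S (v/2))))"
  \<comment> \<open>Dividing \<open>D s\<close> by the cube of the root of \<open>rquart s\<close>
    will give the derivative of \<open>t\<close>, once the square of \<open>deriv S\<close> has been
    replaced by \<open>rcubic\<close>.\<close>
  define D where "D = (\<lambda>s. ((rcubic s + s * (b2/2 * s + 2 * b4 * s^3 + 3 * b6 / 2 * s^5) / 2) * rquart s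
         - s * rcubic s * (- 4 * b4 * s^3 - 12 * b6 * s^5 - 8 * b8 * s^7) / 2))"
  have half: "v / 2 \<in> ball 0 r" "v / 2 \<in> ball 0 d" if "v \<in> ball 0 \<rho>" for v :: complex
    using that norm_ge_zero[of v] r d by (auto simp: \<rho>_def norm_divide simp del: norm_ge_zero)
  have der: "(t has_field_derivative D (S (v/2)) / csqrt (rquart (S (v/2)))^3) (at v)" if v: "v \<in> ball 0 \<rho>" for v
  proof -
    define s p m Q' N' where "s = S (v/2)" "p = deriv S (v/2)" "m = csqrt (rquart s)" "Q' = b2/2 * s + 2 * b4 * s^3 + 3 * b6 / 2 * s^5"
      "N' = - 4 * b4 * s^3 - 12 * b6 * s^5 - 8 * b8 * s^7"
    note defs = this
    have m: "m \<noteq> 0" "m^2 = rquart s" using nonneg[OF half(2)[OF v]] by (auto simp: defs)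
    have p: "p^2 = rcubic s" using Sode[OF half(1)[OF v]] by (simp add: defs)
    have h: "((\<lambda>v. v/2) has_field_derivative 1/2) (at v)" by (auto intro!: derivative_eq_intros)
    have s': "((\<lambda>v. S (v/2)) has_field_derivative p * (1/2)) (at v)"
      unfolding defs(2) by (rule DERIV_chain2[OF S_deriv[OF half(1)[OF v]] h])
    have p': "((\<lambda>v. deriv S (v/2)) has_field_derivative (Q' / 2) * (1/2)) (at v)"
      unfolding defs(1,4) by (rule DERIV_chain2[OF S_deriv2[OF half(1)[OF v]] h])
    have n': "((\<lambda>v. rquart (S (v/2))) has_field_derivative N' * (p * (1/2))) (at v)"
      unfolding rquart_def by (rule derivative_eq_intros s' refl)+ (simp add: defs(1,5) algebra_simps)
    have m': "((\<lambda>v. csqrt (rquart (S (v/2)))) has_field_derivative (1 / (2 * m)) * (N' * (p * (1/2)))) (at v)"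
    proof (rule DERIV_chain2[OF _ n'])
      have "(csqrt has_field_derivative inverse (2 * csqrt (rquart (S (v/2))))) (at (rquart (S (v/2))))"
        by (rule has_field_derivative_csqrt[OF nonneg[OF half(2)[OF v]]])
      then show "(csqrt has_field_derivative 1 / (2 * m)) (at (rquart (S (v/2))))" by (simp add: defs(1,3) inverse_eq_divide)
    qed
    have "(t has_field_derivative ((2 * (p * (1/2)) * p + (Q' / 2) * (1/2) * (2 * s)) * m - 2 * s * p * ((1 / (2 * m)) * (N' * (p * (1/2))))) / (m * m)) (at v)"
      unfolding t_def
      using DERIV_divide[OF DERIV_mult[OF DERIV_cmult[OF s', of 2] p'] m'] m(1) by (simp add: defs(1-3))
    moreover have "((2 * (p * (1/2)) * p + (Q' / 2) * (1/2) * (2 * s)) * m - 2 * s * p * ((1 / (2 * m)) * (N' * (p * (1/2))))) / (m * m)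
        = ((p^2 + s * Q' / 2) * m^2 - s * p^2 * N' / 2) / m^3"
    proof -
      have "((2 * (p * (1/2)) * p + (Q' / 2) * (1/2) * (2 * s)) * m - 2 * s * p * ((1 / (2 * m)) * (N' * (p * (1/2))))) * m
        = (p^2 + s * Q' / 2) * m^2 - s * p^2 * N' / 2"
      proof -
        define k where "k = 1 / (2 * m)"
        have km: "2 * k * m = 1" using m(1) by (simp add: k_def)
        have "((2 * (p * (1/2)) * p + (Q' / 2) * (1/2) * (2 * s)) * m - 2 * s * p * (k * (N' * (p * (1/2))))) * m
          = (p^2 + s * Q' / 2) * m^2 - s * p^2 * N' / 2 * (2 * k * m)"
          by (simp add: algebra_simps power2_eq_square)
        then show ?thesis using m(1) unfolding km k_def by simp
      qed
      then have "((2 * (p * (1/2)) * p + (Q' / 2) * (1/2) * (2 * s)) * m - 2 * s * p * ((1 / (2 * m)) * (N' * (p * (1/2))))) * m / m^3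
        = ((p^2 + s * Q' / 2) * m^2 - s * p^2 * N' / 2) / m^3" by (simp only:)
      moreover have "z * m / m^3 = z / (m * m)" for z using m(1) by (simp add: power3_eq_cube)
      ultimately show ?thesis by metis
    qed
    moreover have "((p^2 + s * Q' / 2) * m^2 - s * p^2 * N' / 2) = D s" unfolding m(2) p D_def defs(4,5) ..
    ultimately have "(t has_field_derivative D s / m^3) (at v)" by metis
    then show ?thesis unfolding defs(1,3) .
  qed
  have "\<forall>\<^sub>F v in nhds 0. t v = S v"
  proof (rule Suniq)
    show "\<rho> > 0" using r d by (simp add: \<rho>_def)
    show "t holomorphic_on ball 0 \<rho>" unfolding holomorphic_on_open[OF open_ball] using der by blast
    show "t 0 = 0" by (simp add: t_def S0)
    show "deriv t 0 = 1" using DERIV_imp_deriv[OF der[of 0]] \<open>\<rho> > 0\<close> by (simp add: S0 D_def rcubic_def rquart_def)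
    fix v :: complex assume v: "v \<in> ball 0 \<rho>"
    define s m where "s = S (v/2)" "m = csqrt (rquart s)"
    have m: "m \<noteq> 0" "m^2 = rquart s" using nonneg[OF half(2)[OF v]] by (auto simp: s_m_def)
    have p: "(deriv S (v/2))^2 = rcubic s" using Sode[OF half(1)[OF v]] by (simp add: s_m_def)
    have "deriv t v = D s / m^3" using DERIV_imp_deriv[OF der[OF v]] by (simp add: s_m_def)
    then have 1: "(deriv t v)^2 * m^6 = (D s)^2" using m(1) by (simp add: power_divide power_mult [symmetric])
    define z where "z = t v"
    have "z * m = 2 * s * deriv S (v/2)" using m(1) by (simp add: z_def t_def s_m_def)
    then have "(z * m)^2 = 4 * s^2 * rcubic s" using p by (simp add: power_mult_distrib)
    then have z2: "z^2 * rquart s = 4 * s^2 * rcubic s" using m(2) by (simp add: power_mult_distrib)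
    have "rcubic z * rquart s^3 = rquart s^3 + b2/4 * (z^2 * rquart s) * rquart s^2 + b4/2 * (z^2 * rquart s)^2 * rquart s + b6/4 * (z^2 * rquart s)^3"
      unfolding rcubic_def by algebra
    also have "\<dots> = (D s)^2"
      unfolding z2 D_def duplication_identity by algebra
    finally have "rcubic z * rquart s^3 = (D s)^2" .
    moreover have "m^6 = rquart s^3" unfolding m(2)[symmetric] by (simp add: power_mult[symmetric])
    ultimately have 2: "rcubic z * m^6 = (D s)^2" by simp
    have "m^6 \<noteq> 0" using m(1) by simp
    then show "(deriv t v)^2 = rcubic (t v)" using 1 2 unfolding z_def by (metis mult_cancel_right)
  qed
  then obtain e where e: "e > 0" "\<And>v. v \<in> ball 0 e \<Longrightarrow> t v = S v"
    unfolding eventually_nhds_metric by (auto simp: dist_commute)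
  define W where "W = ball (0::complex) (min (e/2) (min (d/2) (r/2)))"
  have near: "rquart (S u) * (S (2 * u))^2 = 4 * (S u)^2 * rcubic (S u)" if u: "u \<in> W" for u
  proof -
    have u': "2 * u \<in> ball 0 e" "u \<in> ball 0 d" "u \<in> ball 0 r" using u r d by (auto simp: W_def norm_mult)
    have "csqrt (rquart (S u)) \<noteq> 0" using nonneg[OF u'(2)] by auto
    then have "S (2 * u) * csqrt (rquart (S u)) = 2 * S u * deriv S u"
      using e(2)[OF u'(1)] by (simp add: t_def field_simps)
    then have "(S (2 * u) * csqrt (rquart (S u)))^2 = (2 * S u * deriv S u)^2" by simp
    then show ?thesis using Sode[OF u'(3)] by (simp add: power_mult_distrib mult_ac)
  qed
  have S2: "(\<lambda>u. S (2 * u)) holomorphic_on ball 0 (r/2)"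
    by (rule holomorphic_on_compose_gen[of "\<lambda>u. 2 * u" _ S "ball 0 r", unfolded o_def]) (auto intro!: holomorphic_intros S simp: norm_mult)
  have S': "S holomorphic_on ball 0 (r/2)" by (rule holomorphic_on_subset[OF S]) (use r in auto)
  show ?thesis
  \<comment> \<open>The squared identity contains no root and both sides are holomorphic on the half
    disc, so it extends from the small disc \<open>W\<close>.\<close>
  proof (rule analytic_continuation_open[where f = "\<lambda>u. rquart (S u) * (S (2 * u))^2" and g = "\<lambda>u. 4 * (S u)^2 * rcubic (S u)"])
    show "open W" "open (ball 0 (r/2) :: complex set)" "connected (ball 0 (r/2) :: complex set)" by (auto simp: W_def)
    show "W \<noteq> {}" "W \<subseteq> ball 0 (r/2)" using r d e by (auto simp: W_def)
    show "(\<lambda>u. rquart (S u) * (S (2 * u))^2) holomorphic_on ball 0 (r/2)"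
      "(\<lambda>u. 4 * (S u)^2 * rcubic (S u)) holomorphic_on ball 0 (r/2)"
      unfolding rquart_def rcubic_def by (intro holomorphic_intros S2 S')+
  qed (use assms near in auto)
qed

text \<open>\<open>fst (AB k u) / snd (AB k u)\<close> is the value at \<open>u\<close> obtained from the local solution at \<open>u / 2 ^ k\<close> by \<open>k\<close>
  duplications; homogeneous coordinates avoid all case distinctions at the poles.\<close>

primrec AB :: "nat \<Rightarrow> complex \<Rightarrow> complex \<times> complex" where
  "AB 0 u = (1, (S u)^2)"
| "AB (Suc k) u = dupl (AB k (u / 2))"

lemma AB_nonzero: "AB k u \<noteq> (0, 0)"
proof (induction k arbitrary: u)
  case (Suc k)
  then show ?case using dupl_nonzero[of "AB k (u/2)"] by auto
qed simp

lemma fst_dupl: "fst (dupl p) = fst p^4 - b4 * fst p^2 * snd p^2 - 2 * b6 * fst p * snd p^3 - b8 * snd p^4"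
  and snd_dupl: "snd (dupl p) = snd p * (4 * fst p^3 + b2 * fst p^2 * snd p + 2 * b4 * fst p * snd p^2 + b6 * snd p^3)"
  by (simp_all add: dupl_def case_prod_unfold)

lemma AB_holomorphic:
  "(\<lambda>u. fst (AB k u)) holomorphic_on ball 0 (2^k * r) \<and> (\<lambda>u. snd (AB k u)) holomorphic_on ball 0 (2^k * r)"
proof (induction k)
  case 0
  then show ?case using S by (auto intro!: holomorphic_intros)
next
  case (Suc k)
  have "(\<lambda>u. fst (AB k (u/2))) holomorphic_on ball 0 (2^Suc k * r)"
    by (rule holomorphic_on_compose_gen[of "\<lambda>u. u/2" _ "\<lambda>u. fst (AB k u)" "ball 0 (2^k*r)", unfolded o_def])
       (use Suc in \<open>auto intro!: holomorphic_intros simp: norm_divide\<close>)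
  moreover have "(\<lambda>u. snd (AB k (u/2))) holomorphic_on ball 0 (2^Suc k * r)"
    by (rule holomorphic_on_compose_gen[of "\<lambda>u. u/2" _ "\<lambda>u. snd (AB k u)" "ball 0 (2^k*r)", unfolded o_def])
       (use Suc in \<open>auto intro!: holomorphic_intros simp: norm_divide\<close>)
  ultimately show ?case unfolding AB.simps fst_dupl snd_dupl by (intro conjI holomorphic_intros)
qed

text \<open>One more duplication does not change the point of the projective line: the start is
  \<open>local_duplication\<close> at u/2, and \<open>dupl\<close> respects proportionality. Hence
  the levels patch to one function.\<close>

lemma AB_proportional:
  "u \<in> ball 0 (2^k * r) \<Longrightarrow> fst (AB (Suc k) u) * snd (AB k u) = fst (AB k u) * snd (AB (Suc k) u)"
proof (induction k arbitrary: u)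
  case 0
  then have "u / 2 \<in> ball 0 (r / 2)" by (simp add: norm_divide)
  from local_duplication[OF this] have "rquart (S (u/2)) * (S u)^2 = 4 * (S (u/2))^2 * rcubic (S (u/2))" by simp
  then show ?case by (simp add: fst_dupl snd_dupl rquart_def rcubic_def power_mult[symmetric] algebra_simps)
next
  case (Suc k)
  then have "u / 2 \<in> ball 0 (2^k * r)" by (simp add: norm_divide)
  from Suc.IH[OF this] have *: "fst (AB (Suc k) (u/2)) * snd (AB k (u/2)) = fst (AB k (u/2)) * snd (AB (Suc k) (u/2))" .
  have "(fst (AB k (u/2)), snd (AB k (u/2))) \<noteq> (0, 0)" using AB_nonzero[of k "u/2"] by simp
  from dupl_proportional[OF * this] show ?case
    by (simp only: AB.simps(2)[of "Suc k"] AB.simps(2)[of k u] prod.collapse)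
qed

lemma AB_even: "u \<in> ball 0 (2^k * r) \<Longrightarrow> AB k (- u) = AB k u"
proof (induction k arbitrary: u)
  case 0
  then show ?case using Sodd[of u] by simp
next
  case (Suc k)
  then have "u / 2 \<in> ball 0 (2^k * r)" by (simp add: norm_divide)
  from Suc.IH[OF this] show ?case by simp
qed

definition level :: "complex \<Rightarrow> nat" where "level u = (LEAST k. norm u < 2^k * r)"
text \<open>At a pole the denominator is 0 and the quotient evaluates to 0; the poles are recorded
  separately in \<open>poles\<close>.\<close>

definition xw :: "complex \<Rightarrow> complex" where "xw u = fst (AB (level u) u) / snd (AB (level u) u)"
definition poles :: "complex set" where "poles = {u. snd (AB (level u) u) = 0}"

lemma ex_level: obtains k where "norm u < 2^k * r"
proof -
  obtain k where "norm u / r < 2^k" using real_arch_pow[of 2 "norm u / r"] by auto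
  then show ?thesis using that[of k] r by (simp add: field_simps)
qed

lemma AB_level:
  assumes "norm u < 2^k * r"
  shows "(snd (AB k u) = 0 \<longleftrightarrow> u \<in> poles) \<and> fst (AB k u) / snd (AB k u) = xw u"
proof -
  have lev: "norm u < 2^level u * r" unfolding level_def using assms by (rule LeastI)
  have "level u \<le> k" unfolding level_def using assms by (rule Least_le)
  then show ?thesis
  proof (induction k rule: dec_induct)
    case base
    then show ?case by (simp add: poles_def xw_def)
  next
    case (step j)
    have "norm u < 2^j * r"
    proof -
      have "2^level u * r \<le> 2^j * r" using step(1) r by (intro mult_right_mono power_increasing) auto
      then show ?thesis using lev by linarith
    qed
    then have p: "fst (AB (Suc j) u) * snd (AB j u) = fst (AB j u) * snd (AB (Suc j) u)" by (intro AB_proportional) simp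
    have nz: "snd (AB j u) = 0 \<Longrightarrow> fst (AB j u) \<noteq> 0" "snd (AB (Suc j) u) = 0 \<Longrightarrow> fst (AB (Suc j) u) \<noteq> 0"
      using AB_nonzero[of j u] AB_nonzero[of "Suc j" u] by (metis prod.collapse)+
    have z: "snd (AB (Suc j) u) = 0 \<longleftrightarrow> snd (AB j u) = 0" using p nz by auto
    have "fst (AB (Suc j) u) / snd (AB (Suc j) u) = fst (AB j u) / snd (AB j u)"
    proof (cases "snd (AB j u) = 0")
      case True
      then show ?thesis using z by simp
    next
      case False
      then show ?thesis using z p by (simp add: frac_eq_eq)
    qed
    then show ?case using step z by simp
  qed
qed

lemma near_0:
  assumes "norm u < r"
  shows "u \<in> poles \<longleftrightarrow> u = 0" "xw u = 1 / (S u)^2"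
proof -
  have "S u = 0 \<longleftrightarrow> u = 0" using Snz[of u] S0 assms by auto
  then show "u \<in> poles \<longleftrightarrow> u = 0" "xw u = 1 / (S u)^2" using AB_level[of u 0] assms by auto
qed

lemma poles_sparse: "poles sparse_in UNIV"
proof -
  have "\<forall>\<^sub>F z in at y. z \<notin> poles" for y
  proof -
    obtain k0 where k0: "norm y < 2^k0 * r" by (rule ex_level)
    \<comment> \<open>The point r/2 lies in the initial disc, where 0 is the only pole, so the
      denominator on the large disc does not vanish identically.\<close>
    have c: "of_real (r/2) \<in> ball (0::complex) (2^k0 * r)"
    proof -
      have "(1::real) \<le> 2^k0" by simp
      then have "1 < 2^k0 * (2::real)" by linarith
      then show ?thesis using r by simp
    qed
    have "of_real (r/2) \<notin> poles" using near_0[of "of_real (r/2)"] r by simp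
    then have "snd (AB k0 (of_real (r/2))) \<noteq> 0" using AB_level[of "of_real (r/2)" k0] c by auto
    then have "\<forall>\<^sub>F z in at y. snd (AB k0 z) \<noteq> 0 \<and> z \<in> ball 0 (2^k0 * r)"
      by (intro non_zero_neighbour_alt[OF conjunct2[OF AB_holomorphic] _ _ _ c]) (use k0 in auto)
    then show ?thesis by eventually_elim (use AB_level in auto)
  qed
  then show ?thesis by (simp add: sparse_in_eventually_iff)
qed

lemma poles_closed: "closed poles" using poles_sparse by (rule sparse_in_UNIV_imp_closed)

lemma xw_holomorphic: "xw holomorphic_on - poles"
proof (rule holomorphic_onI)
  fix u assume u: "u \<in> - poles"
  obtain k where k: "norm u < 2^k * r" by (rule ex_level)
  define D where "D = ball 0 (2^k * r) - poles"
  have "open D" unfolding D_def using poles_closed by (intro open_Diff) auto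
  have "(\<lambda>u. fst (AB k u) / snd (AB k u)) holomorphic_on D"
    unfolding D_def using AB_level[of _ k]
    by (intro holomorphic_intros holomorphic_on_subset[OF conjunct1[OF AB_holomorphic[of k]]] holomorphic_on_subset[OF conjunct2[OF AB_holomorphic[of k]]]) auto
  then have "xw holomorphic_on D"
    by (rule holomorphic_transform) (use AB_level[of _ k] in \<open>auto simp: D_def\<close>)
  moreover have "u \<in> D" using u k by (simp add: D_def)
  ultimately show "xw field_differentiable at u within - poles"
    using \<open>open D\<close> by (meson field_differentiable_at_within holomorphic_on_imp_differentiable_at)
qed

lemma xw_pole:
  assumes l: "l \<in> poles"
  shows "filterlim xw at_infinity (at l)"
proof -
  obtain k where k: "norm l < 2^k * r" by (rule ex_level)
  have B0: "snd (AB k l) = 0" using AB_level[OF k] l by simp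
  then have A0: "fst (AB k l) \<noteq> 0" using AB_nonzero[of k l] by (metis prod.collapse)
  have lD: "l \<in> ball 0 (2^k * r)" using k by simp
  have cont: "isCont (\<lambda>u. fst (AB k u)) l" "isCont (\<lambda>u. snd (AB k u)) l"
    using AB_holomorphic[of k] lD holomorphic_on_imp_continuous_on[of _ "ball 0 (2^k * r)"] continuous_on_eq_continuous_at[OF open_ball]
    by blast+
  have ev: "\<forall>\<^sub>F z in at l. z \<notin> poles" "\<forall>\<^sub>F z in at l. z \<in> ball 0 (2^k * r)"
    using poles_sparse eventually_at_in_open'[OF open_ball lD] by (auto simp: sparse_in_eventually_iff)
  then have ev2: "\<forall>\<^sub>F z in at l. snd (AB k z) \<noteq> 0" "\<forall>\<^sub>F z in at l. fst (AB k z) / snd (AB k z) = xw z"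
    by (eventually_elim, use AB_level[of _ k] in auto)+
  have "filterlim (\<lambda>z. snd (AB k z)) (at 0) (at l)"
    using cont(2) B0 ev2(1) by (intro filterlim_atI) (auto simp: isCont_def)
  moreover have "((\<lambda>z. fst (AB k z)) \<longlongrightarrow> fst (AB k l)) (at l)" using cont(1) by (simp add: isCont_def)
  ultimately have "filterlim (\<lambda>z. fst (AB k z) / snd (AB k z)) at_infinity (at l)"
    using A0 by (intro filterlim_divide_at_infinity)
  then show ?thesis using filterlim_cong[OF refl refl ev2(2)] by blast
qed

lemma xw_even: "xw (- u) = xw u" "- u \<in> poles \<longleftrightarrow> u \<in> poles"
proof -
  obtain k where k: "norm u < 2^k * r" by (rule ex_level)
  then have "AB k (- u) = AB k u" by (intro AB_even) simp
  then show "xw (- u) = xw u" "- u \<in> poles \<longleftrightarrow> u \<in> poles" using AB_level[of u k] AB_level[of "- u" k] k by auto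
qed

lemma open_compl_poles: "open (- poles)" using poles_closed by auto

lemma connected_compl_poles: "connected (- poles)"
  using sparse_imp_connected[OF _ connected_UNIV open_UNIV poles_sparse] by (simp add: Compl_eq_Diff_UNIV)

lemma punctured_subset: "ball 0 r - {0} \<subseteq> - poles" "open (ball (0::complex) r - {0})" "ball (0::complex) r - {0} \<noteq> {}"
proof -
  show "ball 0 r - {0} \<subseteq> - poles" using near_0 by auto
  have "of_real (r/2) \<in> ball (0::complex) r - {0}" using r by auto
  then show "ball (0::complex) r - {0} \<noteq> {}" by blast
qed auto

lemma xw_deriv_local:
  assumes u: "u \<in> ball 0 r - {0}"
  shows "deriv xw u = - 2 * deriv S u / S u^3"
proof -
  have "S u \<noteq> 0" using Snz[of u] u by auto
  have "((\<lambda>u. 1 / (S u)^2) has_field_derivative - 2 * deriv S u / S u^3) (at u)"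
    using \<open>S u \<noteq> 0\<close> S_deriv[of u] u
    by (auto intro!: derivative_eq_intros simp: field_simps power2_eq_square power3_eq_cube)
  then have "(xw has_field_derivative - 2 * deriv S u / S u^3) (at u)"
    by (rule has_field_derivative_transform_within_open[OF _ punctured_subset(2) u]) (use near_0 in auto)
  then show ?thesis by (rule DERIV_imp_deriv)
qed

lemma xw_ode1_local:
  assumes u: "u \<in> ball 0 r - {0}"
  shows "(deriv xw u)^2 = cubic (xw u)"
proof -
  have "S u \<noteq> 0" using Snz[of u] u by auto
  have "(deriv xw u)^2 = 4 * (deriv S u)^2 / S u^6"
    unfolding xw_deriv_local[OF u] by (simp add: power_divide power_mult_distrib power_mult[symmetric])
  also have "\<dots> = 4 * rcubic (S u) / S u^6" using Sode[of u] u by simp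
  also have "\<dots> = cubic (1 / (S u)^2)"
    using \<open>S u \<noteq> 0\<close> unfolding rcubic_def cubic_def by (simp add: field_simps eval_nat_numeral)
  finally show ?thesis using near_0[of u] u by simp
qed

lemma xw_ode1:
  assumes "u \<notin> poles"
  shows "(deriv xw u)^2 = cubic (xw u)"
proof (rule analytic_continuation_open[OF punctured_subset(2) open_compl_poles punctured_subset(3) connected_compl_poles punctured_subset(1),
        where f = "\<lambda>u. (deriv xw u)^2" and g = "\<lambda>u. cubic (xw u)"])
  show "(\<lambda>u. (deriv xw u)^2) holomorphic_on - poles"
    by (intro holomorphic_intros holomorphic_deriv xw_holomorphic open_compl_poles)
  show "(\<lambda>u. cubic (xw u)) holomorphic_on - poles"
    unfolding cubic_def by (intro holomorphic_intros xw_holomorphic)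
qed (use assms xw_ode1_local in auto)

text \<open>Differentiating the first-order equation leaves a common factor, the derivative of
  \<open>xw\<close>. It is nonzero near 0, and the cancelled equation extends to the connected
  complement of the poles.\<close>

lemma xw_ode2:
  assumes "u \<notin> poles"
  shows "deriv (deriv xw) u = quad (xw u)"
proof -
  have hol': "deriv xw holomorphic_on - poles" by (rule holomorphic_deriv[OF xw_holomorphic open_compl_poles])
  have hol'': "deriv (deriv xw) holomorphic_on - poles" by (rule holomorphic_deriv[OF hol' open_compl_poles])
  have loc: "deriv (deriv xw) u = quad (xw u)" if u: "u \<in> ball 0 r - {0}" for u
  proof -
    have up: "u \<in> - poles" using u punctured_subset(1) by blast
    have d1: "(xw has_field_derivative deriv xw u) (at u)" by (rule holomorphic_derivI[OF xw_holomorphic open_compl_poles up])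
    have d2: "(deriv xw has_field_derivative deriv (deriv xw) u) (at u)" by (rule holomorphic_derivI[OF hol' open_compl_poles up])
    have "((\<lambda>u. (deriv xw u)^2) has_field_derivative (2 * deriv xw u * deriv (deriv xw) u)) (at u)"
      using DERIV_power[OF d2, of 2] by (simp add: mult_ac)
    moreover have "((\<lambda>u. cubic (xw u)) has_field_derivative 2 * deriv xw u * quad (xw u)) (at u)"
      unfolding cubic_def by (rule derivative_eq_intros d1 refl)+ (simp add: quad_def algebra_simps power2_eq_square)
    then have "((\<lambda>u. (deriv xw u)^2) has_field_derivative 2 * deriv xw u * quad (xw u)) (at u)"
      by (rule has_field_derivative_transform_within_open[OF _ open_compl_poles up]) (simp add: xw_ode1)
    ultimately have "2 * deriv xw u * deriv (deriv xw) u = 2 * deriv xw u * quad (xw u)" by (rule DERIV_unique)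
    moreover have "deriv xw u \<noteq> 0"
      using xw_deriv_local[OF u] Sdnz[of u] Snz[of u] u by auto
    ultimately show ?thesis by simp
  qed
  show ?thesis
  proof (rule analytic_continuation_open[OF punctured_subset(2) open_compl_poles punctured_subset(3) connected_compl_poles punctured_subset(1),
          where f = "deriv (deriv xw)" and g = "\<lambda>u. quad (xw u)"])
    show "(\<lambda>u. quad (xw u)) holomorphic_on - poles"
      unfolding quad_def by (intro holomorphic_intros xw_holomorphic)
  qed (use assms hol'' loc in auto)
qed

lemma xw_lim_0: "((\<lambda>u. u^2 * xw u) \<longlongrightarrow> 1) (at 0)"
proof -
  have "((\<lambda>u. S u / u) \<longlongrightarrow> 1) (at 0)"
    using S_deriv[of 0] r S0 S1 by (simp add: has_field_derivative_iff)
  then have "((\<lambda>u. inverse ((S u / u)^2)) \<longlongrightarrow> inverse (1^2)) (at 0)"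
    by (intro tendsto_intros) auto
  moreover have "\<forall>\<^sub>F u in at (0::complex). u \<in> ball 0 r - {0}"
    using eventually_at_in_open[of "ball 0 r" "0::complex"] r by simp
  then have "\<forall>\<^sub>F u in at 0. inverse ((S u / u)^2) = u^2 * xw u"
    by eventually_elim (use near_0 in \<open>auto simp: field_simps\<close>)
  ultimately show ?thesis using Lim_transform_eventually by fastforce
qed

lemma xw_dupl:
  assumes "u \<notin> poles"
  shows "2 * u \<in> poles \<longleftrightarrow> cubic (xw u) = 0" "2 * u \<notin> poles \<Longrightarrow> xw (2 * u) * cubic (xw u) = quart (xw u)"
proof -
  obtain k where k: "norm u < 2^k * r" by (rule ex_level)
  then have k': "norm (2 * u) < 2^Suc k * r" by (simp add: norm_mult)
  define A B where "A = fst (AB k u)" "B = snd (AB k u)"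
  have B: "B \<noteq> 0" "xw u = A / B" using AB_level[OF k] assms by (auto simp: A_B_def)
  have "AB (Suc k) (2 * u) = dupl (A, B)" by (simp add: A_B_def)
  moreover have "fst (dupl (A, B)) = B^4 * quart (xw u)" "snd (dupl (A, B)) = B^4 * cubic (xw u)"
    unfolding fst_dupl snd_dupl B(2) quart_def cubic_def using B(1) by (simp_all add: field_simps eval_nat_numeral)
  ultimately have "fst (AB (Suc k) (2 * u)) = B^4 * quart (xw u)" "snd (AB (Suc k) (2 * u)) = B^4 * cubic (xw u)" by simp_all
  with AB_level[OF k'] B(1)
  show "2 * u \<in> poles \<longleftrightarrow> cubic (xw u) = 0" "2 * u \<notin> poles \<Longrightarrow> xw (2 * u) * cubic (xw u) = quart (xw u)"
    by (auto simp: field_simps)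
qed

end

text \<open>The interface between construction and use. \<open>L\<close> is merely a symmetric
  sparse set here: that it is a group, and that \<open>x\<close> is periodic under it, are
  consequences of the addition theorem. The two duplication clauses are kept because they come
  directly from the construction.\<close>

locale weierstrass_function = weierstrass_cubic +
  fixes x :: "complex \<Rightarrow> complex" and L :: "complex set"
  assumes sparse: "L sparse_in UNIV"
    and zero_in: "0 \<in> L"
    and hol: "x holomorphic_on - L"
    and pole: "l \<in> L \<Longrightarrow> filterlim x at_infinity (at l)"
    and even: "x (- u) = x u"
    and minus_in_iff: "- u \<in> L \<longleftrightarrow> u \<in> L"
    and ode1: "u \<notin> L \<Longrightarrow> (deriv x u)^2 = cubic (x u)"
    and ode2: "u \<notin> L \<Longrightarrow> deriv (deriv x) u = quad (x u)"
    and lim_0: "((\<lambda>u. u^2 * x u) \<longlongrightarrow> 1) (at 0)"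
    and double_in: "u \<notin> L \<Longrightarrow> 2 * u \<in> L \<longleftrightarrow> cubic (x u) = 0"
    and double: "u \<notin> L \<Longrightarrow> 2 * u \<notin> L \<Longrightarrow> x (2 * u) * cubic (x u) = quart (x u)"

theorem (in weierstrass_cubic) ex_weierstrass_function:
  "\<exists>x L. weierstrass_function b2 b4 b6 x L"
proof (rule local_inverse, goal_cases)
  case (1 S r)
  interpret local_inverse_solution b2 b4 b6 S r
    by unfold_locales (use 1 in auto)
  have "weierstrass_function b2 b4 b6 xw poles"
    by unfold_locales
       (use poles_sparse xw_holomorphic xw_pole xw_even xw_ode1 xw_ode2 xw_lim_0 xw_dupl near_0(1)[of 0] 1(1) in auto)
  then show ?case by blast
qed

section \<open>Theta functions\<close>

lemma no_sparse_singularity: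
  assumes "f holomorphic_on (S - Z)" "open S" "Z sparse_in S" "\<And>z. z \<in> Z \<Longrightarrow> z \<in> S \<Longrightarrow> (f \<longlongrightarrow> f z) (at z)"
  shows "f holomorphic_on S"
proof (rule holomorphic_onI)
  fix z assume z: "z \<in> S"
  have "\<forall>\<^sub>F y in at z. y \<notin> Z" using assms z by (simp add: sparse_in_eventually_iff)
  then obtain e where e: "e > 0" "\<And>y. y \<in> ball z e \<Longrightarrow> y \<noteq> z \<Longrightarrow> y \<notin> Z"
    unfolding eventually_at by (auto simp: dist_commute)
  obtain e' where e': "e' > 0" "ball z e' \<subseteq> S" using assms(2) z open_contains_ball by blast
  define r where "r = min e e'"
  have r: "r > 0" "ball z r \<subseteq> S" "ball z r - {z} \<subseteq> S - Z" using e e' by (auto simp: r_def)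
  have "f holomorphic_on ball z r"
  proof (cases "z \<in> Z")
    case True
    show ?thesis
      by (rule no_isolated_singularity'[where K = "{z}"])
         (use assms(4)[OF True z] r holomorphic_on_subset[OF assms(1) r(3)] in \<open>auto intro: tendsto_within_subset\<close>)
  next
    case False
    then have "ball z r \<subseteq> S - Z" using r by auto
    then show ?thesis using holomorphic_on_subset[OF assms(1)] by blast
  qed
  then show "f field_differentiable at z within S"
    using r(1) by (meson centre_in_ball field_differentiable_at_within holomorphic_on_imp_differentiable_at open_ball)
qed

lemma holomorphic_shift: "F holomorphic_on UNIV \<Longrightarrow> (\<lambda>z. F (z + s)) holomorphic_on UNIV" for F :: "complex \<Rightarrow> complex"
  by (rule holomorphic_on_compose_gen[of "\<lambda>z. z + s" UNIV F UNIV, unfolded o_def]) (auto intro!: holomorphic_intros)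

section \<open>Fourier coefficients of entire periodic functions\<close>

definition mean :: "(complex \<Rightarrow> complex) \<Rightarrow> complex" where
  "mean H = contour_integral (linepath 0 1) H"

lemma mean_primitive:
  assumes "\<And>z. (G has_field_derivative H z) (at z)"
  shows "mean H = G 1 - G 0"
proof -
  have "(H has_contour_integral (G (pathfinish (linepath 0 1)) - G (pathstart (linepath 0 1)))) (linepath 0 1)"
    by (intro contour_integral_primitive[of UNIV] valid_path_linepath assms subset_UNIV)
  then show ?thesis unfolding mean_def by (simp add: contour_integral_unique)
qed

lemma entire_primitive:
  fixes H :: "complex \<Rightarrow> complex"
  assumes "H holomorphic_on UNIV"
  obtains G where "\<And>z. (G has_field_derivative H z) (at z)"
  using holomorphic_convex_primitive'[OF convex_UNIV open_UNIV assms] by auto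

text \<open>For a primitive G of H, \<open>G (w + 1) - G w\<close> has derivative 0 by periodicity.
  As w may be complex, this moves the line of integration vertically.\<close>

lemma mean_shift:
  assumes H: "H holomorphic_on UNIV" and per: "\<And>z. H (z + 1) = H z"
  shows "mean (\<lambda>z. H (z + w)) = mean H"
proof -
  obtain G where G: "\<And>z. (G has_field_derivative H z) (at z)"
    using entire_primitive[OF H] by metis
  have G': "((\<lambda>z. G (z + w)) has_field_derivative H (z + w)) (at z)" for z w
    by (rule DERIV_shift[THEN iffD1, OF G])
  have "((\<lambda>w. G (w + 1) - G w) has_field_derivative (H (w + 1) - H w)) (at w)" for w
    by (intro DERIV_diff G G')
  then have "\<exists>c. \<forall>w\<in>UNIV. G (w + 1) - G w = c"
    by (intro has_field_derivative_zero_constant) (auto simp: per)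
  then obtain c where "\<forall>w. G (w + 1) - G w = c" by auto
  then have "G (w + 1) - G w = c" "G (0 + 1) - G 0 = c" by blast+
  then have "G (w + 1) - G w = G (0 + 1) - G 0" by simp
  then show ?thesis
    using mean_primitive[OF G] mean_primitive[OF G', of w] by (simp add: add.commute)
qed

lemma mean_integrable: "H holomorphic_on UNIV \<Longrightarrow> H contour_integrable_on (linepath 0 1)"
  by (rule contour_integrable_continuous_linepath[OF continuous_on_subset[OF holomorphic_on_imp_continuous_on subset_UNIV]])

lemma mean_bound:
  assumes "H holomorphic_on UNIV" "\<And>t. 0 \<le> t \<Longrightarrow> t \<le> 1 \<Longrightarrow> norm (H (of_real t)) \<le> B"
  shows "norm (mean H) \<le> B"
proof -
  have "B \<ge> 0" using order_trans[OF norm_ge_zero assms(2)[of 0]] by simp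
  have "norm (contour_integral (linepath 0 1) H) \<le> B * norm (1 - 0 :: complex)"
  proof (rule contour_integral_bound_linepath[OF mean_integrable[OF assms(1)] \<open>B \<ge> 0\<close>])
    fix x :: complex assume "x \<in> closed_segment 0 1"
    then obtain t where "x = of_real t" "0 \<le> t" "t \<le> 1"
      by (auto simp: closed_segment_def scaleR_conv_of_real)
    then show "norm (H x) \<le> B" using assms(2) by blast
  qed
  then show ?thesis by (simp add: mean_def)
qed

lemma mean_add: "f holomorphic_on UNIV \<Longrightarrow> g holomorphic_on UNIV \<Longrightarrow> mean (\<lambda>z. f z + g z) = mean f + mean g"
  unfolding mean_def by (intro contour_integral_add mean_integrable)

lemma mean_diff: "f holomorphic_on UNIV \<Longrightarrow> g holomorphic_on UNIV \<Longrightarrow> mean (\<lambda>z. f z - g z) = mean f - mean g"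
  unfolding mean_def by (intro contour_integral_diff mean_integrable)

lemma mean_cmult: "f holomorphic_on UNIV \<Longrightarrow> mean (\<lambda>z. c * f z) = c * mean f"
  unfolding mean_def by (intro contour_integral_lmul mean_integrable)

lemma mean_sum: "finite A \<Longrightarrow> (\<And>i. i \<in> A \<Longrightarrow> f i holomorphic_on UNIV) \<Longrightarrow> mean (\<lambda>z. \<Sum>i\<in>A. f i z) = (\<Sum>i\<in>A. mean (f i))"
  unfolding mean_def by (intro contour_integral_sum) (auto intro: mean_integrable)

definition ee :: "complex \<Rightarrow> complex" where
  "ee z = exp (2 * of_real pi * \<i> * z)"

lemma ee_add: "ee (z + w) = ee z * ee w"
  by (simp add: ee_def exp_add distrib_left)

lemma ee_0 [simp]: "ee 0 = 1" by (simp add: ee_def)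
lemma ee_nz [simp]: "ee z \<noteq> 0" by (simp add: ee_def)

lemma ee_int [simp]: "ee (of_int k) = 1"
  using exp_integer_2pi[of "of_int k"] by (simp add: ee_def mult_ac)

lemma ee_1 [simp]: "ee 1 = 1" using ee_int[of 1] by (simp del: ee_int)

lemma ee_holo: "f holomorphic_on S \<Longrightarrow> (\<lambda>z. ee (f z)) holomorphic_on S"
  unfolding ee_def by (intro holomorphic_intros)

lemma norm_ee: "norm (ee z) = exp (- 2 * pi * Im z)"
  by (simp add: ee_def norm_exp_eq_Re)

lemma ee_eq_1: "ee z = 1 \<longleftrightarrow> z \<in> \<int>"
proof
  assume "ee z = 1"
  then have "Re (2 * of_real pi * \<i> * z) = 0" "\<exists>n::int. Im (2 * of_real pi * \<i> * z) = of_int (2 * n) * pi"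
    unfolding ee_def exp_eq_1 by auto
  then obtain n :: int where "Im z = 0" "Re z = of_int n" by auto
  then have "z = of_int n" by (simp add: complex_eq_iff)
  then show "z \<in> \<int>" by simp
qed (auto elim: Ints_cases)

lemma mean_ee: "mean (\<lambda>z. ee (of_int k * z)) = (if k = 0 then 1 else 0)"
proof (cases "k = 0")
  case True
  then show ?thesis using mean_primitive[of "\<lambda>z. z" "\<lambda>z. 1"] by simp
next
  case False
  have "((\<lambda>z. ee (of_int k * z) / (2 * of_real pi * \<i> * of_int k)) has_field_derivative ee (of_int k * z)) (at z)" for z
    using False unfolding ee_def by (auto intro!: derivative_eq_intros simp: field_simps)
  then show ?thesis using mean_primitive[of "\<lambda>z. ee (of_int k * z) / (2 * of_real pi * \<i> * of_int k)" "\<lambda>z. ee (of_int k * z)"] False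
    by simp
qed

definition fourier_coeff :: "(complex \<Rightarrow> complex) \<Rightarrow> int \<Rightarrow> complex" where
  "fourier_coeff F m = mean (\<lambda>z. F z * ee (- of_int m * z))"

lemma ee_per: "ee (- of_int m * (z + 1)) = ee (- of_int m * z)"
proof -
  have "- of_int m * (z + 1) = - of_int m * z + of_int (- m)" by (simp add: algebra_simps)
  then show ?thesis by (simp only: ee_add ee_int mult_1_right)
qed

lemma fourier_coeff_decay:
  assumes "F holomorphic_on UNIV" "\<And>z. F (z + 1) = F z"
  obtains B where "B > 0" "\<And>m. norm (fourier_coeff F m) \<le> B * exp (- 2 * pi * \<bar>real_of_int m\<bar>)"
proof -
  have "compact ((\<lambda>t. F (of_real t + \<i>)) ` {0..1}) \<and> compact ((\<lambda>t. F (of_real t - \<i>)) ` {0..1})"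
    by (intro conjI compact_continuous_image continuous_on_compose2[OF holomorphic_on_imp_continuous_on[OF assms(1)]] continuous_intros) simp_all
  then have "bounded ((\<lambda>t. F (of_real t + \<i>)) ` {0..1} \<union> (\<lambda>t. F (of_real t - \<i>)) ` {0..1})"
    by (simp add: compact_imp_bounded)
  then obtain B where B: "B > 0" "\<And>x. x \<in> (\<lambda>t. F (of_real t + \<i>)) ` {0..1} \<union> (\<lambda>t. F (of_real t - \<i>)) ` {0..1} \<Longrightarrow> norm x \<le> B"
    unfolding bounded_pos by blast
  have "norm (fourier_coeff F m) \<le> B * exp (- 2 * pi * \<bar>real_of_int m\<bar>)" for m
  proof -
    \<comment> \<open>Shifting down for m >= 0 and up for m < 0 makes the exponential small in
      either case.\<close>
    define w where "w = (if m \<ge> 0 then - \<i> else \<i>)"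
    have "fourier_coeff F m = mean (\<lambda>z. F (z + w) * ee (- of_int m * (z + w)))"
      unfolding fourier_coeff_def
      by (rule mean_shift[symmetric], (intro holomorphic_intros ee_holo assms(1)), (simp only: assms(2) ee_per))
    also have "norm \<dots> \<le> B * exp (- 2 * pi * \<bar>real_of_int m\<bar>)"
    proof (rule mean_bound)
      show "(\<lambda>z. F (z + w) * ee (- of_int m * (z + w))) holomorphic_on UNIV"
        by (intro holomorphic_intros ee_holo holomorphic_shift assms(1))
      fix t :: real assume t: "0 \<le> t" "t \<le> 1"
      have "norm (F (of_real t + w)) \<le> B"
        using t by (intro B(2)) (auto simp: w_def)
      moreover have "norm (ee (- of_int m * (of_real t + w))) = exp (- 2 * pi * \<bar>real_of_int m\<bar>)"
        by (simp add: norm_ee w_def)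
      ultimately show "norm (F (of_real t + w) * ee (- of_int m * (of_real t + w))) \<le> B * exp (- 2 * pi * \<bar>real_of_int m\<bar>)"
        by (simp add: norm_mult)
    qed
    finally show ?thesis .
  qed
  then show ?thesis using that B(1) by blast
qed

lemma Ints_sparse: "(\<int> :: complex set) sparse_in UNIV"
proof -
  have "\<not> z islimpt (\<int> :: complex set)" for z
  proof (rule discrete_imp_not_islimpt[of 1])
    fix x y :: complex assume "x \<in> \<int>" "y \<in> \<int>" "dist y x < 1"
    then obtain a b :: int where ab: "x = of_int a" "y = of_int b" by (auto elim!: Ints_cases)
    then have "\<bar>b - a\<bar> < 1" using \<open>dist y x < 1\<close>
      by (metis dist_of_int of_int_less_1_iff)
    then show "y = x" using ab by simp
  qed simp
  then show ?thesis by (simp add: sparse_in_open)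
qed

text \<open>With \<open>F z - F 0 = K z (1 - ee (- z))\<close> and \<open>K\<close> entire, the Fourier coefficients of \<open>K\<close> are constant on \<open>m \<ge> 1\<close> and on
  \<open>m \<le> 0\<close>, with jump \<open>F 0\<close>; since they decay, the jump is 0. This avoids the convergence of Fourier series.\<close>
lemma fourier_coeff_zero_imp_0_at_0:
  assumes F: "F holomorphic_on UNIV" and per: "\<And>z. F (z + 1) = F z" and fc: "\<And>m. fourier_coeff F m = 0"
  shows "F 0 = 0"
proof -
  have perI: "F (z + of_int n) = F z" for z n
  proof (induction n rule: int_induct[where k = 0])
    case (step1 i)
    then show ?case using per[of "z + of_int i"] by (simp add: add_ac)
  next
    case (step2 i)
    then show ?case using per[of "z + of_int (i - 1)"] by (simp add: add_ac)
  qed simp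
  \<comment> \<open>The value at an integer is the limit of the quotient there:
    \<open>1 - ee (- z)\<close> has a simple zero with derivative 2 pi i.\<close>
  define K where "K = (\<lambda>z. if z \<in> \<int> then deriv F z / (2 * of_real pi * \<i>) else (F z - F 0) / (1 - ee (- z)))"
  have K_eq: "F z - F 0 = K z * (1 - ee (- z))" for z
  proof (cases "z \<in> \<int>")
    case True
    then obtain n where "z = of_int n" by (auto elim: Ints_cases)
    then show ?thesis using perI[of 0 n] ee_int[of "-n"] by (simp del: ee_int)
  next
    case False
    then have "ee (- z) \<noteq> 1" by (metis Ints_minus add.inverse_inverse ee_eq_1)
    then show ?thesis using False by (simp add: K_def)
  qed
  have K: "K holomorphic_on UNIV"
  proof (rule no_sparse_singularity[OF _ open_UNIV Ints_sparse])
    have "(\<lambda>z. (F z - F 0) / (1 - ee (- z))) holomorphic_on UNIV - \<int>"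
    proof (intro holomorphic_intros ee_holo)
      show "1 - ee (- z) \<noteq> 0" if "z \<in> UNIV - \<int>" for z
        using that by (metis Diff_iff Ints_minus add.inverse_inverse ee_eq_1 right_minus_eq)
    qed (use F in \<open>auto elim: holomorphic_on_subset\<close>)
    then show "K holomorphic_on UNIV - \<int>"
      by (rule holomorphic_transform) (auto simp: K_def)
    fix z :: complex assume z: "z \<in> \<int>"
    then obtain n where n: "z = of_int n" by (auto elim: Ints_cases)
    have F0: "F z = F 0" using perI[of 0 n] n by simp
    have e1: "ee (- z) = 1" using n ee_int[of "-n"] by (simp del: ee_int)
    have "((\<lambda>w. (F w - F z) / (w - z)) \<longlongrightarrow> deriv F z) (at z)"
      using holomorphic_derivI[OF F open_UNIV UNIV_I] by (simp add: has_field_derivative_iff)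
    moreover have "((\<lambda>w. ee (- w)) has_field_derivative (- 2 * of_real pi * \<i> * ee (- z))) (at z)"
      unfolding ee_def by (auto intro!: derivative_eq_intros)
    then have "((\<lambda>w. (ee (- w) - ee (- z)) / (w - z)) \<longlongrightarrow> - (2 * of_real pi * \<i>)) (at z)"
      by (simp add: has_field_derivative_iff e1)
    ultimately have "((\<lambda>w. ((F w - F z) / (w - z)) / (- ((ee (- w) - ee (- z)) / (w - z)))) \<longlongrightarrow> deriv F z / (- (- (2 * of_real pi * \<i>)))) (at z)"
      by (intro tendsto_intros) auto
    then have "((\<lambda>w. ((F w - F z) / (w - z)) / (- ((ee (- w) - ee (- z)) / (w - z)))) \<longlongrightarrow> K z) (at z)"
      using z by (simp add: K_def)
    moreover have "\<forall>\<^sub>F w in at z. ((F w - F z) / (w - z)) / (- ((ee (- w) - ee (- z)) / (w - z))) = K w"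
    proof -
      have "\<forall>\<^sub>F w in at z. w \<notin> \<int>" "\<forall>\<^sub>F w in at z. w \<noteq> z"
        using Ints_sparse by (auto simp: sparse_in_eventually_iff eventually_at_filter)
      then show ?thesis
      proof eventually_elim
        case (elim w)
        then have "ee (- w) \<noteq> 1" by (metis Ints_minus add.inverse_inverse ee_eq_1)
        have "(a / d) / (- ((e - 1) / d)) = a / (1 - e)" if "d \<noteq> 0" for a d e :: complex
            using that by (simp add: minus_divide_left)
          from this[of "w - z" "F w - F 0" "ee (- w)"] show ?case using elim by (simp add: K_def F0 e1)
      qed
    qed
    ultimately show "(K \<longlongrightarrow> K z) (at z)" by (rule Lim_transform_eventually)
  qed
  have Kper: "K (z + 1) = K z" for z
  proof (cases "z \<in> \<int>")
    case True
    have "((\<lambda>z. F (z + 1)) has_field_derivative deriv F (z + 1)) (at z)"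
      using DERIV_shift[of F "deriv F (z + 1)" z 1] holomorphic_derivI[OF F open_UNIV UNIV_I] by blast
    then have "deriv F (z + 1) = deriv F z" unfolding per by (metis DERIV_imp_deriv)
    then show ?thesis using True by (simp add: K_def per)
  next
    case False
    moreover have "z + 1 \<notin> \<int>" using False by (metis Ints_1 Ints_diff add_diff_cancel_right')
    moreover have "ee (- (z + 1)) = ee (- z)" using ee_per[of 1 z] by simp
    ultimately show ?thesis by (simp add: K_def per)
  qed
  have rec: "fourier_coeff K (m + 1) = fourier_coeff K m + (if m = 0 then F 0 else 0)" for m
  proof -
    have "fourier_coeff F m = mean (\<lambda>z. F 0 * ee (of_int (- m) * z) + (K z * ee (- of_int m * z) - K z * ee (- of_int (m + 1) * z)))"
    proof -
      have "F z * ee (- of_int m * z) = F 0 * ee (of_int (- m) * z) + (K z * ee (- of_int m * z) - K z * ee (- of_int (m + 1) * z))" for z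
      proof -
        have A: "F z = F 0 + K z * (1 - ee (- z))" using K_eq[of z] by (simp add: algebra_simps)
        have B: "ee (- of_int (m + 1) * z) = ee (- z) * ee (- of_int m * z)"
          by (simp add: ee_add[symmetric] algebra_simps)
        show ?thesis by (simp only: A B of_int_minus) (simp add: algebra_simps)
      qed
      then show ?thesis by (simp add: fourier_coeff_def)
    qed
    also have "\<dots> = F 0 * mean (\<lambda>z. ee (of_int (- m) * z)) + (fourier_coeff K m - fourier_coeff K (m + 1))"
      unfolding fourier_coeff_def
      by (subst mean_add, (intro holomorphic_intros ee_holo K)+, subst mean_diff, (intro holomorphic_intros ee_holo K)+,
          subst mean_cmult, (intro holomorphic_intros ee_holo K)+) simp
    also have "mean (\<lambda>z. ee (of_int (- m) * z)) = (if m = 0 then 1 else 0)"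
      unfolding mean_ee by simp
    finally show ?thesis using fc[of m] by (simp add: algebra_simps split: if_splits)
  qed
  obtain B where B: "B > 0" "\<And>m. norm (fourier_coeff K m) \<le> B * exp (- 2 * pi * \<bar>real_of_int m\<bar>)"
    using fourier_coeff_decay[OF K Kper] by metis
  have lim: "(\<lambda>n. B * exp (- 2 * pi * real n)) \<longlonglongrightarrow> 0"
    by real_asymp
  have p: "fourier_coeff K (int n + 1) = fourier_coeff K 1" for n
  proof (induction n)
    case (Suc n)
    then show ?case using rec[of "int n + 1"] by (simp add: add_ac)
  qed simp
  have q: "fourier_coeff K (- int n) = fourier_coeff K 0" for n
  proof (induction n)
    case (Suc n)
    then show ?case using rec[of "- int (Suc n)"] by simp
  qed simp
  have "norm (fourier_coeff K 1) \<le> 0"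
  proof (rule LIMSEQ_le_const[OF lim])
    have "norm (fourier_coeff K 1) \<le> B * exp (- 2 * pi * real n)" for n
    proof -
      have "norm (fourier_coeff K 1) \<le> B * exp (- 2 * pi * (real n + 1))" using B(2)[of "int n + 1"] by (simp add: p)
      also have "\<dots> \<le> B * exp (- 2 * pi * real n)" using B(1) by simp
      finally show ?thesis .
    qed
    then show "\<exists>N. \<forall>n\<ge>N. norm (fourier_coeff K 1) \<le> B * exp (- 2 * pi * real n)" by blast
  qed
  moreover have "norm (fourier_coeff K 0) \<le> 0"
  proof (rule LIMSEQ_le_const[OF lim])
    show "\<exists>N. \<forall>n\<ge>N. norm (fourier_coeff K 0) \<le> B * exp (- 2 * pi * real n)" using B(2)[of "- int n" for n] by (auto simp: q)
  qed
  ultimately show ?thesis using rec[of 0] by simp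
qed

lemma fourier_coeff_zero_imp_0:
  assumes F: "F holomorphic_on UNIV" and per: "\<And>z. F (z + 1) = F z" and fc: "\<And>m. fourier_coeff F m = 0"
  shows "F s = 0"
proof -
  define Fs where "Fs = (\<lambda>z. F (z + s))"
  have Fs: "Fs holomorphic_on UNIV"
    unfolding Fs_def by (rule holomorphic_shift[OF F])
  have "fourier_coeff Fs m = 0" for m
  proof -
    have "fourier_coeff Fs m = mean (\<lambda>z. ee (of_int m * s) * (F (z + s) * ee (- of_int m * (z + s))))"
    proof -
      have "ee (- of_int m * z) = ee (of_int m * s) * ee (- of_int m * (z + s))" for z
        unfolding ee_add[symmetric] by (simp add: algebra_simps)
      then show ?thesis unfolding fourier_coeff_def Fs_def by (simp add: mult_ac)
    qed
    also have "\<dots> = ee (of_int m * s) * mean (\<lambda>z. F (z + s) * ee (- of_int m * (z + s)))"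
      by (rule mean_cmult) (intro holomorphic_intros ee_holo holomorphic_shift F)
    also have "mean (\<lambda>z. F (z + s) * ee (- of_int m * (z + s))) = fourier_coeff F m"
      unfolding fourier_coeff_def by (rule mean_shift, (intro holomorphic_intros ee_holo F), (simp only: per ee_per))
    finally show ?thesis by (simp add: fc)
  qed
  moreover have "Fs (z + 1) = Fs z" for z using per[of "z + s"] by (simp add: Fs_def add_ac)
  ultimately have "Fs 0 = 0" using fourier_coeff_zero_imp_0_at_0[OF Fs] by blast
  then show ?thesis by (simp add: Fs_def)
qed

text \<open>Shifting the integration line by \<tau> links the coefficients of index m and m + 2 by a
  nonzero factor, so two adjacent ones determine all the others. This is the dimension two of the
  space.\<close>

lemma order2_theta_zero:
  assumes F: "F holomorphic_on UNIV" and per: "\<And>z. F (z + 1) = F z"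
    and quasi: "\<And>z. F (z + \<tau>) = ee (- \<tau> - 2 * z) * F z"
    and 0: "fourier_coeff F 0 = 0" "fourier_coeff F 1 = 0"
  shows "F z = 0"
proof -
  have rec: "fourier_coeff F m = ee (- \<tau> * (1 + of_int m)) * fourier_coeff F (m + 2)" for m
  proof -
    have "fourier_coeff F m = mean (\<lambda>z. F (z + \<tau>) * ee (- of_int m * (z + \<tau>)))"
      unfolding fourier_coeff_def by (rule mean_shift[symmetric], (intro holomorphic_intros ee_holo F), (simp only: per ee_per))
    also have "\<dots> = mean (\<lambda>z. ee (- \<tau> * (1 + of_int m)) * (F z * ee (- of_int (m + 2) * z)))"
    proof -
      have "F (z + \<tau>) * ee (- of_int m * (z + \<tau>)) = ee (- \<tau> * (1 + of_int m)) * (F z * ee (- of_int (m + 2) * z))" for z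
      proof -
        have "ee (- \<tau> - 2 * z) * ee (- of_int m * (z + \<tau>)) = ee (- \<tau> * (1 + of_int m)) * ee (- of_int (m + 2) * z)"
          unfolding ee_add[symmetric] by (rule arg_cong[where f = ee]) (simp add: algebra_simps)
        then show ?thesis unfolding quasi by (metis (no_types) mult.assoc mult.commute)
      qed
      then show ?thesis by simp
    qed
    also have "\<dots> = ee (- \<tau> * (1 + of_int m)) * fourier_coeff F (m + 2)"
      unfolding fourier_coeff_def by (rule mean_cmult) (intro holomorphic_intros ee_holo F)
    finally show ?thesis .
  qed
  have "fourier_coeff F m = 0 \<and> fourier_coeff F (m + 1) = 0" for m
  proof (induction m rule: int_induct[where k = 0])
    case (step1 i)
    then show ?case using rec[of i] by (simp add: add.assoc)
  next
    case (step2 i)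
    then show ?case using rec[of "i - 1"] by (simp add: add_ac)
  qed (use 0 in simp)
  then show ?thesis using fourier_coeff_zero_imp_0[OF F per] by blast
qed

section \<open>The theta series\<close>

text \<open>Jacobi's odd theta function, with characteristic (1/2, 1/2); it is the sum inside
  \<open>unnormalized_sigma\<close> at \<open>v = u / \<omega>'\<close>.\<close>

definition theta :: "complex \<Rightarrow> complex \<Rightarrow> complex" where
  "theta \<tau> v = (\<Sum>\<^sub>\<infinity>m\<in>(UNIV :: int set).
        exp (of_real pi * \<i> * \<tau> * (of_int m + 1/2)^2 + 2 * of_real pi * \<i> * (of_int m + 1/2) * (v + 1/2)))"

definition theta_term :: "complex \<Rightarrow> int \<Rightarrow> complex \<Rightarrow> complex" where
  "theta_term \<tau> m v = exp (of_real pi * \<i> * \<tau> * (of_int m + 1/2)^2 + 2 * of_real pi * \<i> * (of_int m + 1/2) * (v + 1/2))"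

lemma norm_theta_term:
  "norm (theta_term \<tau> m v) = exp (- (pi * Im \<tau> * (real_of_int m + 1/2)^2) - 2 * pi * (real_of_int m + 1/2) * Im v)"
proof -
  have e: "(of_int m + 1/2 :: complex) = of_real (real_of_int m + 1/2)" by simp
  show ?thesis unfolding theta_term_def norm_exp_eq_Re e by (simp add: power2_eq_square algebra_simps)
qed

lemma summable_exp_half: "(\<lambda>m::int. exp (- \<bar>real_of_int m + 1/2\<bar>)) summable_on UNIV"
proof -
  have a: "summable (\<lambda>n. exp (-1/2) * exp (-1::real) ^ n)" by (intro summable_mult summable_geometric) auto
  have b: "exp (-1/2) * exp (-1::real) ^ n = exp (- (real n + 1/2))" for n
    by (simp add: exp_of_nat_mult[symmetric] exp_add[symmetric])
  have "summable (\<lambda>n. exp (- (real n + 1/2)))" using a by (simp only: b)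
  then have nat: "(\<lambda>n. exp (- (real n + 1/2))) summable_on UNIV"
    by (intro norm_summable_imp_summable_on) simp
  have 1: "(\<lambda>m::int. exp (- \<bar>real_of_int m + 1/2\<bar>)) summable_on range int"
    by (subst summable_on_reindex) (use nat in \<open>simp_all add: o_def\<close>)
  have 2: "(\<lambda>m::int. exp (- \<bar>real_of_int m + 1/2\<bar>)) summable_on range (\<lambda>n. -1 - int n)"
  proof (subst summable_on_reindex)
    show "inj (\<lambda>n. -1 - int n)" by (auto intro: injI)
    have "\<bar>real_of_int (-1 - int n) + 1/2\<bar> = real n + 1/2" for n by simp
    then show "((\<lambda>m::int. exp (- \<bar>real_of_int m + 1/2\<bar>)) \<circ> (\<lambda>n. -1 - int n)) summable_on UNIV"
      using nat by (simp add: o_def)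
  qed
  have "(UNIV :: int set) = range int \<union> range (\<lambda>n. -1 - int n)"
  proof (intro equalityI subsetI)
    fix m :: int
    show "m \<in> range int \<union> range (\<lambda>n. -1 - int n)"
    proof (cases "m \<ge> 0")
      case True
      then have "m = int (nat m)" by simp
      then show ?thesis by blast
    next
      case False
      then have "m = -1 - int (nat (-1 - m))" by simp
      then show ?thesis by blast
    qed
  qed simp
  moreover have "range int \<inter> range (\<lambda>n. -1 - int n) = {}" by auto
  ultimately show ?thesis using summable_on_Un_disjoint[OF 1 2] by simp
qed

lemma theta_term_bound:
  assumes "Im \<tau> > 0" "\<bar>Im v\<bar> \<le> R"
  shows "norm (theta_term \<tau> m v) \<le> exp ((2 * pi * R + 1)^2 / (4 * pi * Im \<tau>)) * exp (- \<bar>real_of_int m + 1/2\<bar>)"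
proof -
  define k where "k = real_of_int m + 1/2"
  have "R \<ge> 0" using assms(2) by linarith
  have "- (k * Im v) \<le> \<bar>k\<bar> * R" using assms(2) by (metis abs_ge_minus_self abs_ge_zero abs_mult mult_left_mono order_trans)
  then have 1: "- 2 * pi * k * Im v \<le> 2 * pi * (\<bar>k\<bar> * R)" using pi_gt_zero by (simp add: mult_le_cancel_left_pos algebra_simps)
     (metis (no_types, lifting) minus_mult_minus mult.commute mult.left_commute mult_left_mono pi_ge_zero mult_minus_right)
  \<comment> \<open>Completing the square in |k|. The 1 added to 2 pi R is what leaves the summable
    factor exp (-|k|).\<close>
  have "0 \<le> (2 * pi * Im \<tau> * \<bar>k\<bar> - (2 * pi * R + 1))^2" by simp
  also have "\<dots> = 4 * pi * Im \<tau> * (pi * Im \<tau> * k^2 - (2 * pi * R + 1) * \<bar>k\<bar>) + (2 * pi * R + 1)^2"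
    by (simp add: power2_eq_square algebra_simps)
  finally have "- (pi * Im \<tau> * k^2) + (2 * pi * R + 1) * \<bar>k\<bar> \<le> (2 * pi * R + 1)^2 / (4 * pi * Im \<tau>)"
    using assms(1) by (simp add: field_simps)
  with 1 have "- (pi * Im \<tau> * k^2) - 2 * pi * k * Im v \<le> (2 * pi * R + 1)^2 / (4 * pi * Im \<tau>) + - \<bar>k\<bar>"
    by (simp add: algebra_simps)
  then show ?thesis unfolding norm_theta_term exp_add[symmetric] k_def by simp
qed

lemma theta_uniform:
  assumes "Im \<tau> > 0"
  shows "uniform_limit {v. \<bar>Im v\<bar> \<le> R} (\<lambda>X v. \<Sum>m\<in>X. theta_term \<tau> m v) (theta \<tau>) (finite_subsets_at_top UNIV)"
  unfolding theta_def [abs_def] theta_term_def [symmetric]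
  by (rule Weierstrass_m_test_general[where M = "\<lambda>m. exp ((2 * pi * R + 1)^2 / (4 * pi * Im \<tau>)) * exp (- \<bar>real_of_int m + 1/2\<bar>)"])
     (auto intro!: theta_term_bound assms summable_on_cmult_right summable_exp_half)

lemma theta_holomorphic:
  assumes "Im \<tau> > 0"
  shows "theta \<tau> holomorphic_on UNIV"
proof (rule holomorphic_onI)
  fix z :: complex
  have sub: "cball z 1 \<subseteq> {v. \<bar>Im v\<bar> \<le> \<bar>Im z\<bar> + 1}"
  proof
    fix v assume "v \<in> cball z 1"
    then have "norm (z - v) \<le> 1" by (simp add: dist_norm)
    then have "\<bar>Im (z - v)\<bar> \<le> 1" using abs_Im_le_cmod order_trans by blast
    then show "v \<in> {v. \<bar>Im v\<bar> \<le> \<bar>Im z\<bar> + 1}" by simp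
  qed
  have "\<forall>\<^sub>F X in finite_subsets_at_top UNIV. continuous_on (cball z 1) (\<lambda>v. \<Sum>m\<in>X. theta_term \<tau> m v) \<and>
        (\<lambda>v. \<Sum>m\<in>X. theta_term \<tau> m v) holomorphic_on ball z 1"
    unfolding theta_term_def by (intro always_eventually allI conjI continuous_intros holomorphic_intros) auto
  from holomorphic_uniform_limit[OF this uniform_limit_on_subset[OF theta_uniform[OF assms] sub]]
  have "theta \<tau> holomorphic_on ball z 1" by simp blast
  then show "theta \<tau> field_differentiable at z within UNIV"
    by (auto intro: holomorphic_on_imp_differentiable_at)
qed

lemma theta_shift_1: "theta \<tau> (v + 1) = - theta \<tau> v"
proof -
  have "theta_term \<tau> m (v + 1) = - theta_term \<tau> m v" for m
  proof -
    have "theta_term \<tau> m (v + 1) = theta_term \<tau> m v * (ee (of_int m) * exp (of_real pi * \<i>))"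
      unfolding theta_term_def ee_def exp_add[symmetric] by (rule arg_cong[where f = exp]) (simp add: algebra_simps)
    then show ?thesis by simp
  qed
  then show ?thesis unfolding theta_def theta_term_def[symmetric] by (simp add: infsum_uminus)
qed

lemma theta_shift_tau: "theta \<tau> (v + \<tau>) = - exp (- of_real pi * \<i> * \<tau> - 2 * of_real pi * \<i> * v) * theta \<tau> v"
proof -
  have "theta_term \<tau> m (v + \<tau>) = (- exp (- of_real pi * \<i> * \<tau> - 2 * of_real pi * \<i> * v)) * theta_term \<tau> (m + 1) v" for m
  proof -
    have "- exp (- of_real pi * \<i> * \<tau> - 2 * of_real pi * \<i> * v) = exp (- of_real pi * \<i>) * exp (- of_real pi * \<i> * \<tau> - 2 * of_real pi * \<i> * v)"
      by (simp add: exp_minus)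
    then show ?thesis
      unfolding theta_term_def exp_add[symmetric] by (simp only:, simp only: exp_add[symmetric])
        (rule arg_cong[where f = exp], simp add: power2_eq_square algebra_simps)
  qed
  then have "theta \<tau> (v + \<tau>) = (\<Sum>\<^sub>\<infinity>m\<in>UNIV. (- exp (- of_real pi * \<i> * \<tau> - 2 * of_real pi * \<i> * v)) * theta_term \<tau> (m + 1) v)"
    unfolding theta_def theta_term_def[symmetric] by simp
  also have "\<dots> = (- exp (- of_real pi * \<i> * \<tau> - 2 * of_real pi * \<i> * v)) * (\<Sum>\<^sub>\<infinity>m\<in>UNIV. theta_term \<tau> (m + 1) v)"
    by (rule infsum_cmult_right')
  also have "(\<Sum>\<^sub>\<infinity>m\<in>UNIV. theta_term \<tau> (m + 1) v) = theta \<tau> v"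
    unfolding theta_def theta_term_def[symmetric]
    by (rule infsum_reindex_bij_betw[where g = "\<lambda>m. m + 1"]) (rule bij_betwI[of _ _ _ "\<lambda>m. m - 1"], auto)
  finally show ?thesis .
qed

text \<open>The substitution of -1 - m for m negates m + 1/2, and the shift of v by 1/2 leaves the
  factor exp (pi i (2 m + 1)) = -1.\<close>

lemma theta_minus: "theta \<tau> (- v) = - theta \<tau> v"
proof -
  have "theta_term \<tau> m (- v) = - theta_term \<tau> (-1 - m) v" for m
  proof -
    have "theta_term \<tau> m (- v) = theta_term \<tau> (-1 - m) v * (ee (of_int m) * exp (of_real pi * \<i>))"
      unfolding theta_term_def ee_def exp_add[symmetric] by (rule arg_cong[where f = exp]) (simp add: power2_eq_square algebra_simps)
    then show ?thesis by simp
  qed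
  then have "theta \<tau> (- v) = - (\<Sum>\<^sub>\<infinity>m\<in>UNIV. theta_term \<tau> (-1 - m) v)"
    unfolding theta_def theta_term_def[symmetric] by (simp add: infsum_uminus)
  also have "(\<Sum>\<^sub>\<infinity>m\<in>UNIV. theta_term \<tau> (-1 - m) v) = theta \<tau> v"
    unfolding theta_def theta_term_def[symmetric]
    by (rule infsum_reindex_bij_betw[where g = "\<lambda>m. -1 - m"]) (rule bij_betwI[of _ _ _ "\<lambda>m. -1 - m"], auto)
  finally show ?thesis .
qed

text \<open>If theta vanished, some finite partial sum containing the index 0 would be uniformly
  small on the real line. Its mean against a suitable exponential is the coefficient
  \<open>a 0\<close>, which is an exponential and not 0.\<close>

lemma theta_nonzero:
  assumes "Im \<tau> > 0"
  shows "\<exists>v. theta \<tau> v \<noteq> 0"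
proof (rule ccontr)
  assume "\<not> ?thesis"
  then have 0: "theta \<tau> v = 0" for v by simp
  define a where "a = (\<lambda>m::int. exp (of_real pi * \<i> * \<tau> * (of_int m + 1/2)^2 + of_real pi * \<i> * (of_int m + 1/2)))"
  \<comment> \<open>Splitting off exp (pi i v) turns the half-integral frequencies into integral
    ones; on the real line this factor has norm 1.\<close>
  have tm: "theta_term \<tau> m v = exp (of_real pi * \<i> * v) * (a m * ee (of_int m * v))" for m v
    unfolding a_def theta_term_def ee_def exp_add[symmetric] by (rule arg_cong[where f = exp]) (simp add: algebra_simps add_divide_distrib)
  define \<epsilon> where "\<epsilon> = norm (a 0) / 2"
  have "\<epsilon> > 0" by (simp add: \<epsilon>_def a_def)
  from uniform_limitD[OF theta_uniform[OF assms, of 0] this]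
  have ev: "\<forall>\<^sub>F X in finite_subsets_at_top UNIV. \<forall>v\<in>{v. \<bar>Im v\<bar> \<le> 0}. dist (\<Sum>m\<in>X. theta_term \<tau> m v) (theta \<tau> v) < \<epsilon>" .
  have "\<forall>\<^sub>F X in finite_subsets_at_top UNIV. finite X \<and> {0::int} \<subseteq> X"
    unfolding eventually_finite_subsets_at_top by (intro exI[of _ "{0}"]) auto
  then have "\<forall>\<^sub>F X in finite_subsets_at_top UNIV. finite X \<and> {0::int} \<subseteq> X" .
  from eventually_happens[OF eventually_conj[OF ev this]]
  obtain X where X: "finite X" "0 \<in> X" "\<And>v. Im v = 0 \<Longrightarrow> norm (\<Sum>m\<in>X. theta_term \<tau> m v) < \<epsilon>"
    using 0 by auto
  define P where "P = (\<lambda>v. \<Sum>m\<in>X. a m * ee (of_int m * v))"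
  have "mean P = (\<Sum>m\<in>X. mean (\<lambda>v. a m * ee (of_int m * v)))"
    unfolding P_def by (rule mean_sum[OF X(1)]) (intro holomorphic_intros ee_holo)
  also have "\<dots> = (\<Sum>m\<in>X. if m = 0 then a 0 else 0)"
  proof (rule sum.cong)
    fix m
    have "mean (\<lambda>v. a m * ee (of_int m * v)) = a m * mean (\<lambda>v. ee (of_int m * v))"
      by (rule mean_cmult) (intro holomorphic_intros ee_holo)
    then show "mean (\<lambda>v. a m * ee (of_int m * v)) = (if m = 0 then a 0 else 0)" unfolding mean_ee by simp
  qed simp
  also have "\<dots> = a 0" using X by simp
  finally have "mean P = a 0" .
  moreover have "norm (mean P) \<le> \<epsilon>"
  proof (rule mean_bound)
    show "P holomorphic_on UNIV" unfolding P_def by (intro holomorphic_intros ee_holo)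
    fix t :: real
    have "(\<Sum>m\<in>X. theta_term \<tau> m (of_real t)) = exp (of_real pi * \<i> * of_real t) * P (of_real t)"
      by (simp add: tm P_def sum_distrib_left)
    moreover have "norm (exp (of_real pi * \<i> * of_real t)) = 1" by (simp add: norm_exp_eq_Re)
    ultimately have "norm (P (of_real t)) = norm (\<Sum>m\<in>X. theta_term \<tau> m (of_real t))" by (simp add: norm_mult)
    then show "norm (P (of_real t)) \<le> \<epsilon>" using X(3)[of "of_real t"] by simp
  qed
  ultimately show False using \<open>\<epsilon> > 0\<close> by (simp add: \<epsilon>_def)
qed

section \<open>The addition theorem\<close>

text \<open>The point at infinity as neutral element: when the first point runs to infinity along
  the curve, the chord formula for the sum returns the limit of the second. An arbitrary filter
  allows its use at 0 and at any other pole.\<close>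

lemma addition_limit:
  fixes X Y X2 Y2 :: "'a \<Rightarrow> complex"
  assumes X: "filterlim X at_infinity F" and X2: "(X2 \<longlongrightarrow> a) F" and Y2: "(Y2 \<longlongrightarrow> b) F"
    and curve: "\<forall>\<^sub>F w in F. (Y w)^2 = 4 * (X w)^3 + b2 * (X w)^2 + 2 * b4 * X w + b6"
  shows "((\<lambda>w. - X w - X2 w - b2 / 4 + ((Y w - Y2 w) / (X w - X2 w))^2 / 4) \<longlongrightarrow> a) F"
proof -
  \<comment> \<open>Coordinates at infinity: t = 1/X and p = Y/X^2 both tend to 0, because p^2 is a
    polynomial in t without constant term. The chord formula is a rational expression in them,
    continuous at t = p = 0.\<close>
  define t where "t = (\<lambda>w. inverse (X w))"
  define p where "p = (\<lambda>w. Y w * (t w)^2)"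
  have t: "(t \<longlongrightarrow> 0) F" unfolding t_def by (rule tendsto_inverse_0[THEN filterlim_compose, OF X])
  have Xnz: "\<forall>\<^sub>F w in F. X w \<noteq> 0"
    using filterlim_at_infinity_imp_eventually_ne[OF X] by blast
  have "((\<lambda>w. 4 * t w + b2 * (t w)^2 + 2 * b4 * (t w)^3 + b6 * (t w)^4) \<longlongrightarrow> 4 * 0 + b2 * 0^2 + 2 * b4 * 0^3 + b6 * 0^4) F"
    by (intro tendsto_intros t)
  moreover have "\<forall>\<^sub>F w in F. 4 * t w + b2 * (t w)^2 + 2 * b4 * (t w)^3 + b6 * (t w)^4 = (p w)^2"
    using curve Xnz
  proof eventually_elim
    case (elim w)
    have "(p w)^2 = (Y w)^2 * (t w)^4" by (simp add: p_def power_mult_distrib power_mult[symmetric])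
    also have "\<dots> = 4 * t w + b2 * (t w)^2 + 2 * b4 * (t w)^3 + b6 * (t w)^4"
      unfolding elim(1) t_def using elim(2) by (simp add: field_simps eval_nat_numeral)
    finally show ?case by simp
  qed
  ultimately have "((\<lambda>w. (p w)^2) \<longlongrightarrow> 0) F" using Lim_transform_eventually by fastforce
  then have "((\<lambda>w. norm ((p w)^2)) \<longlongrightarrow> 0) F" by (rule tendsto_norm_zero)
  then have "((\<lambda>w. sqrt (norm ((p w)^2))) \<longlongrightarrow> sqrt 0) F" by (intro tendsto_intros)
  then have p: "(p \<longlongrightarrow> 0) F" by (simp add: norm_power tendsto_norm_zero_iff)
  have "((\<lambda>w. (4 * X2 w + 4 * (X2 w)^2 * t w - 4 * (X2 w)^3 * (t w)^2 + 2 * b2 * X2 w * t w - b2 * (X2 w)^2 * (t w)^2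
      + 2 * b4 * t w + b6 * (t w)^2 - 2 * p w * Y2 w + (Y2 w)^2 * (t w)^2) / (4 * (1 - X2 w * t w)^2))
     \<longlongrightarrow> (4 * a + 4 * a^2 * 0 - 4 * a^3 * 0^2 + 2 * b2 * a * 0 - b2 * a^2 * 0^2
      + 2 * b4 * 0 + b6 * 0^2 - 2 * 0 * b + b^2 * 0^2) / (4 * (1 - a * 0)^2)) F"
    by (intro tendsto_intros t p X2 Y2) auto
  then have lim: "((\<lambda>w. (4 * X2 w + 4 * (X2 w)^2 * t w - 4 * (X2 w)^3 * (t w)^2 + 2 * b2 * X2 w * t w - b2 * (X2 w)^2 * (t w)^2
      + 2 * b4 * t w + b6 * (t w)^2 - 2 * p w * Y2 w + (Y2 w)^2 * (t w)^2) / (4 * (1 - X2 w * t w)^2)) \<longlongrightarrow> a) F"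
    by simp
  have "((\<lambda>w. 1 - X2 w * t w) \<longlongrightarrow> 1 - a * 0) F" by (intro tendsto_intros t X2)
  then have "\<forall>\<^sub>F w in F. 1 - X2 w * t w \<noteq> 0" by (rule tendsto_imp_eventually_ne) simp
  with curve Xnz have "\<forall>\<^sub>F w in F. (4 * X2 w + 4 * (X2 w)^2 * t w - 4 * (X2 w)^3 * (t w)^2 + 2 * b2 * X2 w * t w - b2 * (X2 w)^2 * (t w)^2
      + 2 * b4 * t w + b6 * (t w)^2 - 2 * p w * Y2 w + (Y2 w)^2 * (t w)^2) / (4 * (1 - X2 w * t w)^2)
      = - X w - X2 w - b2 / 4 + ((Y w - Y2 w) / (X w - X2 w))^2 / 4"
  proof eventually_elim
    case (elim w)
    have tX: "t w * X w = 1" using elim(2) by (simp add: t_def)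
    have "X w * (1 - X2 w * t w) = X w - X2 w" using tX by (simp add: algebra_simps)
    then have ne: "X w - X2 w \<noteq> 0" using elim(2,3) by auto
    have sq: "(X w - X2 w)^2 * (t w)^2 = (1 - X2 w * t w)^2" using tX by algebra
    define N where "N = 4 * X2 w + 4 * (X2 w)^2 * t w - 4 * (X2 w)^3 * (t w)^2 + 2 * b2 * X2 w * t w - b2 * (X2 w)^2 * (t w)^2
      + 2 * b4 * t w + b6 * (t w)^2 - 2 * p w * Y2 w + (Y2 w)^2 * (t w)^2"
    have "N = ((Y w - Y2 w)^2 - 4 * (X w + X2 w + b2/4) * (X w - X2 w)^2) * (t w)^2"
    proof -
      have "(Y w - Y2 w)^2 = (4 * (X w)^3 + b2 * (X w)^2 + 2 * b4 * X w + b6) - 2 * Y w * Y2 w + (Y2 w)^2"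
        unfolding elim(1)[symmetric] by algebra
      then have "((Y w - Y2 w)^2 - 4 * (X w + X2 w + b2/4) * (X w - X2 w)^2) =
        4 * (X w)^2 * X2 w + 4 * X w * (X2 w)^2 - 4 * (X2 w)^3 + 2 * b2 * X w * X2 w - b2 * (X2 w)^2 + 2 * b4 * X w + b6 - 2 * Y w * Y2 w + (Y2 w)^2"
        by (simp add: algebra_simps power2_eq_square power3_eq_cube)
      moreover have "p w = Y w * (t w)^2" by (simp add: p_def)
      ultimately show ?thesis unfolding N_def using tX by algebra
    qed
    then have "N / (4 * (1 - X2 w * t w)^2) = ((Y w - Y2 w)^2 - 4 * (X w + X2 w + b2/4) * (X w - X2 w)^2) * (t w)^2 / (4 * ((X w - X2 w)^2 * (t w)^2))"
      unfolding sq by simp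
    also have "\<dots> = ((Y w - Y2 w)^2 - 4 * (X w + X2 w + b2/4) * (X w - X2 w)^2) / (4 * (X w - X2 w)^2)"
      using elim(2) by (simp add: t_def)
    also have "\<dots> = - X w - X2 w - b2 / 4 + ((Y w - Y2 w) / (X w - X2 w))^2 / 4"
    proof -
      have "(a^2 - 4 * s * d^2) / (4 * d^2) = - s + (a / d)^2 / 4" if "d \<noteq> 0" for a s d :: complex
        using that by (simp add: power_divide field_simps)
      from this[OF ne, of "Y w - Y2 w" "X w + X2 w + b2/4"] show ?thesis by simp
    qed
    finally show ?case by (simp add: N_def)
  qed
  with lim show ?thesis by (rule Lim_transform_eventually)
qed

lemma sparse_reflect:
  fixes c :: complex
  assumes "L sparse_in UNIV"
  shows "{w. c - w \<in> L} sparse_in UNIV" "{w. c + w \<in> L} sparse_in UNIV"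
proof -
  have "\<forall>\<^sub>F w in at y. c - w \<notin> L" for y
  proof -
    have "filterlim (\<lambda>w. c - w) (at (c - y)) (at y)"
      by (rule filterlim_atI) (auto intro!: tendsto_intros simp: eventually_at_filter)
    moreover have "\<forall>\<^sub>F z in at (c - y). z \<notin> L" using assms by (simp add: sparse_in_eventually_iff)
    ultimately show ?thesis by (rule eventually_compose_filterlim[rotated])
  qed
  then show "{w. c - w \<in> L} sparse_in UNIV" by (simp add: sparse_in_eventually_iff)
  have "\<forall>\<^sub>F w in at y. c + w \<notin> L" for y
  proof -
    have "filterlim (\<lambda>w. c + w) (at (c + y)) (at y)"
      by (rule filterlim_atI) (auto intro!: tendsto_intros simp: eventually_at_filter)
    moreover have "\<forall>\<^sub>F z in at (c + y). z \<notin> L" using assms by (simp add: sparse_in_eventually_iff)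
    ultimately show ?thesis by (rule eventually_compose_filterlim[rotated])
  qed
  then show "{w. c + w \<in> L} sparse_in UNIV" by (simp add: sparse_in_eventually_iff)
qed

context weierstrass_function
begin

lemma L_closed: "closed L" using sparse by (rule sparse_in_UNIV_imp_closed)
lemma L_open: "open (- L)" using L_closed by auto
lemma L_connected: "connected (- L)"
  using sparse_imp_connected[OF _ connected_UNIV open_UNIV sparse] by (simp add: Compl_eq_Diff_UNIV)

lemma ev_not_L: "\<forall>\<^sub>F w in at z. w \<notin> L" "\<forall>\<^sub>F w in at z. c - w \<notin> L" "\<forall>\<^sub>F w in at z. c + w \<notin> L" "\<forall>\<^sub>F w in at z. w + c \<notin> L"
  using sparse sparse_reflect[OF sparse, of c] by (simp_all add: sparse_in_eventually_iff add.commute)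

lemma x_deriv: "u \<notin> L \<Longrightarrow> (x has_field_derivative deriv x u) (at u)"
  using holomorphic_derivI[OF hol L_open] by auto

lemma Y_hol: "deriv x holomorphic_on - L" by (rule holomorphic_deriv[OF hol L_open])

lemma Y_deriv: "u \<notin> L \<Longrightarrow> (deriv x has_field_derivative quad (x u)) (at u)"
  using holomorphic_derivI[OF Y_hol L_open, of u] ode2[of u] by auto

lemma x_cont: "u \<notin> L \<Longrightarrow> isCont x u" and Y_cont: "u \<notin> L \<Longrightarrow> isCont (deriv x) u"
  using x_deriv Y_deriv by (auto intro: DERIV_isCont)

lemma Y_minus: "u \<notin> L \<Longrightarrow> deriv x (- u) = - deriv x u"
proof -
  assume u: "u \<notin> L"
  have "((\<lambda>w. x (- w)) has_field_derivative deriv x (- u) * (-1)) (at u)"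
    by (rule DERIV_chain2[OF x_deriv]) (use u minus_in_iff in \<open>auto intro!: derivative_eq_intros\<close>)
  then have "(x has_field_derivative deriv x (- u) * (-1)) (at u)" by (simp add: even)
  from DERIV_unique[OF this x_deriv[OF u]] have "deriv x u = - deriv x (- u)" by simp
  then show ?thesis by (rule equation_minus_iff[THEN iffD2])
qed

lemma ev_x_neq: "\<forall>\<^sub>F w in at z. x w \<noteq> a"
proof (cases "z \<in> L")
  case True
  show ?thesis using filterlim_at_infinity_imp_eventually_ne[OF pole[OF True]] by blast
next
  case False
  have "\<forall>\<^sub>F w in at 0. x w \<noteq> a \<and> w \<notin> L"
    using eventually_conj[OF filterlim_at_infinity_imp_eventually_ne[OF pole[OF zero_in]] ev_not_L(1)] by blast
  from eventually_happens[OF this] obtain w where w: "x w \<noteq> a" "w \<notin> L" by auto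
  have "\<forall>\<^sub>F w in at z. x w - a \<noteq> 0 \<and> w \<in> - L"
    by (rule non_zero_neighbour_alt[OF _ L_open L_connected _ , where \<beta> = w]) (use w False hol in \<open>auto intro!: holomorphic_intros\<close>)
  then show ?thesis by eventually_elim auto
qed

text \<open>The sum c of the two parameters is fixed while w moves; removing the sparse exceptional
  sets keeps the domain connected, so vanishing derivative means constancy.\<close>

lemma addition_aux:
  assumes c: "c \<notin> L" and w: "w \<notin> L" "c - w \<notin> L" "x w \<noteq> x (c - w)"
  shows "- x w - x (c - w) - b2 / 4 + ((deriv x w - deriv x (c - w)) / (x w - x (c - w)))^2 / 4 = x c"
proof -
  define W where "W = (\<lambda>w. - x w - x (c - w) - b2 / 4 + ((deriv x w - deriv x (c - w)) / (x w - x (c - w)))^2 / 4)"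
  define D where "D = - (L \<union> {w. c - w \<in> L})"
  have sp: "L \<union> {w. c - w \<in> L} sparse_in UNIV" by (rule sparse_in_union'[OF sparse sparse_reflect(1)[OF sparse]])
  have D: "open D" "connected D" unfolding D_def
    by (rule open_Compl[OF sparse_in_UNIV_imp_closed[OF sp]])
       (use sparse_imp_connected[OF _ connected_UNIV open_UNIV sp] in \<open>simp add: Compl_eq_Diff_UNIV\<close>)
  have xr: "(\<lambda>w. x (c - w)) holomorphic_on D"
    by (rule holomorphic_on_compose_gen[of "\<lambda>w. c - w" _ x "- L", unfolded o_def]) (use hol in \<open>auto intro!: holomorphic_intros simp: D_def\<close>)
  have xD: "x holomorphic_on D" by (rule holomorphic_on_subset[OF hol]) (auto simp: D_def)
  define g where "g = (\<lambda>w. x w - x (c - w))"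
  have g: "g holomorphic_on D" unfolding g_def by (intro holomorphic_intros xr xD)
  have lim_c: "((\<lambda>w. x (c - w)) \<longlongrightarrow> x c) (at 0)" "((\<lambda>w. deriv x (c - w)) \<longlongrightarrow> deriv x c) (at 0)"
  proof -
    have t: "((\<lambda>w. c - w) \<longlongrightarrow> c) (at 0)" by (auto intro!: tendsto_eq_intros)
    show "((\<lambda>w. x (c - w)) \<longlongrightarrow> x c) (at 0)" by (rule isCont_tendsto_compose[OF x_cont[OF c] t])
    show "((\<lambda>w. deriv x (c - w)) \<longlongrightarrow> deriv x c) (at 0)" by (rule isCont_tendsto_compose[OF Y_cont[OF c] t])
  qed
  have ginf: "filterlim g at_infinity (at 0)"
    unfolding g_def using tendsto_add_filterlim_at_infinity'[OF pole[OF zero_in] tendsto_minus[OF lim_c(1)]] by simp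
  have ev0: "\<forall>\<^sub>F w in at 0. g w \<noteq> 0 \<and> w \<in> D"
    using eventually_conj[OF filterlim_at_infinity_imp_eventually_ne[OF ginf] eventually_conj[OF ev_not_L(1) ev_not_L(2)[of c]]]
    by eventually_elim (auto simp: D_def)
  then obtain w0 where w0: "g w0 \<noteq> 0" "w0 \<in> D" using eventually_happens[OF ev0] by auto
  define Z where "Z = {w. g w = 0}"
  have "\<forall>\<^sub>F w in at z. w \<notin> Z" if "z \<in> D" for z
    using non_zero_neighbour_alt[OF g D that w0(2,1)] by eventually_elim (auto simp: Z_def)
  then have Z: "Z sparse_in D" using D by (simp add: sparse_in_eventually_iff)
  have oE: "open (D - Z)" using D(1) Z by (rule open_diff_sparse_pts)
  have cE: "connected (D - Z)" by (rule sparse_imp_connected[OF _ D(2,1) Z]) simp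
  have der: "(W has_field_derivative 0) (at w)" if "w \<in> D - Z" for w
  proof -
    have w: "w \<notin> L" "c - w \<notin> L" "x w - x (c - w) \<noteq> 0" using that by (auto simp: D_def Z_def g_def)
    define X1 X2 Y1 Y2 where "X1 = x w" "X2 = x (c - w)" "Y1 = deriv x w" "Y2 = deriv x (c - w)"
    note defs = this
    have r: "((\<lambda>w. c - w) has_field_derivative (-1)) (at w)" by (auto intro!: derivative_eq_intros)
    have d: "(x has_field_derivative Y1) (at w)" "(deriv x has_field_derivative quad X1) (at w)"
      "((\<lambda>w. x (c - w)) has_field_derivative Y2 * (-1)) (at w)" "((\<lambda>w. deriv x (c - w)) has_field_derivative quad X2 * (-1)) (at w)"
      unfolding defs using x_deriv[OF w(1)] Y_deriv[OF w(1)] DERIV_chain2[OF x_deriv[OF w(2)] r] DERIV_chain2[OF Y_deriv[OF w(2)] r]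
      by simp_all
    define m where "m = (Y1 - Y2) / (X1 - X2)"
    have ne: "X1 - X2 \<noteq> 0" using w(3) by (simp add: defs)
    have "((\<lambda>w. (deriv x w - deriv x (c - w)) / (x w - x (c - w))) has_field_derivative
        ((quad X1 - quad X2 * (-1)) * (X1 - X2) - (Y1 - Y2) * (Y1 - Y2 * (-1))) / ((X1 - X2) * (X1 - X2))) (at w)"
      unfolding defs by (rule DERIV_divide[OF DERIV_diff[OF d(2,4)[unfolded defs]] DERIV_diff[OF d(1,3)[unfolded defs]] w(3)])
    \<comment> \<open>With m the slope, its derivative is 2 (X1 - X2). Hence m^2 / 4 has derivative
      m (X1 - X2) = Y1 - Y2, which cancels the derivative of - X1 - X2.\<close>
    moreover have "((quad X1 - quad X2 * (-1)) * (X1 - X2) - (Y1 - Y2) * (Y1 - Y2 * (-1))) / ((X1 - X2) * (X1 - X2)) = 2 * (X1 - X2)"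
    proof -
      have "Y1^2 = cubic X1" "Y2^2 = cubic X2" using ode1[OF w(1)] ode1[OF w(2)] by (simp_all add: defs)
      then have "(quad X1 - quad X2 * (-1)) * (X1 - X2) - (Y1 - Y2) * (Y1 - Y2 * (-1)) = 2 * (X1 - X2) * ((X1 - X2) * (X1 - X2))"
        unfolding quad_def cubic_def by algebra
      then show ?thesis using ne by simp
    qed
    ultimately have dm: "((\<lambda>w. (deriv x w - deriv x (c - w)) / (x w - x (c - w))) has_field_derivative 2 * (X1 - X2)) (at w)" by simp
    have "(W has_field_derivative (- Y1 - Y2 * (-1) - 0 + (of_nat 2 * (2 * (X1 - X2) * m ^ (2 - Suc 0))) / 4)) (at w)"
      unfolding W_def m_def
      by (intro DERIV_add DERIV_diff DERIV_minus d DERIV_const DERIV_cdivide DERIV_power[OF dm, unfolded defs[symmetric]])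
    moreover have "- Y1 - Y2 * (-1) - 0 + (of_nat 2 * (2 * (X1 - X2) * m ^ (2 - Suc 0))) / 4 = 0"
    proof -
      have "(X1 - X2) * m = Y1 - Y2" using ne by (simp add: m_def)
      moreover have "(of_nat 2 * (2 * (X1 - X2) * m ^ (2 - Suc 0))) / 4 = (X1 - X2) * m" by simp
      ultimately show ?thesis by (simp only:) simp
    qed
    ultimately show ?thesis by simp
  qed
  obtain K where K: "\<And>w. w \<in> D - Z \<Longrightarrow> W w = K"
  proof (rule DERIV_zero_connected_constant[OF cE oE finite.emptyI, of W])
    show "continuous_on (D - Z) W" using der by (intro continuous_at_imp_continuous_on ballI) (auto intro: DERIV_isCont)
    show "\<forall>w\<in>D - Z - {}. (W has_field_derivative 0) (at w)" using der by auto
  qed auto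
  \<comment> \<open>The constant is found at w = 0, where one point goes to infinity and the other
    to the point with parameter c.\<close>
  have "(W \<longlongrightarrow> x c) (at 0)"
    unfolding W_def
    by (rule addition_limit[OF pole[OF zero_in] lim_c]) (use ev_not_L(1)[of 0] in \<open>eventually_elim, simp add: ode1 cubic_def\<close>)
  moreover have "\<forall>\<^sub>F w in at 0. W w = K" using ev0 by eventually_elim (auto intro: K simp: Z_def)
  then have "(W \<longlongrightarrow> K) (at 0)" by (rule tendsto_eventually)
  ultimately have "K = x c" by (metis tendsto_unique at_neq_bot)
  moreover have "w \<in> D - Z" using w by (auto simp: D_def Z_def g_def)
  ultimately show ?thesis using K by (simp add: W_def)
qed

theorem addition:
  assumes "u \<notin> L" "v \<notin> L" "u + v \<notin> L" "x u \<noteq> x v"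
  shows "x (u + v) = - x u - x v - b2 / 4 + ((deriv x u - deriv x v) / (x u - x v))^2 / 4"
  using addition_aux[of "u + v" u] assms by simp

text \<open>As v tends to the pole l, the addition formula for u + v tends to the finite value
  \<open>x u\<close> by \<open>addition_limit\<close>; so u + l cannot be a pole, and continuity
  gives the value there.\<close>

lemma translate:
  assumes l: "l \<in> L" and u: "u \<notin> L"
  shows "u + l \<notin> L" "x (u + l) = x u"
proof -
  have ev: "\<forall>\<^sub>F v in at l. v \<notin> L \<and> u + v \<notin> L \<and> x v \<noteq> x u"
    using ev_not_L(1)[of l] ev_not_L(3)[of u l] ev_x_neq[of "x u" l] by eventually_elim auto
  have "((\<lambda>v. - x v - x u - b2 / 4 + ((deriv x v - deriv x u) / (x v - x u))^2 / 4) \<longlongrightarrow> x u) (at l)"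
  proof (rule addition_limit[OF pole[OF l] tendsto_const tendsto_const])
    show "\<forall>\<^sub>F w in at l. (deriv x w)^2 = 4 * (x w)^3 + b2 * (x w)^2 + 2 * b4 * x w + b6"
      using ev_not_L(1)[of l] by eventually_elim (simp add: ode1 cubic_def)
  qed
  moreover have "\<forall>\<^sub>F v in at l. - x v - x u - b2 / 4 + ((deriv x v - deriv x u) / (x v - x u))^2 / 4 = x (u + v)"
    using ev by eventually_elim (use addition[of _ u] u in \<open>auto simp: add.commute\<close>)
  ultimately have lim: "((\<lambda>v. x (u + v)) \<longlongrightarrow> x u) (at l)" by (rule Lim_transform_eventually)
  have shift: "filterlim (\<lambda>v. u + v) (at (u + l)) (at l)"
    by (rule filterlim_atI) (auto intro!: tendsto_intros simp: eventually_at_filter)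
  show 1: "u + l \<notin> L"
  proof
    assume "u + l \<in> L"
    then have "filterlim (\<lambda>v. x (u + v)) at_infinity (at l)" by (intro filterlim_compose[OF pole shift])
    then show False using lim not_tendsto_and_filterlim_at_infinity at_neq_bot by blast
  qed
  have "((\<lambda>v. x (u + v)) \<longlongrightarrow> x (u + l)) (at l)"
    by (rule isCont_tendsto_compose[OF x_cont[OF 1]]) (auto intro!: tendsto_intros)
  then show "x (u + l) = x u" using lim by (metis tendsto_unique at_neq_bot)
qed

lemma L_minus: "l \<in> L \<Longrightarrow> - l \<in> L" using minus_in_iff by simp

lemma L_add: "l \<in> L \<Longrightarrow> l' \<in> L \<Longrightarrow> l + l' \<in> L"
  using translate(1)[OF L_minus, of l' "l + l'"] by auto

lemma L_diff: "l \<in> L \<Longrightarrow> l' \<in> L \<Longrightarrow> l - l' \<in> L"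
  using L_add[OF _ L_minus] by fastforce

lemma L_add_iff: "l \<in> L \<Longrightarrow> u + l \<in> L \<longleftrightarrow> u \<in> L"
  using translate(1) L_add by blast

lemma L_of_int: "l \<in> L \<Longrightarrow> of_int k * l \<in> L"
proof (induction k rule: int_induct[where k = 0])
  case base
  then show ?case using zero_in by simp
next
  case (step1 i)
  then show ?case using L_add[of "of_int i * l" l] by (simp add: algebra_simps)
next
  case (step2 i)
  then show ?case using L_diff[of "of_int i * l" l] by (simp add: algebra_simps)
qed

lemma translate_Y:
  assumes l: "l \<in> L" and u: "u \<notin> L"
  shows "deriv x (u + l) = deriv x u"
proof -
  have "((\<lambda>w. x (w + l)) has_field_derivative deriv x (u + l)) (at u)"
    using DERIV_shift[of x "deriv x (u + l)" u l] x_deriv translate(1)[OF l u] by blast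
  then have "(x has_field_derivative deriv x (u + l)) (at u)"
    by (rule has_field_derivative_transform_within_open[OF _ L_open]) (use u translate(2)[OF l] in auto)
  from DERIV_unique[OF this x_deriv[OF u]] show ?thesis .
qed

text \<open>Otherwise v - u is a regular point. The addition formula depends only on the values of
  \<open>x\<close> and its derivative, so \<open>x (w + u) = x (w + v)\<close> for w near - u; but
  the left side has a pole at w = - u and the right side does not.\<close>

theorem injective:
  assumes u: "u \<notin> L" and v: "v \<notin> L" and eq: "x u = x v" "deriv x u = deriv x v"
  shows "u - v \<in> L"
proof (rule ccontr)
  assume "u - v \<notin> L"
  then have vu: "v - u \<notin> L" using minus_in_iff[of "u - v"] by simp
  have ev: "\<forall>\<^sub>F w in at (- u). x (w + v) = x (w + u)"
    using ev_not_L(1)[of "- u"] ev_not_L(4)[of u "- u"] ev_not_L(4)[of v "- u"] ev_x_neq[of "x u" "- u"]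
    by eventually_elim (use addition[of _ u] addition[of _ v] u v eq in auto)
  have "filterlim (\<lambda>w. w + u) (at 0) (at (- u))"
    by (rule filterlim_atI) (auto intro!: tendsto_eq_intros simp: eventually_at_filter eq_neg_iff_add_eq_0)
  then have "filterlim (\<lambda>w. x (w + u)) at_infinity (at (- u))" by (intro filterlim_compose[OF pole[OF zero_in]])
  then have "filterlim (\<lambda>w. x (w + v)) at_infinity (at (- u))" using filterlim_cong[OF refl refl ev] by blast
  moreover have "((\<lambda>w. x (w + v)) \<longlongrightarrow> x (v - u)) (at (- u))"
    by (rule isCont_tendsto_compose[OF x_cont[OF vu]]) (auto intro!: tendsto_eq_intros)
  ultimately show False using not_tendsto_and_filterlim_at_infinity at_neq_bot by blast
qed

lemma x_eq_cases:
  assumes u: "u \<notin> L" and v: "v \<notin> L" and eq: "x u = x v"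
  shows "u - v \<in> L \<or> u + v \<in> L"
proof -
  have "(deriv x u)^2 = (deriv x v)^2" using eq ode1 u v by simp
  then consider "deriv x u = deriv x v" | "deriv x u = deriv x (- v)" unfolding power2_eq_iff using Y_minus[OF v] by auto
  then show ?thesis
  proof cases
    case 1
    then show ?thesis using injective[OF u v eq] by blast
  next
    case 2
    then show ?thesis using injective[of u "- v"] u v eq even minus_in_iff by auto
  qed
qed

lemma Y_zero_iff:
  assumes "u \<notin> L"
  shows "deriv x u = 0 \<longleftrightarrow> 2 * u \<in> L"
  unfolding double_in[OF assms] ode1[OF assms, symmetric] by simp

text \<open>Differentiation of the addition formula in u for fixed v. The curve equations reduce the
  derivative of the slope to \<open>2 * (x u - x (u + v))\<close>.\<close>

theorem addition_Y:
  assumes u: "u \<notin> L" and v: "v \<notin> L" and uv: "u + v \<notin> L" and ne: "x u \<noteq> x v"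
  defines "m \<equiv> (deriv x u - deriv x v) / (x u - x v)"
  shows "deriv x (u + v) = - deriv x u - m * (x (u + v) - x u)"
proof -
  define X1 X2 Y1 Y2 where "X1 = x u" "X2 = x v" "Y1 = deriv x u" "Y2 = deriv x v"
  note defs = this
  have ne': "X1 - X2 \<noteq> 0" using ne by (simp add: defs)
  have d: "(x has_field_derivative Y1) (at u)" "(deriv x has_field_derivative quad X1) (at u)"
    unfolding defs using x_deriv[OF u] Y_deriv[OF u] by auto
  have m: "m = (Y1 - Y2) / (X1 - X2)" by (simp add: m_def defs)
  then have mm: "m * (X1 - X2) = Y1 - Y2" using ne' by simp
  define m' where "m' = (quad X1 * (X1 - X2) - (Y1 - Y2) * Y1) / ((X1 - X2) * (X1 - X2))"
  have dm: "((\<lambda>w. (deriv x w - Y2) / (x w - X2)) has_field_derivative m') (at u)"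
    unfolding m'_def using DERIV_divide[OF DERIV_diff[OF d(2) DERIV_const] DERIV_diff[OF d(1) DERIV_const], of X2 Y2] ne'
    by (simp add: defs)
  have "((\<lambda>w. - x w - X2 - b2 / 4 + ((deriv x w - Y2) / (x w - X2))^2 / 4) has_field_derivative
     (- Y1 - 0 - 0 + (of_nat 2 * (m' * m ^ (2 - Suc 0))) / 4)) (at u)"
    unfolding m by (intro DERIV_add DERIV_diff DERIV_minus d DERIV_const DERIV_cdivide DERIV_power[OF dm, unfolded defs[symmetric], folded defs])
  note d3 = this
  have ev3: "\<forall>\<^sub>F w in nhds u. - x w - X2 - b2 / 4 + ((deriv x w - Y2) / (x w - X2))^2 / 4 = x (w + v)"
  proof -
    have "\<forall>\<^sub>F w in nhds u. w \<in> - L" using L_open u by (intro eventually_nhds_in_open) auto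
    moreover have "\<forall>\<^sub>F w in nhds u. x w \<noteq> X2"
      using x_cont[OF u] ne by (intro tendsto_imp_eventually_ne) (auto simp: isCont_def tendsto_nhds_iff defs)
    moreover have "\<forall>\<^sub>F w in nhds u. w + v \<in> - L"
    proof -
      have "open ((\<lambda>w. w + v) -` (- L))" by (intro open_vimage L_open continuous_intros)
      then show ?thesis using eventually_nhds_in_open[of "(\<lambda>w. w + v) -` (- L)" u] uv by simp
    qed
    ultimately show ?thesis by eventually_elim (use addition[of _ v] v in \<open>auto simp: defs\<close>)
  qed
  have "((\<lambda>w. x (w + v)) has_field_derivative (- Y1 - 0 - 0 + (of_nat 2 * (m' * m ^ (2 - Suc 0))) / 4)) (at u)"
    by (rule DERIV_cong_ev[THEN iffD1, OF refl ev3 refl d3])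
  moreover have "((\<lambda>w. x (w + v)) has_field_derivative deriv x (u + v)) (at u)"
    using DERIV_shift[of x "deriv x (u + v)" u v] x_deriv[OF uv] by blast
  ultimately have "deriv x (u + v) = - Y1 - 0 - 0 + (of_nat 2 * (m' * m ^ (2 - Suc 0))) / 4" using DERIV_unique by blast
  then have Y3: "deriv x (u + v) = - Y1 + m * m' / 2" by simp
  have X3: "4 * x (u + v) = - 4 * X1 - 4 * X2 - b2 + m^2" using addition[OF u v uv ne] by (simp add: m_def defs)
  have Yc: "Y1^2 = cubic X1" "Y2^2 = cubic X2" using ode1[OF u] ode1[OF v] by (simp_all add: defs)
  have "m' * ((X1 - X2) * (X1 - X2)) = quad X1 * (X1 - X2) - (Y1 - Y2) * Y1" using ne' by (simp add: m'_def)
  then have "(X1 - X2) * (m' * (X1 - X2)) = (X1 - X2) * (quad X1 - m * Y1)" unfolding mm[symmetric] by algebra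
  then have m': "m' * (X1 - X2) = quad X1 - m * Y1" using ne' by (simp only: mult_cancel_left) simp
  have "2 * (m' * (X1 - X2)) * (X1 - X2) = (4 * X1 - 4 * x (u + v)) * (X1 - X2) * (X1 - X2)"
    unfolding m' using X3 mm Yc unfolding quad_def cubic_def by algebra
  then have "2 * m' * ((X1 - X2) * (X1 - X2)) = (4 * X1 - 4 * x (u + v)) * ((X1 - X2) * (X1 - X2))" by algebra
  then have "2 * m' = 4 * X1 - 4 * x (u + v)" using ne' by (simp only: mult_cancel_right) simp
  then have e: "m' = 2 * (X1 - x (u + v))" by algebra
  have e': "m * m' / 2 = m * (X1 - x (u + v))" by (simp add: e)
  show ?thesis unfolding Y3 e' by (simp add: defs algebra_simps)
qed

text \<open>The tangent case: the first formula is \<open>double\<close> rewritten by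
  \<open>quart_eq\<close>, the second its derivative in u, the slope having derivative
  \<open>12 x + b2 - m^2\<close>.\<close>

lemma duplication:
  assumes u: "u \<notin> L" and Y: "deriv x u \<noteq> 0"
  defines "m \<equiv> quad (x u) / deriv x u"
  shows "x (2 * u) = m^2 / 4 - b2 / 4 - 2 * x u" "deriv x (2 * u) = - deriv x u - m * (x (2 * u) - x u)"
proof -
  have X: "x (2 * w) = (quad (x w) / deriv x w)^2 / 4 - b2 / 4 - 2 * x w" if w: "w \<notin> L" "deriv x w \<noteq> 0" for w
  proof -
    have 2: "2 * w \<notin> L" using Y_zero_iff[OF w(1)] w(2) by simp
    have c: "cubic (x w) \<noteq> 0" "cubic (x w) = (deriv x w)^2" using ode1[OF w(1)] w(2) by auto
    have "4 * (x (2 * w) * cubic (x w)) = (quad (x w))^2 - (b2 + 8 * x w) * cubic (x w)"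
      unfolding double[OF w(1) 2] by (rule quart_eq)
    then have "x (2 * w) * (4 * cubic (x w)) = (quad (x w))^2 - (b2 + 8 * x w) * cubic (x w)" by (simp add: mult_ac)
    then have "x (2 * w) = ((quad (x w))^2 - (b2 + 8 * x w) * cubic (x w)) / (4 * cubic (x w))"
      using c(1) by (metis mult_eq_0_iff nonzero_eq_divide_eq zero_neq_numeral)
    also have "\<dots> = (quad (x w) / deriv x w)^2 / 4 - b2 / 4 - 2 * x w"
      using c w by (simp add: diff_divide_distrib power_divide add_divide_distrib)
    finally show ?thesis .
  qed
  show x2: "x (2 * u) = m^2 / 4 - b2 / 4 - 2 * x u" using X[OF u Y] by (simp add: m_def)
  have 2: "2 * u \<notin> L" using Y_zero_iff[OF u] Y by simp
  have dq: "((\<lambda>w. quad (x w)) has_field_derivative (12 * x u + b2) * deriv x u) (at u)"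
    unfolding quad_def by (rule derivative_eq_intros x_deriv[OF u] refl)+ (simp add: algebra_simps)
  have dm: "((\<lambda>w. quad (x w) / deriv x w) has_field_derivative
    (((12 * x u + b2) * deriv x u) * deriv x u - quad (x u) * quad (x u)) / (deriv x u * deriv x u)) (at u)"
    by (rule DERIV_divide[OF dq Y_deriv[OF u] Y])
  have "(((12 * x u + b2) * deriv x u) * deriv x u - quad (x u) * quad (x u)) / (deriv x u * deriv x u) = 12 * x u + b2 - m^2"
    using Y by (simp add: m_def diff_divide_distrib power2_eq_square)
  with dm have dm: "((\<lambda>w. quad (x w) / deriv x w) has_field_derivative 12 * x u + b2 - m^2) (at u)" by simp
  have d3: "((\<lambda>w. (quad (x w) / deriv x w)^2 / 4 - b2 / 4 - 2 * x w) has_field_derivative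
     (of_nat 2 * ((12 * x u + b2 - m^2) * (quad (x u) / deriv x u) ^ (2 - Suc 0))) / 4 - 0 - 2 * deriv x u) (at u)"
    by (intro DERIV_diff DERIV_cdivide DERIV_power[OF dm] DERIV_const DERIV_cmult x_deriv u)
  have ev3: "\<forall>\<^sub>F w in nhds u. (quad (x w) / deriv x w)^2 / 4 - b2 / 4 - 2 * x w = x (2 * w)"
  proof -
    have "\<forall>\<^sub>F w in nhds u. w \<in> - L" using L_open u by (intro eventually_nhds_in_open) auto
    moreover have "\<forall>\<^sub>F w in nhds u. deriv x w \<noteq> 0"
      using Y_cont[OF u] Y by (intro tendsto_imp_eventually_ne) (auto simp: isCont_def tendsto_nhds_iff)
    ultimately show ?thesis by eventually_elim (use X in auto)
  qed
  have "((\<lambda>w. x (2 * w)) has_field_derivative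
     (of_nat 2 * ((12 * x u + b2 - m^2) * (quad (x u) / deriv x u) ^ (2 - Suc 0))) / 4 - 0 - 2 * deriv x u) (at u)"
    by (rule DERIV_cong_ev[THEN iffD1, OF refl ev3 refl d3])
  moreover have "((\<lambda>w. x (2 * w)) has_field_derivative deriv x (2 * u) * 2) (at u)"
    by (rule DERIV_chain2[of x "deriv x (2 * u)" "\<lambda>w. 2 * w" u 2 UNIV, OF x_deriv[OF 2]]) (auto intro!: derivative_eq_intros)
  ultimately have "deriv x (2 * u) * 2 = (of_nat 2 * ((12 * x u + b2 - m^2) * (quad (x u) / deriv x u) ^ (2 - Suc 0))) / 4 - 0 - 2 * deriv x u"
    using DERIV_unique by blast
  then have "deriv x (2 * u) * 2 = (12 * x u + b2 - m^2) * m / 2 - 2 * deriv x u"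
    unfolding m_def[symmetric] by (simp add: mult_ac)
  then show "deriv x (2 * u) = - deriv x u - m * (x (2 * u) - x u)"
    unfolding x2 by (simp add: field_simps power2_eq_square)
qed

section \<open>Surjectivity of the parametrization\<close>

text \<open>Sending the omitted value a to infinity makes 1 / (x - a) entire after removal of the
  singularities at the poles. It would omit two further values, so by Picard's little theorem it is
  constant; but it vanishes at 0 and not off \<open>L\<close>.\<close>

lemma omits_at_most_two:
  assumes om: "\<And>u. u \<notin> L \<Longrightarrow> x u \<noteq> a" "\<And>u. u \<notin> L \<Longrightarrow> x u \<noteq> b" "\<And>u. u \<notin> L \<Longrightarrow> x u \<noteq> c"
    and ne: "b \<noteq> a" "c \<noteq> a" "b \<noteq> c"
  shows False
proof -
  define g where "g = (\<lambda>u. if u \<in> L then 0 else 1 / (x u - a))"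
  have g: "g holomorphic_on UNIV"
  proof (rule no_sparse_singularity[OF _ open_UNIV sparse])
    have "(\<lambda>u. 1 / (x u - a)) holomorphic_on UNIV - L"
      by (intro holomorphic_intros) (use hol om(1) in \<open>auto simp: Compl_eq_Diff_UNIV\<close>)
    then show "g holomorphic_on UNIV - L" by (rule holomorphic_transform) (auto simp: g_def)
    fix l assume l: "l \<in> L"
    have "filterlim (\<lambda>u. x u - a) at_infinity (at l)"
      using tendsto_add_filterlim_at_infinity'[OF pole[OF l] tendsto_const[of "- a"]] by simp
    then have "((\<lambda>u. inverse (x u - a)) \<longlongrightarrow> 0) (at l)"
      by (rule tendsto_inverse_0[THEN filterlim_compose])
    moreover have "\<forall>\<^sub>F u in at l. inverse (x u - a) = g u"
      using ev_not_L(1)[of l] by eventually_elim (simp add: g_def inverse_eq_divide)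
    ultimately show "(g \<longlongrightarrow> g l) (at l)" using Lim_transform_eventually l by (force simp: g_def)
  qed
  have "1 / (b - a) \<noteq> 1 / (c - a)" using ne by (simp add: frac_eq_eq)
  moreover have "range g \<inter> {1 / (b - a), 1 / (c - a)} = {}"
  proof -
    have "g u \<noteq> 1 / (b - a)" "g u \<noteq> 1 / (c - a)" for u
      using ne om(2)[of u] om(3)[of u] by (auto simp: g_def)
    then show ?thesis by fastforce
  qed
  ultimately obtain k where k: "g = (\<lambda>u. k)" using little_Picard[OF g] by blast
  have "g 0 = 0" using zero_in by (simp add: g_def)
  then have "k = 0" using fun_cong[OF k, of 0] by simp
  obtain u where "u \<notin> L" using eventually_happens[OF ev_not_L(1)[of 0]] by auto
  then have "g u \<noteq> 0" using om(1)[of u] by (simp add: g_def)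
  then show False using fun_cong[OF k, of u] \<open>k = 0\<close> by simp
qed

lemma monic_quartic_roots:
  fixes p q r s :: complex
  obtains r1 r2 r3 r4 where "\<And>z. z^4 + p * z^3 + q * z^2 + r * z + s = (z - r1) * (z - r2) * (z - r3) * (z - r4)"
    "r1 + r2 + r3 + r4 = - p"
proof -
  define P where "P = [:s, r, q, p, 1:]"
  have P: "degree P = 4" "lead_coeff P = 1" "P \<noteq> 0" by (auto simp: P_def)
  obtain A where A: "size A = 4" "P = (\<Prod>x\<in>#A. [:-x, 1:])"
    using alg_closed_imp_factorization[OF P(3)] P by auto
  from A(1) obtain r1 A1 where A1: "A = add_mset r1 A1" "size A1 = 3" using size_eq_Suc_imp_eq_union[of A 3] by auto
  then obtain r2 A2 where A2: "A1 = add_mset r2 A2" "size A2 = 2" using size_eq_Suc_imp_eq_union[of A1 2] by auto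
  then obtain r3 A3 where A3: "A2 = add_mset r3 A3" "size A3 = 1" using size_eq_Suc_imp_eq_union[of A2 1] by auto
  then obtain r4 where A4: "A3 = {#r4#}" using size_1_singleton_mset by metis
  have Pf: "P = [:-r1, 1:] * ([:-r2, 1:] * ([:-r3, 1:] * [:-r4, 1:]))" using A(2) by (simp add: A1 A2 A3 A4)
  show ?thesis
  proof
    show "z^4 + p * z^3 + q * z^2 + r * z + s = (z - r1) * (z - r2) * (z - r3) * (z - r4)" for z
    proof -
      have "poly P z = z^4 + p * z^3 + q * z^2 + r * z + s" by (simp add: P_def algebra_simps eval_nat_numeral)
      moreover have "poly P z = (z - r1) * (z - r2) * (z - r3) * (z - r4)" unfolding Pf poly_mult by (simp add: mult.assoc)
      ultimately show ?thesis by simp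
    qed
    have "coeff P 3 = - (r1 + r2 + r3 + r4)" unfolding Pf by (simp add: eval_nat_numeral)
    then show "r1 + r2 + r3 + r4 = - p" by (simp add: P_def eval_nat_numeral)
  qed
qed

text \<open>If \<open>a\<close> is omitted, so are all the roots of \<open>quart - a cubic\<close>, the \<open>x\<close>-coordinates of the halves; their sum is \<open>4 a\<close>,
  whereas \<open>x\<close> omits at most two values by Picard's theorem.\<close>
theorem x_surjective: "\<exists>u. u \<notin> L \<and> x u = a"
proof (rule ccontr)
  define om where "om = (\<lambda>a. \<forall>u. u \<notin> L \<longrightarrow> x u \<noteq> a)"
  assume "\<not> ?thesis"
  then have a: "om a" by (auto simp: om_def)
  have root: "om c" if "quart c - a * cubic c = 0" for c
    unfolding om_def
  proof (intro allI impI notI)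
    fix u assume u: "u \<notin> L" "x u = c"
    show False
    proof (cases "2 * u \<in> L")
      case True
      \<comment> \<open>If the double of u is a pole, c would be a common zero of
        \<open>cubic\<close> and \<open>quart\<close>, hence a double root.\<close>
      then have "cubic c = 0" using double_in[OF u(1)] u by simp
      then have "quad c = 0" using that quart_eq[of c] by simp
      then show False using no_double_root[of c] \<open>cubic c = 0\<close> by (simp add: cubic_def quad_def)
    next
      case False
      then have "cubic c \<noteq> 0" using double_in[OF u(1)] u by simp
      moreover have "x (2 * u) * cubic c = a * cubic c" using double[OF u(1) False] that u by simp
      ultimately show False using a False by (auto simp: om_def)
    qed
  qed
  obtain r1 r2 r3 r4 where r: "\<And>z. z^4 + (- 4 * a) * z^3 + (- b4 - a * b2) * z^2 + (- 2 * b6 - 2 * a * b4) * z + (- b8 - a * b6)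
      = (z - r1) * (z - r2) * (z - r3) * (z - r4)" "r1 + r2 + r3 + r4 = - (- 4 * a)"
    by (rule monic_quartic_roots[of "- 4 * a" "- b4 - a * b2" "- 2 * b6 - 2 * a * b4" "- b8 - a * b6"]) (rule that)
  have q: "quart z - a * cubic z = (z - r1) * (z - r2) * (z - r3) * (z - r4)" for z
    unfolding r(1)[symmetric] quart_def cubic_def by (simp add: algebra_simps)
  have omr: "om r1" "om r2" "om r3" "om r4" by (rule root; simp add: q)+
  have two: "b = a \<or> c = a \<or> b = c" if "om b" "om c" for b c
    using omits_at_most_two[of a b c] that a unfolding om_def by blast
  \<comment> \<open>At most one omitted value b differs from a. If b occurred among the roots, their
    sum would not be 4 a.\<close>
  have eqs: "r1 = a \<and> r2 = a \<and> r3 = a \<and> r4 = a"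
  proof -
    define b where "b = (if r1 \<noteq> a then r1 else if r2 \<noteq> a then r2 else if r3 \<noteq> a then r3 else r4)"
    have "om b" using omr by (simp add: b_def)
    then have "r1 = a \<or> r1 = b" "r2 = a \<or> r2 = b" "r3 = a \<or> r3 = b" "r4 = a \<or> r4 = b"
      using two omr two[of b] by (metis b_def)+
    moreover have "a = b" if "n * a + m * b = (n + m) * a" "m \<noteq> 0" for n m :: complex
      using that by (simp add: algebra_simps)
    ultimately show ?thesis using r(2)
      by (elim disjE) (auto simp: algebra_simps)
  qed
  \<comment> \<open>With all four roots equal to a, comparison of coefficients makes a a zero of
    both \<open>cubic\<close> and \<open>quad\<close>, that is, a double root.\<close>
  have q': "quart z - a * cubic z = (z - a)^4" for z using q[of z] eqs by (simp add: eval_nat_numeral)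
  have "6 * a^2 + b2 * a + b4 = 0 \<and> cubic a = 0"
  proof -
    have P: "[:- b8 - a * b6, - 2 * b6 - 2 * a * b4, - b4 - a * b2, - 4 * a, 1:] = [:a^4, - 4 * a^3, 6 * a^2, - 4 * a, 1:]"
    proof (rule poly_ext)
      fix z
      show "poly [:- b8 - a * b6, - 2 * b6 - 2 * a * b4, - b4 - a * b2, - 4 * a, 1:] z = poly [:a^4, - 4 * a^3, 6 * a^2, - 4 * a, 1:] z"
        using q'[of z] unfolding quart_def cubic_def by (simp add: algebra_simps eval_nat_numeral)
    qed
    then have e: "- b4 - a * b2 = 6 * a^2" "- 2 * b6 - 2 * a * b4 = - 4 * a^3" by simp_all
    have 1: "6 * a^2 + b2 * a + b4 = 0" unfolding e(1)[symmetric] by (simp add: algebra_simps)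
    have "b6 = 2 * a^3 - a * b4" using e(2) by algebra
    then have "cubic a = a * (6 * a^2 + b2 * a + b4)" unfolding cubic_def by (simp add: algebra_simps power2_eq_square power3_eq_cube)
    then show ?thesis using 1 by simp
  qed
  then show False using no_double_root[of a] by (simp add: cubic_def)
qed

theorem surjective:
  assumes "b^2 = cubic a"
  obtains u where "u \<notin> L" "x u = a" "deriv x u = b"
proof -
  obtain u where u: "u \<notin> L" "x u = a" using x_surjective by blast
  then have "(deriv x u)^2 = b^2" using ode1 assms by simp
  then consider "deriv x u = b" | "deriv x (- u) = b" using Y_minus[OF u(1)] by (auto simp: power2_eq_iff)
  then show ?thesis using that[of u] that[of "- u"] u even minus_in_iff by cases auto
qed

end

section \<open>Division values of the sigma function\<close>

text \<open>The cross product of the two rows is a solution; if it vanishes, the rows are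
  proportional and a vector orthogonal to one nonzero row suffices.\<close>

lemma two_equations_three_unknowns:
  fixes p1 p2 q1 q2 r1 r2 :: complex
  obtains a b c where "a * p1 + b * q1 + c * r1 = 0" "a * p2 + b * q2 + c * r2 = 0" "a \<noteq> 0 \<or> b \<noteq> 0 \<or> c \<noteq> 0"
proof (cases "q1 * r2 - q2 * r1 = 0 \<and> r1 * p2 - r2 * p1 = 0 \<and> p1 * q2 - p2 * q1 = 0")
  case False
  show ?thesis
    by (rule that[of "q1 * r2 - q2 * r1" "r1 * p2 - r2 * p1" "p1 * q2 - p2 * q1"]) (use False in \<open>auto simp: algebra_simps\<close>)
next
  case True
  consider "p1 = 0" "p2 = 0" | "p1 \<noteq> 0" | "p2 \<noteq> 0" by blast
  then show ?thesis
  proof cases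
    case 1
    then show ?thesis using that[of 1 0 0] by simp
  next
    case 2
    then show ?thesis using that[of q1 "- p1" 0] True by (simp add: algebra_simps)
  next
    case 3
    then show ?thesis using that[of q2 "- p2" 0] True by (simp add: algebra_simps)
  qed
qed

text \<open>Bookkeeping for the recursion: powers of sigma with symbolic exponents are replaced by
  letters whose products all equal the same k.\<close>

lemma collect_odd_terms:
  fixes w a s' t w2 b w3 c w4 d w5 e k :: complex
  assumes "w * a * s' * t = w2 * b * (w3 * c)^3 - w4 * d * (w5 * e)^3" "a * s' * t = k" "b * c^3 = k" "d * e^3 = k"
  shows "w * k = (w2 * w3^3 - w4 * w5^3) * k"
  using assms by algebra

lemma collect_even_terms:
  fixes w a w2 b t v c v2 d v1 e v3 f v4 g k :: complex
  assumes "w * a * (w2 * b) * t = v * c * (v2 * d * (v1 * e)^2 - v3 * f * (v4 * g)^2)" "a * b * t = k" "c * d * e^2 = k" "c * f * g^2 = k"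
  shows "w * w2 * k = v * (v2 * v1^2 - v3 * v4^2) * k"
  using assms by algebra

locale weierstrass_sigma = weierstrass_function +
  fixes \<sigma> :: "complex \<Rightarrow> complex"
  assumes sigma_hol: "\<sigma> holomorphic_on UNIV"
    and sigma_zero: "\<sigma> u = 0 \<longleftrightarrow> u \<in> L"
    and sigma_deriv_0: "(\<sigma> has_field_derivative 1) (at 0)"
    and sigma_id: "u \<notin> L \<Longrightarrow> a \<notin> L \<Longrightarrow> \<sigma> (u + a) * \<sigma> (u - a) = - (\<sigma> a ^ 2) * \<sigma> u ^ 2 * (x u - x a)"
begin

lemma sigma_cont: "isCont \<sigma> u"
  using holomorphic_on_imp_continuous_on[OF sigma_hol] continuous_on_eq_continuous_at[OF open_UNIV] by blast

lemma zero_off_L_imp_zero: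
  fixes f :: "complex \<Rightarrow> complex"
  assumes "isCont f u" "\<And>w. w \<notin> L' \<Longrightarrow> f w = 0" "L' sparse_in UNIV"
  shows "f u = 0"
proof -
  have "\<forall>\<^sub>F w in at u. w \<notin> L'" using assms(3) by (simp add: sparse_in_eventually_iff)
  then have "\<forall>\<^sub>F w in at u. f w = 0" by eventually_elim (rule assms(2))
  then have "(f \<longlongrightarrow> 0) (at u)" by (rule tendsto_eventually)
  moreover have "(f \<longlongrightarrow> f u) (at u)" using assms(1) by (simp add: isCont_def)
  ultimately show ?thesis by (rule tendsto_unique[OF at_neq_bot, rotated])
qed

lemma sigma_shift_cont: "isCont (\<lambda>p. \<sigma> (p + q)) p" "isCont (\<lambda>p. \<sigma> (p - q)) p" "isCont (\<lambda>q. \<sigma> (p - q)) q" "isCont (\<lambda>q. \<sigma> (p + q)) q"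
  by (rule isCont_o2[OF _ sigma_cont], intro continuous_intros)+

text \<open>Off \<open>L\<close> each product is given by \<open>sigma_id\<close>, and the claim
  reduces to x p - x q = (x p - x r) - (x q - x r). Values of p and then q in \<open>L\<close> are
  reached by continuity.\<close>

lemma three_term:
  assumes r: "r \<notin> L"
  shows "\<sigma> (p + q) * \<sigma> (p - q) * \<sigma> r ^ 2 = \<sigma> (p + r) * \<sigma> (p - r) * \<sigma> q ^ 2 - \<sigma> (q + r) * \<sigma> (q - r) * \<sigma> p ^ 2"
proof -
  define T where "T = (\<lambda>p q. \<sigma> (p + q) * \<sigma> (p - q) * \<sigma> r ^ 2 - (\<sigma> (p + r) * \<sigma> (p - r) * \<sigma> q ^ 2 - \<sigma> (q + r) * \<sigma> (q - r) * \<sigma> p ^ 2))"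
  have 1: "T p q = 0" if "p \<notin> L" "q \<notin> L" for p q
    unfolding T_def sigma_id[OF that] sigma_id[OF that(1) r] sigma_id[OF that(2) r] by algebra
  have 2: "T p q = 0" if "q \<notin> L" for p q
  proof (rule zero_off_L_imp_zero[OF _ _ sparse, where f = "\<lambda>p. T p q"])
    show "isCont (\<lambda>p. T p q) p" unfolding T_def by (intro continuous_intros sigma_shift_cont sigma_cont)
  qed (use 1 that in auto)
  have "T p q = 0"
  proof (rule zero_off_L_imp_zero[OF _ _ sparse, where f = "\<lambda>q. T p q"])
    show "isCont (\<lambda>q. T p q) q" unfolding T_def by (intro continuous_intros sigma_shift_cont sigma_cont)
  qed (use 2 in auto)
  then show ?thesis by (simp add: T_def)
qed

text \<open>Divide \<open>sigma_id\<close> by u - a and let u tend to a; the normalization of sigma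
  at 0 enters here.\<close>

lemma sigma_double:
  assumes a: "a \<notin> L"
  shows "\<sigma> (2 * a) = - (\<sigma> a ^ 4) * deriv x a"
proof -
  have ev: "\<forall>\<^sub>F u in at a. \<sigma> (u + a) * (\<sigma> (u - a) / (u - a)) = - (\<sigma> a ^ 2) * \<sigma> u ^ 2 * ((x u - x a) / (u - a))"
    using ev_not_L(1)[of a] by eventually_elim (simp add: sigma_id[OF _ a])
  have "((\<lambda>h. \<sigma> h / h) \<longlongrightarrow> 1) (at 0)"
    using sigma_deriv_0 sigma_zero[of 0] zero_in by (simp add: has_field_derivative_iff)
  moreover have "filterlim (\<lambda>u. u - a) (at 0) (at a)"
    by (rule filterlim_atI) (auto intro!: tendsto_eq_intros simp: eventually_at_filter)
  ultimately have l1: "((\<lambda>u. \<sigma> (u - a) / (u - a)) \<longlongrightarrow> 1) (at a)" by (rule filterlim_compose)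
  have l2: "((\<lambda>u. \<sigma> (u + a)) \<longlongrightarrow> \<sigma> (a + a)) (at a)" using sigma_shift_cont(1)[of a a] by (simp add: isCont_def)
  have l3: "(\<sigma> \<longlongrightarrow> \<sigma> a) (at a)" using sigma_cont[of a] by (simp add: isCont_def)
  have l4: "((\<lambda>u. (x u - x a) / (u - a)) \<longlongrightarrow> deriv x a) (at a)" using x_deriv[OF a] by (simp add: has_field_derivative_iff)
  have "((\<lambda>u. - (\<sigma> a ^ 2) * \<sigma> u ^ 2 * ((x u - x a) / (u - a))) \<longlongrightarrow> - (\<sigma> a ^ 2) * \<sigma> a ^ 2 * deriv x a) (at a)"
    by (intro tendsto_intros l3 l4)
  moreover have "((\<lambda>u. - (\<sigma> a ^ 2) * \<sigma> u ^ 2 * ((x u - x a) / (u - a))) \<longlongrightarrow> \<sigma> (a + a) * 1) (at a)"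
    by (rule Lim_transform_eventually[OF tendsto_mult[OF l2 l1] ev])
  ultimately have "\<sigma> (a + a) * 1 = - (\<sigma> a ^ 2) * \<sigma> a ^ 2 * deriv x a" by (rule tendsto_unique[OF at_neq_bot, rotated])
  then show ?thesis unfolding mult_2 by (simp only: power2_eq_square power4_eq_xxxx mult_1_right mult_minus_left mult.assoc)
qed

section \<open>Division values and their recursion\<close>

definition W :: "nat \<Rightarrow> complex \<Rightarrow> complex" where "W n u = \<sigma> (of_nat n * u) / \<sigma> u ^ (n^2)"

lemma W_sigma: "u \<notin> L \<Longrightarrow> \<sigma> (of_nat n * u) = W n u * \<sigma> u ^ (n^2)"
  by (simp add: W_def sigma_zero)

text \<open>\<open>three_term\<close> at (m + 1) u, m u and u. Every product carries the power 4 m^2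
  + 4 m + 4 of sigma, which cancels.\<close>

lemma W_odd_rec:
  assumes u: "u \<notin> L" and m: "m \<ge> 1"
  shows "W (2*m+1) u = W (m+2) u * W m u ^ 3 - W (m-1) u * W (m+1) u ^ 3"
proof -
  obtain j where j: "m = j + 1" using m by (metis add.commute le_Suc_ex plus_1_eq_Suc)
  define s where "s = \<sigma> u"
  have s: "s \<noteq> 0" using u by (simp add: s_def sigma_zero)
  have "\<sigma> (of_nat (m+1) * u + of_nat m * u) * \<sigma> (of_nat (m+1) * u - of_nat m * u) * \<sigma> u ^ 2
     = \<sigma> (of_nat (m+1) * u + u) * \<sigma> (of_nat (m+1) * u - u) * \<sigma> (of_nat m * u) ^ 2
       - \<sigma> (of_nat m * u + u) * \<sigma> (of_nat m * u - u) * \<sigma> (of_nat (m+1) * u) ^ 2"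
    by (rule three_term[OF u])
  moreover have "of_nat (m+1) * u + of_nat m * u = of_nat (2*m+1) * u" "of_nat (m+1) * u - of_nat m * u = u"
    "of_nat (m+1) * u + u = of_nat (m+2) * u" "of_nat (m+1) * u - u = of_nat m * u" "of_nat m * u + u = of_nat (m+1) * u"
    "of_nat m * u - u = of_nat (m-1) * u"
    by (simp_all add: algebra_simps j)
  ultimately have "\<sigma> (of_nat (2*m+1) * u) * s * s^2 = \<sigma> (of_nat (m+2) * u) * \<sigma> (of_nat m * u)^3 - \<sigma> (of_nat (m-1) * u) * \<sigma> (of_nat (m+1) * u)^3"
    by (simp only: s_def power2_eq_square power3_eq_cube) (simp add: mult_ac)
  then have "W (2*m+1) u * s^((2*m+1)^2) * s * s^2 = W (m+2) u * s^((m+2)^2) * (W m u * s^(m^2))^3 - W (m-1) u * s^((m-1)^2) * (W (m+1) u * s^((m+1)^2))^3"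
    unfolding W_sigma[OF u] s_def .
  moreover have "s^((2*m+1)^2) * s * s^2 = s^(4*m^2+4*m+4)" "s^((m+2)^2) * (s^(m^2))^3 = s^(4*m^2+4*m+4)"
    "s^((m-1)^2) * (s^((m+1)^2))^3 = s^(4*m^2+4*m+4)"
    unfolding j by (simp_all add: power_add[symmetric] power_mult[symmetric] flip: power_Suc power_Suc2) (simp_all add: power2_eq_square algebra_simps eval_nat_numeral)
  ultimately have "W (2*m+1) u * s^(4*m^2+4*m+4) = (W (m+2) u * W m u ^ 3 - W (m-1) u * W (m+1) u ^ 3) * s^(4*m^2+4*m+4)"
    by (rule collect_odd_terms)
  then show ?thesis using s by simp
qed

text \<open>\<open>three_term\<close> at (m + 1) u, (m - 1) u and u; both products on the right
  contain the value at m u. The common power of sigma is 4 m^2 + 6.\<close>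

lemma W_even_rec:
  assumes u: "u \<notin> L" and m: "m \<ge> 2"
  shows "W (2*m) u * W 2 u = W m u * (W (m+2) u * W (m-1) u ^ 2 - W (m-2) u * W (m+1) u ^ 2)"
proof -
  obtain j where j: "m = j + 2" using m by (metis add.commute le_Suc_ex)
  define s where "s = \<sigma> u"
  have s: "s \<noteq> 0" using u by (simp add: s_def sigma_zero)
  have "\<sigma> (of_nat (m+1) * u + of_nat (m-1) * u) * \<sigma> (of_nat (m+1) * u - of_nat (m-1) * u) * \<sigma> u ^ 2
     = \<sigma> (of_nat (m+1) * u + u) * \<sigma> (of_nat (m+1) * u - u) * \<sigma> (of_nat (m-1) * u) ^ 2
       - \<sigma> (of_nat (m-1) * u + u) * \<sigma> (of_nat (m-1) * u - u) * \<sigma> (of_nat (m+1) * u) ^ 2"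
    by (rule three_term[OF u])
  moreover have "of_nat (m+1) * u + of_nat (m-1) * u = of_nat (2*m) * u" "of_nat (m+1) * u - of_nat (m-1) * u = of_nat 2 * u"
    "of_nat (m+1) * u + u = of_nat (m+2) * u" "of_nat (m+1) * u - u = of_nat m * u" "of_nat (m-1) * u + u = of_nat m * u"
    "of_nat (m-1) * u - u = of_nat (m-2) * u"
    by (simp_all add: algebra_simps j)
  ultimately have "\<sigma> (of_nat (2*m) * u) * \<sigma> (of_nat 2 * u) * s^2 = \<sigma> (of_nat m * u) * (\<sigma> (of_nat (m+2) * u) * \<sigma> (of_nat (m-1) * u)^2 - \<sigma> (of_nat (m-2) * u) * \<sigma> (of_nat (m+1) * u)^2)"
    by (simp only: s_def right_diff_distrib) (simp only: mult_ac)
  then have "W (2*m) u * s^((2*m)^2) * (W 2 u * s^(2^2)) * s^2 = W m u * s^(m^2) * (W (m+2) u * s^((m+2)^2) * (W (m-1) u * s^((m-1)^2))^2 - W (m-2) u * s^((m-2)^2) * (W (m+1) u * s^((m+1)^2))^2)"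
    unfolding W_sigma[OF u] s_def .
  moreover have "s^((2*m)^2) * s^(2^2) * s^2 = s^(4*m^2+6)" "s^(m^2) * s^((m+2)^2) * (s^((m-1)^2))^2 = s^(4*m^2+6)"
    "s^(m^2) * s^((m-2)^2) * (s^((m+1)^2))^2 = s^(4*m^2+6)"
    unfolding j by (simp_all add: power_add[symmetric] power_mult[symmetric] flip: power_Suc power_Suc2) (simp_all add: power2_eq_square algebra_simps eval_nat_numeral)
  ultimately have "W (2*m) u * W 2 u * s^(4*m^2+6) = W m u * (W (m+2) u * W (m-1) u ^ 2 - W (m-2) u * W (m+1) u ^ 2) * s^(4*m^2+6)"
    by (rule collect_even_terms)
  then show ?thesis using s by simp
qed

lemma W_1: "u \<notin> L \<Longrightarrow> W 1 u = 1" by (simp add: W_def sigma_zero)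

lemma W_2: "u \<notin> L \<Longrightarrow> W 2 u = - deriv x u"
  by (simp add: W_def sigma_double sigma_zero)

definition psi3 :: "complex \<Rightarrow> complex" where "psi3 z = 3*z^4 + b2*z^3 + 3*b4*z^2 + 3*b6*z + b8"
definition psi4 :: "complex \<Rightarrow> complex" where
  "psi4 z = 2*z^6 + b2*z^5 + 5*b4*z^4 + 10*b6*z^3 + 10*b8*z^2 + (b2*b8 - b4*b6)*z + (b4*b8 - b6^2)"

text \<open>\<open>sigma_id\<close> at 2 w and w, with the duplication formula inserted. Points
  whose double is a pole are recovered from the continuous function \<open>f\<close>, in which no
  denominator is left.\<close>

lemma W_3:
  assumes u: "u \<notin> L"
  shows "W 3 u = psi3 (x u)"
proof -
  have gen: "W 3 w - psi3 (x w) = 0" if w: "w \<notin> L" "2 * w \<notin> L" for w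
  proof -
    have "\<sigma> (2 * w + w) * \<sigma> (2 * w - w) = - (\<sigma> w ^ 2) * \<sigma> (2 * w) ^ 2 * (x (2 * w) - x w)" by (rule sigma_id[OF w(2,1)])
    then have "\<sigma> (of_nat 3 * w) * \<sigma> w = - (\<sigma> w ^ 2) * (\<sigma> w ^ 4 * deriv x w)^2 * (x (2 * w) - x w)"
      by (simp add: sigma_double[OF w(1)])
    also have "\<dots> = - (\<sigma> w ^ 10) * ((deriv x w)^2 * (x (2 * w) - x w))" by (simp add: power_mult_distrib power_mult[symmetric] power_add[symmetric])
    also have "(deriv x w)^2 * (x (2 * w) - x w) = quart (x w) - x w * cubic (x w)"
      using double[OF w] ode1[OF w(1)] by (simp add: algebra_simps)
    also have "\<dots> = - psi3 (x w)" by (simp add: quart_def cubic_def psi3_def algebra_simps eval_nat_numeral)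
    finally have "\<sigma> (of_nat 3 * w) * \<sigma> w = \<sigma> w ^ 9 * psi3 (x w) * \<sigma> w" by algebra
    then have "\<sigma> (of_nat 3 * w) = \<sigma> w ^ 9 * psi3 (x w)" using w sigma_zero by simp
    then show ?thesis using w sigma_zero by (simp add: W_def)
  qed
  define f where "f = (\<lambda>w. \<sigma> (of_nat 3 * w) - \<sigma> w ^ 9 * psi3 (x w))"
  have "\<forall>\<^sub>F w in at u. 2 * w \<notin> L"
  proof -
    have "filterlim (\<lambda>w. 2 * w) (at (2 * u)) (at u)"
      by (rule filterlim_atI) (auto intro!: tendsto_intros simp: eventually_at_filter)
    then show ?thesis using ev_not_L(1)[of "2 * u"] by (rule eventually_compose_filterlim[rotated])
  qed
  then have "\<forall>\<^sub>F w in at u. f w = 0" using ev_not_L(1)[of u]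
    by eventually_elim (use gen sigma_zero in \<open>auto simp: f_def W_def field_simps\<close>)
  then have "(f \<longlongrightarrow> 0) (at u)" by (rule tendsto_eventually)
  moreover have "isCont f u" unfolding f_def psi3_def
    by (intro continuous_intros x_cont[OF u] sigma_cont isCont_o2[OF _ sigma_cont])
  then have "(f \<longlongrightarrow> f u) (at u)" by (simp add: isCont_def)
  ultimately have "f u = 0" by (rule tendsto_unique[OF at_neq_bot, rotated])
  then show ?thesis using u sigma_zero by (simp add: f_def W_def field_simps)
qed

lemma W_4:
  assumes u: "u \<notin> L"
  shows "W 4 u = - deriv x u * psi4 (x u)"
proof (cases "2 * u \<in> L")
  case True
  then have "of_nat 4 * u \<in> L" using L_add[OF True True] by simp
  then have "W 4 u = 0" using sigma_zero by (simp add: W_def)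
  moreover have "deriv x u = 0" using Y_zero_iff[OF u] True by simp
  ultimately show ?thesis by simp
next
  case False
  have Y: "deriv x u \<noteq> 0" using Y_zero_iff[OF u] False by simp
  have "\<sigma> (of_nat 4 * u) = - (\<sigma> (2 * u) ^ 4) * deriv x (2 * u)" using sigma_double[OF False] by simp
  also have "\<dots> = - (\<sigma> u ^ 16) * ((deriv x u)^4 * deriv x (2 * u))"
    unfolding sigma_double[OF u] by (simp add: power_mult_distrib power_mult[symmetric])
  also have "(deriv x u)^4 * deriv x (2 * u) = deriv x u * psi4 (x u)"
  proof -
    define Y z m where "Y = deriv x u" "z = x u" "m = quad z / Y"
    note defs = this
    have mY: "m * Y = quad z" using \<open>deriv x u \<noteq> 0\<close> by (simp add: defs)
    have Y2: "Y^2 = cubic z" using ode1[OF u] by (simp add: defs)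
    have d: "x (2 * u) * Y^2 = quart z" using double[OF u False] by (simp add: defs ode1[OF u])
    have "deriv x (2 * u) = - Y - m * (x (2 * u) - z)" using duplication(2)[OF u Y] by (simp add: defs)
    then have "Y^4 * deriv x (2 * u) = Y * (- ((Y^2)^2) - (m * Y) * (x (2 * u) * Y^2 - z * Y^2))" by algebra
    also have "\<dots> = Y * (- (cubic z ^ 2) - quad z * (quart z - z * cubic z))" unfolding mY d unfolding Y2 ..
    also have "- (cubic z ^ 2) - quad z * (quart z - z * cubic z) = psi4 z"
    proof -
      have "4 * b8 = b2 * b6 - b4^2" by (simp add: b8_def)
      then show ?thesis unfolding cubic_def quad_def quart_def psi4_def by algebra
    qed
    finally show ?thesis by (simp add: defs)
  qed
  finally show ?thesis using u sigma_zero by (simp add: W_def)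
qed

theorem W_eq_eds:
  assumes "n \<ge> 1" and u: "u \<notin> L"
  shows "W n u = (if odd n then 1 else - deriv x u) * eds (cubic (x u)) (psi3 (x u)) (psi4 (x u)) n"
  using assms(1)
proof (induction n rule: eds_induct)
  case (base n)
  then show ?case using W_1[OF u] W_2[OF u] W_3[OF u] W_4[OF u] by auto
next
  case (even m)
  define f where "f = eds (cubic (x u)) (psi3 (x u)) (psi4 (x u))"
  define Y where "Y = deriv x u"
  show ?case
  proof (cases "Y = 0")
    \<comment> \<open>At a 2-torsion point nothing can be cancelled, but then both sides vanish: 2 m
      u is a multiple of the pole 2 u.\<close>
    case True
    then have "2 * u \<in> L" using Y_zero_iff[OF u] by (simp add: Y_def)
    then have "of_nat (2 * m) * u \<in> L" using L_of_int[of "2 * u" "int m"] by (simp add: mult_ac)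
    then have "W (2 * m) u = 0" using sigma_zero by (simp add: W_def)
    then show ?thesis using True by (simp add: Y_def)
  next
    case False
    have par: "odd (m+2) \<longleftrightarrow> odd m" "odd (m-2) \<longleftrightarrow> odd m" "odd (m+1) \<longleftrightarrow> even m" "odd (m-1) \<longleftrightarrow> even m"
      using even(1) by presburger+
    have e1: "(- Y * a) * ((- Y * b) * (1 * c)^2 - (- Y * d) * (1 * e)^2) = Y^2 * (a * (b * c^2 - d * e^2))"
      and e2: "(1 * a) * ((1 * b) * (- Y * c)^2 - (1 * d) * (- Y * e)^2) = Y^2 * (a * (b * c^2 - d * e^2))" for a b c d e
      by algebra+
    have r: "W (2*m) u * (- Y) = W m u * (W (m+2) u * W (m-1) u ^ 2 - W (m-2) u * W (m+1) u ^ 2)"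
      using W_even_rec[OF u, of m] even(1) W_2[OF u] by (simp add: Y_def)
    have "W (2*m) u * (- Y) = Y^2 * (f m * (f (m+2) * f (m-1)^2 - f (m-2) * f (m+1)^2))"
      unfolding r even.IH par f_def[symmetric] Y_def[symmetric]
      by (cases "even m") (simp_all only: if_True if_False not_False_eq_True not_True_eq_False, (rule e1 e2)+)
    then have "(- Y) * W (2*m) u = (- Y) * (- Y * f (2*m))" unfolding f_def eds_even[OF even(1)] by algebra
    then have "W (2*m) u = - Y * f (2*m)" using False by (simp only: mult_cancel_left) simp
    then show ?thesis by (simp add: f_def Y_def)
  qed
next
  case (odd m)
  define f where "f = eds (cubic (x u)) (psi3 (x u)) (psi4 (x u))"
  define Y where "Y = deriv x u"
  have par: "odd (m+2) \<longleftrightarrow> odd m" "odd (m+1) \<longleftrightarrow> even m" "odd (m-1) \<longleftrightarrow> even m"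
    using odd(1) by presburger+
  have r: "W (2*m+1) u = W (m+2) u * W m u ^ 3 - W (m-1) u * W (m+1) u ^ 3"
    by (rule W_odd_rec[OF u]) (use odd(1) in simp)
  have o1: "(- Y * b) * (- Y * a)^3 - (1 * d) * (1 * e)^3 = (Y^2)^2 * b * a^3 - d * e^3"
    and o2: "(1 * b) * (1 * a)^3 - (- Y * d) * (- Y * e)^3 = b * a^3 - (Y^2)^2 * d * e^3" for a b d e
    by algebra+
  have c: "cubic (x u) = Y^2" using ode1[OF u] by (simp add: Y_def)
  have "W (2*m+1) u = f (2*m+1)"
    unfolding r odd.IH par f_def eds_odd[OF odd(1)] Y_def[symmetric] unfolding f_def[symmetric]
    by (cases "even m") (simp_all only: if_True if_False not_False_eq_True not_True_eq_False c, (rule o1 o2)+)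
  then show ?case by (simp add: f_def)
qed

lemma W_zero_iff: "u \<notin> L \<Longrightarrow> W n u = 0 \<longleftrightarrow> of_nat n * u \<in> L"
  by (simp add: W_def sigma_zero)

end

section \<open>The sigma function of a lattice\<close>

definition lattice_theta :: "complex \<Rightarrow> complex \<Rightarrow> complex \<Rightarrow> complex" where
  "lattice_theta w1 w2 u = theta (w2 / w1) (u / w1)"

locale weierstrass_lattice = weierstrass_function +
  fixes w1 w2 :: complex
  assumes L_eq: "L = {of_int a * w1 + of_int b * w2 | a b. True}" and Im_pos: "Im (w2 / w1) > 0"
begin

definition "s = lattice_theta w1 w2"

lemma w1_nz: "w1 \<noteq> 0" using Im_pos by auto

lemma w_in: "w1 \<in> L" "w2 \<in> L"
proof -
  have "w1 = of_int 1 * w1 + of_int 0 * w2" "w2 = of_int 0 * w1 + of_int 1 * w2" by simp_all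
  then show "w1 \<in> L" "w2 \<in> L" unfolding L_eq by blast+
qed

lemma s_hol: "s holomorphic_on UNIV"
  unfolding s_def lattice_theta_def
  by (rule holomorphic_on_compose_gen[of "\<lambda>u. u / w1" UNIV "theta (w2/w1)" UNIV, unfolded o_def])
     (auto intro!: holomorphic_intros theta_holomorphic Im_pos simp: w1_nz)

lemma s_odd: "s (- u) = - s u" by (simp add: s_def lattice_theta_def theta_minus)

lemma s_0: "s 0 = 0" using s_odd[of 0] by simp

lemma s_w1: "s (u + w1) = - s u"
  using w1_nz by (simp add: s_def lattice_theta_def add_divide_distrib theta_shift_1)

definition E where "E u = - exp (- of_real pi * \<i> * (w2 / w1) - 2 * of_real pi * \<i> * (u / w1))"

lemma s_w2: "s (u + w2) = E u * s u"
  using theta_shift_tau[of "w2/w1" "u/w1"] by (simp add: s_def lattice_theta_def E_def add_divide_distrib)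

lemma E_nz: "E u \<noteq> 0" by (simp add: E_def)

text \<open>The shift a cancels, so the product of the translates by a and - a has the same
  multiplier as the square of \<open>s\<close>.\<close>

lemma E_prod: "E (u + a) * E (u - a) = ee (- (w2/w1) - 2 * (u / w1))"
  unfolding E_def ee_def minus_mult_minus exp_add[symmetric]
  by (rule arg_cong[where f = exp]) (simp add: add_divide_distrib diff_divide_distrib algebra_simps)

lemma E_sq: "E u ^ 2 = ee (- (w2/w1) - 2 * (u / w1))"
  using E_prod[of u 0] by (simp add: power2_eq_square)

lemma s_deriv: "(s has_field_derivative deriv s u) (at u)"
  using holomorphic_derivI[OF s_hol open_UNIV] by auto

lemma s_cont: "isCont s u" using s_deriv DERIV_isCont by blast

lemma s_zero_shift: "s (u + w1) = 0 \<longleftrightarrow> s u = 0" "s (u + w2) = 0 \<longleftrightarrow> s u = 0"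
  by (simp_all add: s_w1 s_w2 E_nz)

lemma s_zero_L: "l \<in> L \<Longrightarrow> s l = 0"
proof -
  have 1: "s (u + of_int a * w1) = 0 \<longleftrightarrow> s u = 0" for u a
  proof (induction a rule: int_induct[where k = 0])
    case (step1 i)
    then show ?case using s_zero_shift(1)[of "u + of_int i * w1"] by (simp add: algebra_simps)
  next
    case (step2 i)
    then show ?case using s_zero_shift(1)[of "u + of_int (i - 1) * w1"] by (simp add: algebra_simps)
  qed simp
  have 2: "s (u + of_int a * w2) = 0 \<longleftrightarrow> s u = 0" for u a
  proof (induction a rule: int_induct[where k = 0])
    case (step1 i)
    then show ?case using s_zero_shift(2)[of "u + of_int i * w2"] by (simp add: algebra_simps)
  next
    case (step2 i)
    then show ?case using s_zero_shift(2)[of "u + of_int (i - 1) * w2"] by (simp add: algebra_simps)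
  qed simp
  assume "l \<in> L"
  then obtain a b where "l = of_int a * w1 + of_int b * w2" unfolding L_eq by blast
  then show "s l = 0" using 1[of 0 a] 2[of "of_int a * w1" b] s_0 by simp
qed

lemma ev_s_nz: "\<forall>\<^sub>F w in at z. s w \<noteq> 0"
proof -
  obtain v where "theta (w2/w1) v \<noteq> 0" using theta_nonzero[OF Im_pos] by blast
  then have "s (v * w1) \<noteq> 0" using w1_nz by (simp add: s_def lattice_theta_def)
  from non_zero_neighbour_alt[OF s_hol open_UNIV connected_UNIV UNIV_I UNIV_I this, of z] show ?thesis
    by eventually_elim simp
qed

section \<open>Functions of order two and the product identity\<close>

definition order2 :: "(complex \<Rightarrow> complex) \<Rightarrow> bool" where
  "order2 F \<longleftrightarrow> F holomorphic_on UNIV \<and> (\<forall>u. F (u + w1) = F u) \<and> (\<forall>u. F (u + w2) = ee (- (w2/w1) - 2 * (u / w1)) * F u)"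

text \<open>The Fourier coefficients of index 0 and 1 impose two linear conditions on three
  unknowns; the resulting combination vanishes by \<open>order2_theta_zero\<close> after rescaling
  the first period to 1.\<close>

lemma order2_dependent:
  assumes "order2 F" "order2 G" "order2 H"
  obtains a b c where "\<And>u. a * F u + b * G u + c * H u = 0" "a \<noteq> 0 \<or> b \<noteq> 0 \<or> c \<noteq> 0"
proof -
  define sc where "sc = (\<lambda>F v. F (w1 * v) :: complex)"
  have sch: "sc F holomorphic_on UNIV" if "F holomorphic_on UNIV" for F
    unfolding sc_def by (rule holomorphic_on_compose_gen[of "\<lambda>v. w1 * v" UNIV F UNIV, unfolded o_def]) (auto intro!: holomorphic_intros that)
  have hol: "sc F holomorphic_on UNIV" "sc G holomorphic_on UNIV" "sc H holomorphic_on UNIV"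
    using assms by (auto intro!: sch simp: order2_def)
  have quasi: "sc F (v + 1) = sc F v" "sc F (v + w2/w1) = ee (- (w2/w1) - 2 * v) * sc F v" if "order2 F" for F v
  proof -
    have "w1 * (v + 1) = w1 * v + w1" "w1 * (v + w2/w1) = w1 * v + w2" "w1 * v / w1 = v" using w1_nz by (simp_all add: algebra_simps)
    then show "sc F (v + 1) = sc F v" "sc F (v + w2/w1) = ee (- (w2/w1) - 2 * v) * sc F v"
      using that w1_nz by (simp_all add: order2_def sc_def)
  qed
  obtain a b c where abc: "a * fourier_coeff (sc F) 0 + b * fourier_coeff (sc G) 0 + c * fourier_coeff (sc H) 0 = 0"
    "a * fourier_coeff (sc F) 1 + b * fourier_coeff (sc G) 1 + c * fourier_coeff (sc H) 1 = 0" "a \<noteq> 0 \<or> b \<noteq> 0 \<or> c \<noteq> 0"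
    by (rule two_equations_three_unknowns) (rule that)
  define K where "K = (\<lambda>v. a * sc F v + b * sc G v + c * sc H v)"
  have "K v = 0" for v
  proof (rule order2_theta_zero[where \<tau> = "w2/w1" and F = K and z = v])
    show "K holomorphic_on UNIV" unfolding K_def by (intro holomorphic_intros hol)
    show "K (z + 1) = K z" for z by (simp add: K_def quasi assms)
    show "K (z + w2/w1) = ee (- (w2/w1) - 2 * z) * K z" for z
      unfolding K_def quasi(2)[OF assms(1)] quasi(2)[OF assms(2)] quasi(2)[OF assms(3)] by (simp add: algebra_simps)
    have "fourier_coeff K m = a * fourier_coeff (sc F) m + b * fourier_coeff (sc G) m + c * fourier_coeff (sc H) m" for m
    proof -
      have h: "(\<lambda>z. sc F z * ee (- of_int m * z)) holomorphic_on UNIV" "(\<lambda>z. sc G z * ee (- of_int m * z)) holomorphic_on UNIV"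
        "(\<lambda>z. sc H z * ee (- of_int m * z)) holomorphic_on UNIV"
        by (intro holomorphic_intros ee_holo hol)+
      have "fourier_coeff K m = mean (\<lambda>z. (a * (sc F z * ee (- of_int m * z)) + b * (sc G z * ee (- of_int m * z))) + c * (sc H z * ee (- of_int m * z)))"
        unfolding fourier_coeff_def K_def by (simp add: algebra_simps)
      also have "\<dots> = mean (\<lambda>z. a * (sc F z * ee (- of_int m * z)) + b * (sc G z * ee (- of_int m * z))) + mean (\<lambda>z. c * (sc H z * ee (- of_int m * z)))"
        by (rule mean_add) (intro holomorphic_intros h)+
      also have "mean (\<lambda>z. a * (sc F z * ee (- of_int m * z)) + b * (sc G z * ee (- of_int m * z))) =
          mean (\<lambda>z. a * (sc F z * ee (- of_int m * z))) + mean (\<lambda>z. b * (sc G z * ee (- of_int m * z)))"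
        by (rule mean_add) (intro holomorphic_intros h)+
      finally show ?thesis unfolding mean_cmult[OF h(1)] mean_cmult[OF h(2)] mean_cmult[OF h(3)] fourier_coeff_def .
    qed
    then show "fourier_coeff K 0 = 0" "fourier_coeff K 1 = 0" using abc by auto
  qed
  then have "K (u / w1) = 0" for u .
  then have "a * F u + b * G u + c * H u = 0" for u
    using w1_nz by (simp add: K_def sc_def)
  then show ?thesis using that abc(3) by blast
qed

text \<open>The entire extension of \<open>s ^ 2 * x\<close>: at a pole the simple zero or higher of
  \<open>s\<close> meets a double pole of leading coefficient 1.\<close>

definition sx where "sx u = (if u \<in> L then deriv s u ^ 2 else s u ^ 2 * x u)"

lemma lim_L:
  assumes l: "l \<in> L"
  shows "((\<lambda>u. s u ^ 2 * x u) \<longlongrightarrow> deriv s l ^ 2) (at l)"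
proof -
  have "((\<lambda>u. s u / (u - l)) \<longlongrightarrow> deriv s l) (at l)"
    using s_deriv[of l] s_zero_L[OF l] by (simp add: has_field_derivative_iff)
  moreover have "((\<lambda>u. (u - l)^2 * x (u - l)) \<longlongrightarrow> 1) (at l)"
  proof (rule filterlim_compose[OF lim_0])
    show "filterlim (\<lambda>u. u - l) (at 0) (at l)"
      by (rule filterlim_atI) (auto intro!: tendsto_eq_intros simp: eventually_at_filter)
  qed
  ultimately have "((\<lambda>u. (s u / (u - l))^2 * ((u - l)^2 * x (u - l))) \<longlongrightarrow> deriv s l ^ 2 * 1) (at l)"
    by (intro tendsto_intros)
  moreover have "\<forall>\<^sub>F u in at l. (s u / (u - l))^2 * ((u - l)^2 * x (u - l)) = s u ^ 2 * x u"
  proof -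
    have "\<forall>\<^sub>F u in at l. u \<noteq> l" by (simp add: eventually_at_filter)
    with ev_not_L(1)[of l] show ?thesis
    proof eventually_elim
      case (elim u)
      have "x (u - l) = x u" using translate(2)[OF L_minus[OF l] elim(1)] by simp
      then show ?case using elim(2) by (simp add: power_divide)
    qed
  qed
  ultimately show ?thesis using Lim_transform_eventually by fastforce
qed

lemma sx_order2: "order2 sx"
  unfolding order2_def
proof (intro conjI allI)
  show "sx holomorphic_on UNIV"
  proof (rule no_sparse_singularity[OF _ open_UNIV sparse])
    have "(\<lambda>u. s u ^ 2 * x u) holomorphic_on - L"
      by (intro holomorphic_intros hol holomorphic_on_subset[OF s_hol]) auto
    then show "sx holomorphic_on UNIV - L" unfolding Compl_eq_Diff_UNIV by (rule holomorphic_transform) (auto simp: sx_def)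
    fix l assume l: "l \<in> L"
    have "\<forall>\<^sub>F u in at l. s u ^ 2 * x u = sx u" using ev_not_L(1)[of l] by eventually_elim (simp add: sx_def)
    with lim_L[OF l] have "(sx \<longlongrightarrow> deriv s l ^ 2) (at l)" by (rule Lim_transform_eventually)
    then show "(sx \<longlongrightarrow> sx l) (at l)" using l by (simp add: sx_def)
  qed
  fix u
  have d1: "deriv s (u + w1) = - deriv s u"
  proof -
    have "((\<lambda>u. s (u + w1)) has_field_derivative deriv s (u + w1)) (at u)" using DERIV_shift[of s _ u w1] s_deriv by blast
    moreover have "((\<lambda>u. s (u + w1)) has_field_derivative - deriv s u) (at u)" unfolding s_w1 by (intro DERIV_minus s_deriv)
    ultimately show ?thesis by (rule DERIV_unique)
  qed
  \<comment> \<open>The derivative of the multiplier drops out only where \<open>s\<close> vanishes,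
    which suffices since the derivative of \<open>s\<close> occurs in \<open>sx\<close> only on
    \<open>L\<close>.\<close>
  have d2: "deriv s (u + w2) = E u * deriv s u" if "u \<in> L"
  proof -
    have "((\<lambda>u. s (u + w2)) has_field_derivative deriv s (u + w2)) (at u)" using DERIV_shift[of s _ u w2] s_deriv by blast
    moreover have "(E has_field_derivative deriv E u) (at u)"
      by (rule holomorphic_derivI[of E UNIV]) (auto simp: E_def [abs_def] w1_nz intro!: holomorphic_intros)
    then have "((\<lambda>u. s (u + w2)) has_field_derivative (deriv E u * s u + deriv s u * E u)) (at u)"
      unfolding s_w2 by (intro DERIV_mult s_deriv)
    ultimately have "deriv s (u + w2) = deriv E u * s u + deriv s u * E u" by (rule DERIV_unique)
    then show ?thesis using s_zero_L[OF that] by simp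
  qed
  show "sx (u + w1) = sx u"
    using d1 translate[OF w_in(1), of u] L_add_iff[OF w_in(1), of u] by (simp add: sx_def s_w1)
  show "sx (u + w2) = ee (- (w2/w1) - 2 * (u / w1)) * sx u"
    using d2 translate[OF w_in(2), of u] L_add_iff[OF w_in(2), of u] by (simp add: sx_def s_w2 power_mult_distrib E_sq)
qed

lemma s2_order2: "order2 (\<lambda>u. s u ^ 2)"
  unfolding order2_def by (auto simp: s_w1 s_w2 power_mult_distrib E_sq intro!: holomorphic_intros s_hol)

lemma ss_order2: "order2 (\<lambda>u. s (u + a) * s (u - a))"
  unfolding order2_def
proof (intro conjI allI)
  show "(\<lambda>u. s (u + a) * s (u - a)) holomorphic_on UNIV"
    using holomorphic_shift[OF s_hol, of a] holomorphic_shift[OF s_hol, of "- a"] by (auto intro!: holomorphic_intros)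
  fix u
  have e: "u + w + a = (u + a) + w" "u + w - a = (u - a) + w" for w by simp_all
  show "s (u + w1 + a) * s (u + w1 - a) = s (u + a) * s (u - a)" unfolding e s_w1 by simp
  show "s (u + w2 + a) * s (u + w2 - a) = ee (- (w2/w1) - 2 * (u / w1)) * (s (u + a) * s (u - a))"
    unfolding e s_w2 E_prod[of u a, symmetric] by (simp add: mult_ac)
qed

lemma ss_combination:
  obtains A B where "\<And>u. u \<notin> L \<Longrightarrow> s (u + a) * s (u - a) = s u ^ 2 * (A + B * x u)" "\<And>u. s (u + a) * s (u - a) = A * s u ^ 2 + B * sx u"
proof -
  obtain p q r where pqr: "\<And>u. p * (s (u + a) * s (u - a)) + q * s u ^ 2 + r * sx u = 0" "p \<noteq> 0 \<or> q \<noteq> 0 \<or> r \<noteq> 0"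
    by (rule order2_dependent[OF ss_order2[of a] s2_order2 sx_order2]) (rule that)
  \<comment> \<open>A relation without the product would make \<open>x\<close> constant near 0,
    where it has a pole.\<close>
  have "p \<noteq> 0"
  proof
    assume p: "p = 0"
    have "\<forall>\<^sub>F u in at 0. s u \<noteq> 0 \<and> u \<notin> L \<and> x u \<noteq> - q / r"
      using ev_s_nz[of 0] ev_not_L(1)[of 0] ev_x_neq[of "- q / r" 0] by eventually_elim auto
    then obtain u where u: "s u \<noteq> 0" "u \<notin> L" "x u \<noteq> - q / r" using eventually_happens[of _ "at (0::complex)"] by auto
    have "s u ^ 2 * (q + r * x u) = 0" using pqr(1)[of u] u p by (simp add: sx_def algebra_simps)
    then have z: "q + r * x u = 0" using u(1) by simp
    show False
    proof (cases "r = 0")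
      case True
      then show False using z pqr(2) p by simp
    next
      case False
      then have "x u = - q / r" using z by (simp add: field_simps add_eq_0_iff)
      then show False using u(3) by simp
    qed
  qed
  have 2: "s (u + a) * s (u - a) = (- q / p) * s u ^ 2 + (- r / p) * sx u" for u
  proof -
    have "p * (s (u + a) * s (u - a)) = p * ((- q / p) * s u ^ 2 + (- r / p) * sx u)"
    proof -
      have "p * (s (u + a) * s (u - a)) = - q * s u ^ 2 - r * sx u" using pqr(1)[of u] by algebra
      then show ?thesis using \<open>p \<noteq> 0\<close> by (simp add: ring_distribs)
    qed
    then show ?thesis using \<open>p \<noteq> 0\<close> by (simp only: mult_cancel_left) simp
  qed
  show ?thesis
    by (rule that[OF _ 2]) (simp only: 2, simp add: sx_def algebra_simps)
qed

text \<open>Both constants of the linear combination come from special points: u = a, where the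
  product vanishes, and u = 0, where only the \<open>sx\<close> term survives.\<close>

lemma identity_aux:
  assumes a: "a \<notin> L" and sa: "s a \<noteq> 0"
  shows "s (u + a) * s (u - a) * deriv s 0 ^ 2 = - (s a ^ 2) * (sx u - x a * s u ^ 2)"
proof -
  obtain A B where AB: "\<And>u. u \<notin> L \<Longrightarrow> s (u + a) * s (u - a) = s u ^ 2 * (A + B * x u)" "\<And>u. s (u + a) * s (u - a) = A * s u ^ 2 + B * sx u"
    by (rule ss_combination[of a]) (rule that)
  have A: "A = - B * x a" using AB(1)[OF a] sa s_0 by (simp add: add_eq_0_iff)
  have B: "- (s a ^ 2) = B * deriv s 0 ^ 2"
    using AB(2)[of 0] s_0 zero_in by (simp add: sx_def s_odd power2_eq_square)
  show ?thesis unfolding AB(2)[of u] A B by (simp add: algebra_simps)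
qed

text \<open>A double zero at 0 would annihilate the left side of \<open>identity_aux\<close> and
  force \<open>x u = x a\<close> for general u.\<close>

lemma deriv_s_0: "deriv s 0 \<noteq> 0"
proof
  assume 0: "deriv s 0 = 0"
  obtain a where "s a \<noteq> 0" "a \<notin> L"
    using eventually_happens[OF eventually_conj[OF ev_s_nz[of 0] ev_not_L(1)[of 0]]] by auto
  note a = this
  have "\<forall>\<^sub>F u in at 0. s u \<noteq> 0 \<and> u \<notin> L \<and> x u \<noteq> x a"
    using ev_s_nz[of 0] ev_not_L(1)[of 0] ev_x_neq[of "x a" 0] by eventually_elim auto
  then obtain u where u: "s u \<noteq> 0" "u \<notin> L" "x u \<noteq> x a" using eventually_happens[of _ "at (0::complex)"] by auto
  have "s a ^ 2 * (s u ^ 2 * (x u - x a)) = 0"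
    using identity_aux[OF a(2,1), of u] 0 u(2) by (simp add: sx_def algebra_simps)
  then show False using a u by simp
qed

lemma identity:
  assumes a: "a \<notin> L" and u: "u \<notin> L"
  shows "s (u + a) * s (u - a) * deriv s 0 ^ 2 = - (s a ^ 2) * s u ^ 2 * (x u - x a)"
proof -
  define f where "f = (\<lambda>a. s (u + a) * s (u - a) * deriv s 0 ^ 2 + s a ^ 2 * s u ^ 2 * (x u - x a))"
  have "isCont f a" unfolding f_def
    by (intro continuous_intros x_cont[OF a] s_cont isCont_o2[OF _ s_cont])
  then have "(f \<longlongrightarrow> f a) (at a)" by (simp add: isCont_def)
  moreover have "\<forall>\<^sub>F w in at a. f w = 0"
    using ev_s_nz[of a] ev_not_L(1)[of a]
    by eventually_elim (use identity_aux[of _ u] u in \<open>simp add: f_def sx_def algebra_simps\<close>)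
  then have "(f \<longlongrightarrow> 0) (at a)" by (rule tendsto_eventually)
  ultimately have "f a = 0" by (rule tendsto_unique[OF at_neq_bot])
  then show ?thesis by (simp add: f_def add_eq_0_iff)
qed

text \<open>A zero u off \<open>L\<close> would, by \<open>identity\<close>, make s (v + u) s (v -
  u) vanish for all v off \<open>L\<close>, contrary to the isolation of the zeros. This replaces
  counting zeros in a period parallelogram.\<close>

lemma s_zero_iff: "s u = 0 \<longleftrightarrow> u \<in> L"
proof
  assume 0: "s u = 0"
  show "u \<in> L"
  proof (rule ccontr)
    assume u: "u \<notin> L"
    have nz: "\<forall>\<^sub>F v in at 0. s (v + u) \<noteq> 0" "\<forall>\<^sub>F v in at 0. s (v - u) \<noteq> 0"
    proof -
      have "filterlim (\<lambda>v. v + c) (at c) (at 0)" for c :: complex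
        by (rule filterlim_atI) (auto intro!: tendsto_eq_intros simp: eventually_at_filter)
      from eventually_compose_filterlim[OF ev_s_nz this[of u]] eventually_compose_filterlim[OF ev_s_nz this[of "- u"]]
      show "\<forall>\<^sub>F v in at 0. s (v + u) \<noteq> 0" "\<forall>\<^sub>F v in at 0. s (v - u) \<noteq> 0" by simp_all
    qed
    obtain v where "s (v + u) \<noteq> 0" "s (v - u) \<noteq> 0" "v \<notin> L"
      using eventually_happens[OF eventually_conj[OF nz(1) eventually_conj[OF nz(2) ev_not_L(1)[of 0]]]] by auto
    then show False using identity[OF u, of v] 0 deriv_s_0 by simp
  qed
qed (rule s_zero_L)

text \<open>The quadratic exponential respects the product identity because (u + a)^2 + (u - a)^2 =
  2 u^2 + 2 a^2, and it does not affect the derivative at the zero 0.\<close>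

theorem sigma_locale:
  assumes \<sigma>: "\<And>u. \<sigma> u = 1 / deriv s 0 * (exp (\<kappa> * u^2) * s u)"
  shows "weierstrass_sigma b2 b4 b6 x L \<sigma>"
proof unfold_locales
  have \<sigma>': "\<sigma> = (\<lambda>u. 1 / deriv s 0 * (exp (\<kappa> * u^2) * s u))" using \<sigma> by auto
  show "\<sigma> holomorphic_on UNIV" unfolding \<sigma>' by (intro holomorphic_intros s_hol)
  show "\<sigma> u = 0 \<longleftrightarrow> u \<in> L" for u unfolding \<sigma> using deriv_s_0 s_zero_iff by simp
  have "((\<lambda>u. exp (\<kappa> * u^2)) has_field_derivative 0) (at 0)" by (auto intro!: derivative_eq_intros)
  from DERIV_cmult[OF DERIV_mult[OF this s_deriv[of 0]], of "1 / deriv s 0"]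
  show "(\<sigma> has_field_derivative 1) (at 0)" unfolding \<sigma>' using deriv_s_0 by simp
  fix u a assume u: "u \<notin> L" and a: "a \<notin> L"
  define d where "d = deriv s 0"
  define eu ea where "eu = exp (\<kappa> * u^2)" "ea = exp (\<kappa> * a^2)"
  have e: "exp (\<kappa> * (u + a)^2) * exp (\<kappa> * (u - a)^2) = eu^2 * ea^2"
    unfolding eu_ea_def exp_of_nat_mult[symmetric] power2_eq_square[of "exp _"] exp_add[symmetric]
    by (rule arg_cong[where f = exp]) (simp add: power2_eq_square algebra_simps)
  have d: "1 / d * d = 1" using deriv_s_0 by (simp add: d_def)
  have "\<sigma> (u + a) * \<sigma> (u - a) = (1 / d)^2 * (exp (\<kappa> * (u + a)^2) * exp (\<kappa> * (u - a)^2)) * (s (u + a) * s (u - a))"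
    unfolding \<sigma> d_def[symmetric] by (simp add: power2_eq_square mult_ac)
  also have "\<dots> = (1 / d)^2 * (eu^2 * ea^2) * (s (u + a) * s (u - a) * d^2 * (1 / d)^2)"
    unfolding e using d by (simp add: power_mult_distrib[symmetric])
  also have "s (u + a) * s (u - a) * d^2 = - (s a ^ 2) * s u ^ 2 * (x u - x a)"
    unfolding d_def by (rule identity[OF a u])
  also have "(1 / d)^2 * (eu^2 * ea^2) * (- (s a ^ 2) * s u ^ 2 * (x u - x a) * (1 / d)^2) = - (\<sigma> a ^ 2) * \<sigma> u ^ 2 * (x u - x a)"
  proof -
    obtain k where k: "k = 1 / d" by simp
    show ?thesis unfolding \<sigma> d_def[symmetric] eu_ea_def[symmetric] k[symmetric] by algebra
  qed
  finally show "\<sigma> (u + a) * \<sigma> (u - a) = - (\<sigma> a ^ 2) * \<sigma> u ^ 2 * (x u - x a)" .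
qed

theorem sigma_sigma_locale:
  "weierstrass_sigma b2 b4 b6 x L (sigma w1 w2 \<eta>)"
proof -
  define \<kappa> where "\<kappa> = 1/2 * \<eta> / w1"
  define U where "U = unnormalized_sigma w1 w2 \<eta>"
  have U: "U u = exp (\<kappa> * u^2) * s u" for u
    by (simp add: U_def unnormalized_sigma_def s_def lattice_theta_def theta_def \<kappa>_def mult_ac)
  have U': "U = (\<lambda>u. exp (\<kappa> * u^2) * s u)" using U by auto
  have Uh: "U holomorphic_on UNIV" unfolding U' by (intro holomorphic_intros s_hol)
  define d where "d = deriv s 0"
  have dU: "(U has_field_derivative d) (at 0)"
  proof -
    have "((\<lambda>u. exp (\<kappa> * u^2)) has_field_derivative 0) (at 0)" by (auto intro!: derivative_eq_intros)
    from DERIV_mult[OF this s_deriv[of 0]] show ?thesis unfolding U' d_def by simp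
  qed
  have U0: "U 0 = 0" by (simp add: U s_0)
  have d: "d \<noteq> 0" using deriv_s_0 by (simp add: d_def)
  have "sigma_constant w1 w2 \<eta> = 1 / d"
    unfolding sigma_constant_def U_def[symmetric]
  proof (rule the_equality)
    define f where "f = (\<lambda>u. 1 / d * U u - u)"
    have fh: "f holomorphic_on UNIV" unfolding f_def by (intro holomorphic_intros Uh)
    have f0: "f 0 = 0" by (simp add: f_def U0)
    have "(f has_field_derivative 1 / d * d - 1) (at 0)" unfolding f_def by (intro DERIV_diff DERIV_cmult dU DERIV_ident)
    then have df: "deriv f 0 = 0" using d by (simp add: DERIV_imp_deriv)
    \<comment> \<open>Here f has a double zero, so g = f / z extends holomorphically with value 0,
      and f / z^2 tends to the derivative of g. A finite limit yields the required bound.\<close>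
    define g where "g = (\<lambda>z. if z = 0 then deriv f 0 else (f z - f 0) / (z - 0))"
    have "g holomorphic_on UNIV" unfolding g_def by (rule pole_lemma[OF fh]) simp
    then have "(g has_field_derivative deriv g 0) (at 0)" using holomorphic_derivI[OF _ open_UNIV] by auto
    then have "((\<lambda>z. (g z - g 0) / (z - 0)) \<longlongrightarrow> deriv g 0) (at 0)" by (simp add: has_field_derivative_iff)
    moreover have ne: "\<forall>\<^sub>F z in at (0::complex). z \<noteq> 0" by (simp add: eventually_at_filter)
    then have "\<forall>\<^sub>F z in at 0. (g z - g 0) / (z - 0) = f z / z^2"
      by eventually_elim (simp add: g_def df f0 power2_eq_square)
    ultimately have "((\<lambda>z. f z / z^2) \<longlongrightarrow> deriv g 0) (at 0)" by (rule Lim_transform_eventually)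
    then have "f \<in> O[at 0](\<lambda>u. u^2)" by (rule bigoI_tendsto) (use ne in \<open>eventually_elim, simp\<close>)
    then show "1 / d \<noteq> 0 \<and> (\<lambda>u. 1 / d * U u - u) \<in> O[at 0](\<lambda>u. u^2)" using d by (simp add: f_def)
  next
    fix c assume c: "c \<noteq> 0 \<and> (\<lambda>u. c * U u - u) \<in> O[at 0](\<lambda>u. u^2)"
    have ne: "\<forall>\<^sub>F z in at (0::complex). z \<noteq> 0" by (simp add: eventually_at_filter)
    have "((\<lambda>u::complex. u^2 / u) \<longlongrightarrow> 0) (at 0)"
    proof (rule Lim_transform_eventually)
      show "((\<lambda>u::complex. u) \<longlongrightarrow> 0) (at 0)" by (rule tendsto_ident_at)
      show "\<forall>\<^sub>F u in at (0::complex). u = u^2 / u" using ne by eventually_elim (simp add: power2_eq_square)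
    qed
    then have "(\<lambda>u::complex. u^2) \<in> o[at 0](\<lambda>u. u)" by (rule smalloI_tendsto) (use ne in simp)
    then have "(\<lambda>u. c * U u - u) \<in> o[at 0](\<lambda>u. u)" using c landau_o.big_small_trans by blast
    then have l0: "((\<lambda>u. (c * U u - u) / u) \<longlongrightarrow> 0) (at 0)" by (rule smalloD_tendsto)
    have "((\<lambda>u. U u / u) \<longlongrightarrow> d) (at 0)" using dU U0 by (simp add: has_field_derivative_iff)
    then have "((\<lambda>u. c * (U u / u) - 1) \<longlongrightarrow> c * d - 1) (at 0)" by (intro tendsto_intros)
    moreover have "\<forall>\<^sub>F u in at 0. c * (U u / u) - 1 = (c * U u - u) / u" using ne by eventually_elim (simp add: field_simps)
    ultimately have "((\<lambda>u. (c * U u - u) / u) \<longlongrightarrow> c * d - 1) (at 0)" by (rule Lim_transform_eventually)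
    with l0 have "0 = c * d - 1" by (rule tendsto_unique[OF at_neq_bot])
    then show "c = 1 / d" using d by (simp add: field_simps)
  qed
  then show ?thesis
    by (intro sigma_locale[where \<kappa> = \<kappa>]) (simp add: sigma_def U_def[symmetric] U d_def)
qed

end

section \<open>The uniformization as a covering map\<close>

text \<open>By continuity \<open>h\<close> stays near \<open>h t\<close>, so locally it is the
  composition of \<open>g\<close> with a holomorphic inverse of \<open>f\<close>; a merely
  continuous lift is thereby differentiable.\<close>

lemma has_vector_derivative_inverse_branch:
  fixes f :: "complex \<Rightarrow> complex" and h :: "real \<Rightarrow> complex"
  assumes f: "f holomorphic_on S" "open S" and h: "isCont h t" "h t \<in> S" and nz: "deriv f (h t) \<noteq> 0"
    and g: "(g has_vector_derivative D) (at t)" and T: "open T" "t \<in> T" "\<And>s. s \<in> T \<Longrightarrow> f (h s) = g s"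
  shows "(h has_vector_derivative (D / deriv f (h t))) (at t)"
proof -
  obtain r where r: "r > 0" "ball (h t) r \<subseteq> S" "inj_on f (ball (h t) r)"
    using has_complex_derivative_locally_injective[OF f(1) h(2) f(2) nz] by metis
  obtain W where W: "W holomorphic_on (f ` ball (h t) r)" "\<And>z. z \<in> ball (h t) r \<Longrightarrow> deriv f z * deriv W (f z) = 1"
    "\<And>z. z \<in> ball (h t) r \<Longrightarrow> W (f z) = z"
    using holomorphic_has_inverse[OF holomorphic_on_subset[OF f(1) r(2)] open_ball r(3)] by metis
  have o: "open (f ` ball (h t) r)"
    by (rule open_mapping_thm3[OF holomorphic_on_subset[OF f(1) r(2)] open_ball r(3)])
  have c: "h t \<in> ball (h t) r" using r(1) by simp
  have "(W has_field_derivative deriv W (f (h t))) (at (f (h t)))"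
    by (rule holomorphic_derivI[OF W(1) o]) (use c in blast)
  moreover have "f (h t) = g t" using T by blast
  ultimately have "(W has_field_derivative deriv W (f (h t))) (at (g t))" by simp
  from field_vector_diff_chain_at[OF g this]
  have d: "(W \<circ> g has_vector_derivative D * deriv W (f (h t))) (at t)" .
  have "deriv W (f (h t)) = 1 / deriv f (h t)" using W(2)[OF c] nz by (simp add: field_simps)
  with d have d: "(W \<circ> g has_vector_derivative D / deriv f (h t)) (at t)" by simp
  have "(h \<longlongrightarrow> h t) (nhds t)" using h(1) by (simp add: isCont_def tendsto_nhds_iff)
  then have "\<forall>\<^sub>F s in nhds t. h s \<in> ball (h t) r" by (rule topological_tendstoD[OF _ open_ball c])
  moreover have "\<forall>\<^sub>F s in nhds t. s \<in> T" using T by (intro eventually_nhds_in_open)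
  ultimately have "\<forall>\<^sub>F s in nhds t. (W \<circ> g) s = h s"
    by eventually_elim (metis W(3) T(3) comp_apply)
  then obtain V where V: "open V" "t \<in> V" "\<And>s. s \<in> V \<Longrightarrow> (W \<circ> g) s = h s"
    unfolding eventually_nhds by blast
  show ?thesis by (rule has_vector_derivative_transform_within_open[OF d V])
qed

locale weierstrass_curve = weierstrass_function +
  fixes \<mu> :: "nat \<Rightarrow> complex"
  assumes b2: "b2 = \<mu> 1^2 + 4 * \<mu> 2" and b4: "b4 = 2 * \<mu> 4 + \<mu> 1 * \<mu> 3" and b6: "b6 = \<mu> 3^2 + 4 * \<mu> 6"
begin

abbreviation "E \<equiv> affine_curve \<mu>"

text \<open>Completing the square: with this function in place of y the curve reads
  \<open>eta ^ 2 = cubic\<close>.\<close>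

definition eta :: "complex \<times> complex \<Rightarrow> complex" where "eta p = 2 * snd p + \<mu> 1 * fst p + \<mu> 3"

definition P :: "complex \<Rightarrow> complex \<times> complex" where
  "P u = (x u, (deriv x u - \<mu> 1 * x u - \<mu> 3) / 2)"

lemma eta_P: "eta (P u) = deriv x u" and fst_P: "fst (P u) = x u"
  by (simp_all add: eta_def P_def diff_divide_distrib)

lemma in_E_iff: "p \<in> E \<longleftrightarrow> eta p ^ 2 = cubic (fst p)"
proof -
  obtain a b where p: "p = (a, b)" by force
  have "eta p ^ 2 - cubic (fst p) = 4 * (b^2 + (\<mu> 1 * a + \<mu> 3) * b - (a^3 + \<mu> 2 * a^2 + \<mu> 4 * a + \<mu> 6))"
    unfolding p eta_def cubic_def unfolding b2 b4 b6 by (simp add: power2_eq_square power3_eq_cube algebra_simps)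
  moreover have "p \<in> E \<longleftrightarrow> b^2 + (\<mu> 1 * a + \<mu> 3) * b - (a^3 + \<mu> 2 * a^2 + \<mu> 4 * a + \<mu> 6) = 0"
    by (simp add: p affine_curve_def)
  ultimately show ?thesis by (metis (no_types) eq_iff_diff_eq_0 mult_eq_0_iff zero_neq_numeral)
qed

lemma eq_P_iff: "p = q \<longleftrightarrow> fst p = fst q \<and> eta p = eta q"
  by (auto simp: prod_eq_iff eta_def)

lemma P_in_E: "u \<notin> L \<Longrightarrow> P u \<in> E"
  by (simp add: in_E_iff eta_P fst_P ode1)

lemma P_onto: "p \<in> E \<Longrightarrow> \<exists>u. u \<notin> L \<and> P u = p"
  using surjective[of "eta p" "fst p"] by (metis eq_P_iff eta_P fst_P in_E_iff)

lemma P_image: "P ` (- L) = E" using P_in_E P_onto by force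

lemma P_eq_iff: "u \<notin> L \<Longrightarrow> v \<notin> L \<Longrightarrow> P u = P v \<longleftrightarrow> u - v \<in> L"
  using injective[of u v] translate[of "u - v" v] translate_Y[of "u - v" v]
  by (auto simp: eq_P_iff eta_P fst_P)

lemma P_translate: "l \<in> L \<Longrightarrow> u \<notin> L \<Longrightarrow> P (u + l) = P u"
  by (simp add: eq_P_iff eta_P fst_P translate translate_Y)

lemma P_cont: "continuous_on (- L) P"
  unfolding P_def using hol Y_hol by (intro continuous_intros holomorphic_on_imp_continuous_on) simp_all

lemma eta_cont: "continuous_on S eta" unfolding eta_def by (intro continuous_intros)

lemma x_not_const: "\<not> x constant_on (- L)"
proof
  assume "x constant_on (- L)"
  then obtain c where "\<And>u. u \<in> - L \<Longrightarrow> x u = c" unfolding constant_on_def by blast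
  moreover obtain u where "u \<notin> L" "x u = c + 1" using x_surjective by blast
  ultimately show False by (metis ComplI add_cancel_left_right zero_neq_one)
qed

lemma Y_not_const: "\<not> deriv x constant_on (- L)"
proof
  assume "deriv x constant_on (- L)"
  then obtain c where c: "\<And>u. u \<in> - L \<Longrightarrow> deriv x u = c" unfolding constant_on_def by blast
  have "quad (x u) = 0" if u: "u \<notin> L" for u
  proof -
    have "((\<lambda>u. c) has_field_derivative quad (x u)) (at u)"
      by (rule has_field_derivative_transform_within_open[OF Y_deriv[OF u] L_open]) (use u c in auto)
    then show ?thesis using DERIV_unique[OF _ DERIV_const] by blast
  qed
  then have q: "quad a = 0" for a using x_surjective[of a] by blast
  have "quad 1 + quad (-1) - 2 * quad 0 = 12" by (simp add: quad_def)
  then show False using q by simp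
qed

text \<open>Openness comes from the open mapping theorem in a local coordinate of the curve: fst
  where \<open>eta\<close> is nonzero, \<open>eta\<close> itself at the branch points.\<close>

lemma P_open_map:
  assumes V: "open V" "V \<subseteq> - L"
  shows "openin (top_of_set E) (P ` V)"
proof -
  have "\<exists>Q. open Q \<and> P u \<in> Q \<and> Q \<inter> E \<subseteq> P ` V" if u: "u \<in> V" for u
  proof -
    have uL: "u \<notin> L" using u V by blast
    define Y0 where "Y0 = deriv x u"
    show ?thesis
    proof (cases "Y0 = 0")
      case False
      have "(deriv x \<longlongrightarrow> Y0) (nhds u)" using Y_cont[OF uL] by (simp add: isCont_def tendsto_nhds_iff Y0_def)
      then have "\<forall>\<^sub>F w in nhds u. dist (deriv x w) Y0 < norm Y0" using False by (intro tendstoD) auto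
      moreover have "\<forall>\<^sub>F w in nhds u. w \<in> V" using V u by (intro eventually_nhds_in_open)
      ultimately have "\<forall>\<^sub>F w in nhds u. dist (deriv x w) Y0 < norm Y0 \<and> w \<in> V" by eventually_elim simp
      then obtain B where B: "open B" "u \<in> B" "\<And>w. w \<in> B \<Longrightarrow> dist (deriv x w) Y0 < norm Y0 \<and> w \<in> V"
        unfolding eventually_nhds by blast
      have oB: "open (x ` B)"
        by (rule open_mapping_thm[OF hol L_open L_connected B(1) _ x_not_const]) (use B V in blast)
      define O' where "O' = {q. fst q \<in> x ` B} \<inter> {q. dist (eta q) Y0 < norm Y0}"
      have "open O'"
        unfolding O'_def
      proof (intro open_Int)
        have "open (fst -` (x ` B) :: (complex \<times> complex) set)" by (intro open_vimage oB continuous_intros)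
        then show "open {q :: complex \<times> complex. fst q \<in> x ` B}" by (simp add: vimage_def)
        show "open {q. dist (eta q) Y0 < norm Y0}" by (intro open_Collect_less continuous_intros eta_cont)
      qed
      moreover have "P u \<in> O'" using B(2) False by (auto simp: O'_def fst_P eta_P Y0_def)
      moreover have "O' \<inter> E \<subseteq> P ` V"
      proof
        fix q assume q: "q \<in> O' \<inter> E"
        then obtain w where w: "w \<in> B" "fst q = x w" by (auto simp: O'_def)
        have wL: "w \<notin> L" using B w V by blast
        have "eta q ^ 2 = deriv x w ^ 2" using q w ode1[OF wL] by (simp add: in_E_iff)
        \<comment> \<open>The two points over the same first coordinate have opposite
          \<open>eta\<close>; both cannot lie within distance |Y0| of Y0.\<close>
        moreover have "eta q \<noteq> - deriv x w"
        proof
          assume e: "eta q = - deriv x w"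
          have "norm (2 * Y0) \<le> dist (eta q) Y0 + dist (deriv x w) Y0"
            using norm_triangle_ineq[of "Y0 - eta q" "Y0 - deriv x w"] e by (simp add: dist_norm norm_minus_commute algebra_simps)
          moreover have "dist (eta q) Y0 < norm Y0" "dist (deriv x w) Y0 < norm Y0" using q B(3)[OF w(1)] by (auto simp: O'_def)
          ultimately show False by (simp add: norm_mult)
        qed
        ultimately have "eta q = deriv x w" by (auto simp: power2_eq_iff)
        then have "q = P w" using w by (simp add: eq_P_iff eta_P fst_P)
        then show "q \<in> P ` V" using B(3)[OF w(1)] by blast
      qed
      ultimately show ?thesis by blast
    next
      case True
      \<comment> \<open>At a branch point the first coordinate is recovered from
        \<open>eta ^ 2 = cubic\<close>, since the cubic is injective near a simple root.\<close>
      have c0: "cubic (x u) = 0" using ode1[OF uL] True by (simp add: Y0_def)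
      then have q0: "quad (x u) \<noteq> 0" using no_double_root[of "x u"] by (simp add: cubic_def quad_def)
      have ch: "cubic holomorphic_on UNIV" unfolding cubic_def by (intro holomorphic_intros)
      have "(cubic has_field_derivative 2 * quad (x u)) (at (x u))"
        unfolding cubic_def by (rule derivative_eq_intros refl)+ (simp add: quad_def algebra_simps power2_eq_square)
      then have "deriv cubic (x u) \<noteq> 0" using q0 DERIV_imp_deriv by fastforce
      then obtain \<delta> where \<delta>: "\<delta> > 0" "inj_on cubic (ball (x u) \<delta>)"
        using has_complex_derivative_locally_injective[OF ch UNIV_I open_UNIV] by metis
      have "(x \<longlongrightarrow> x u) (nhds u)" using x_cont[OF uL] by (simp add: isCont_def tendsto_nhds_iff)
      then have "\<forall>\<^sub>F w in nhds u. dist (x w) (x u) < \<delta>" using \<delta> by (intro tendstoD) auto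
      moreover have "\<forall>\<^sub>F w in nhds u. w \<in> V" using V u by (intro eventually_nhds_in_open)
      ultimately have "\<forall>\<^sub>F w in nhds u. dist (x w) (x u) < \<delta> \<and> w \<in> V" by eventually_elim simp
      then obtain B where B: "open B" "u \<in> B" "\<And>w. w \<in> B \<Longrightarrow> dist (x w) (x u) < \<delta> \<and> w \<in> V"
        unfolding eventually_nhds by blast
      have oB: "open (deriv x ` B)"
        by (rule open_mapping_thm[OF Y_hol L_open L_connected B(1) _ Y_not_const]) (use B V in blast)
      define O' where "O' = {q. eta q \<in> deriv x ` B} \<inter> {q. dist (fst q) (x u) < \<delta>}"
      have "open O'"
        unfolding O'_def
      proof (intro open_Int)
        have "open (eta -` (deriv x ` B))" by (intro open_vimage oB eta_cont)
        then show "open {q. eta q \<in> deriv x ` B}" by (simp add: vimage_def)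
        show "open {q :: complex \<times> complex. dist (fst q) (x u) < \<delta>}" by (intro open_Collect_less continuous_intros)
      qed
      moreover have "P u \<in> O'" using B(2) \<delta> by (auto simp: O'_def fst_P eta_P)
      moreover have "O' \<inter> E \<subseteq> P ` V"
      proof
        fix q assume q: "q \<in> O' \<inter> E"
        then obtain w where w: "w \<in> B" "eta q = deriv x w" by (auto simp: O'_def)
        have wL: "w \<notin> L" using B w V by blast
        have "cubic (fst q) = cubic (x w)" using q w ode1[OF wL] by (simp add: in_E_iff)
        then have "fst q = x w"
          by (rule inj_onD[OF \<delta>(2)]) (use q B(3)[OF w(1)] in \<open>auto simp: O'_def dist_commute\<close>)
        then have "q = P w" using w by (simp add: eq_P_iff eta_P fst_P)
        then show "q \<in> P ` V" using B(3)[OF w(1)] by blast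
      qed
      ultimately show ?thesis by blast
    qed
  qed
  then obtain O' where O': "\<And>u. u \<in> V \<Longrightarrow> open (O' u) \<and> P u \<in> O' u \<and> O' u \<inter> E \<subseteq> P ` V" by metis
  have "P ` V = E \<inter> (\<Union>u\<in>V. O' u)" using O' P_in_E V by blast
  then show ?thesis using O' by (auto simp: openin_open intro!: exI[of _ "\<Union>u\<in>V. O' u"])
qed

text \<open>The sheets over a small neighbourhood are the translates by \<open>L\<close> of one
  ball. Half the distance from 0 to the rest of \<open>L\<close> bounds its radius, which makes P
  injective on it and the translates disjoint.\<close>

lemma P_covering: "covering_space (- L) P E"
proof
  show "continuous_on (- L) P" by (rule P_cont)
  show "P ` (- L) = E" by (rule P_image)
  fix p assume "p \<in> E"
  then obtain u where u: "u \<notin> L" "P u = p" using P_onto by blast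
  have "\<forall>\<^sub>F w in nhds 0. w \<in> L \<longrightarrow> w = 0"
    using ev_not_L(1)[of 0] by (auto simp: eventually_at_filter elim!: eventually_mono)
  then obtain d where d: "d > 0" "\<And>w. w \<in> ball 0 d \<Longrightarrow> w \<in> L \<Longrightarrow> w = 0"
    unfolding eventually_nhds_metric by (auto simp: dist_commute)
  obtain e where e: "e > 0" "ball u e \<subseteq> - L" using L_open u by (meson ComplI open_contains_ball)
  define B where "B = ball u (min (d/2) e)"
  have B: "open B" "B \<subseteq> - L" "u \<in> B" using e d by (auto simp: B_def)
  have inj: "w = w'" if "w \<in> B" "w' \<in> B" "w - w' \<in> L" for w w'
  proof -
    have "norm (w - w') < d" using that dist_triangle_half_l[of w u d w'] by (auto simp: B_def dist_norm dist_commute norm_minus_commute)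
    then show ?thesis using d(2)[of "w - w'"] that by auto
  qed
  define T where "T = P ` B"
  define v where "v = (\<lambda>l. (\<lambda>w. w + l) ` B) ` L"
  have sheet: "(\<lambda>w. w + l) ` B \<subseteq> - L" "open ((\<lambda>w. w + l) ` B)" "P ` ((\<lambda>w. w + l) ` B) = T" "inj_on P ((\<lambda>w. w + l) ` B)" if l: "l \<in> L" for l
  proof -
    show 1: "(\<lambda>w. w + l) ` B \<subseteq> - L" using translate(1)[OF l] B by auto
    show "open ((\<lambda>w. w + l) ` B)" using open_translation[OF B(1), of l] by (simp add: add.commute)
    show "P ` ((\<lambda>w. w + l) ` B) = T" using P_translate[OF l] B by (force simp: T_def image_image)
    show "inj_on P ((\<lambda>w. w + l) ` B)"
    proof (rule inj_onI)
      fix a b assume ab: "a \<in> (\<lambda>w. w + l) ` B" "b \<in> (\<lambda>w. w + l) ` B" "P a = P b"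
      then obtain a' b' where ab': "a = a' + l" "b = b' + l" "a' \<in> B" "b' \<in> B" by blast
      have "a - b \<in> L" using P_eq_iff[of a b] ab 1 by blast
      then show "a = b" using inj[of a' b'] ab' by simp
    qed
  qed
  have "p \<in> T" using u B by (auto simp: T_def)
  moreover have "openin (top_of_set E) T" unfolding T_def by (rule P_open_map[OF B(1,2)])
  moreover have "\<Union>v = - L \<inter> P -` T"
  proof (intro equalityI subsetI)
    fix w assume "w \<in> \<Union>v"
    then show "w \<in> - L \<inter> P -` T" using sheet(1,3) unfolding v_def by blast
  next
    fix w assume w: "w \<in> - L \<inter> P -` T"
    then obtain w' where w': "w' \<in> B" "P w = P w'" by (auto simp: T_def)
    then have "w - w' \<in> L" using P_eq_iff[of w w'] w B by blast
    moreover have "w = w' + (w - w')" by simp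
    ultimately show "w \<in> \<Union>v" using w'(1) unfolding v_def by blast
  qed
  moreover have "\<forall>u\<in>v. openin (top_of_set (- L)) u"
    using sheet(1,2) L_open by (auto simp: v_def openin_open_eq)
  moreover have "pairwise disjnt v"
  proof (rule pairwiseI)
    fix A A' assume A: "A \<in> v" "A' \<in> v" "A \<noteq> A'"
    then obtain l l' where l: "l \<in> L" "l' \<in> L" "A = (\<lambda>w. w + l) ` B" "A' = (\<lambda>w. w + l') ` B" unfolding v_def by blast
    show "disjnt A A'"
    proof (rule ccontr)
      assume "\<not> disjnt A A'"
      then obtain w w' where w: "w \<in> B" "w' \<in> B" "w + l = w' + l'" using l by (auto simp: disjnt_def)
      then have "w - w' = l' - l" by (simp add: algebra_simps)
      then have "w = w'" using inj[OF w(1,2)] L_diff l by simp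
      then have "l = l'" using w by simp
      then show False using A l by simp
    qed
  qed
  moreover have "\<forall>A\<in>v. \<exists>q. homeomorphism A T P q"
  proof
    fix A assume "A \<in> v"
    then obtain l where l: "l \<in> L" "A = (\<lambda>w. w + l) ` B" unfolding v_def by blast
    have oT: "openin (top_of_set T) (P ` U)" if "openin (top_of_set A) U" for U
    proof -
      have "open U" "U \<subseteq> A" using that sheet(2)[OF l(1)] l(2) by (auto simp: openin_open_eq)
      then have "openin (top_of_set E) (P ` U)" "P ` U \<subseteq> T" using P_open_map[of U] sheet(1,3)[OF l(1)] l(2) by blast+
      moreover have "T \<subseteq> E" using P_in_E B by (auto simp: T_def)
      ultimately show ?thesis by (rule openin_subset_trans)
    qed
    show "\<exists>q. homeomorphism A T P q"
      by (rule homeomorphism_injective_open_map[of A P T])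
         (use oT sheet[OF l(1)] l(2) continuous_on_subset[OF P_cont] in auto)
  qed
  ultimately show "\<exists>T. p \<in> T \<and> openin (top_of_set E) T \<and> (\<exists>v. \<Union>v = - L \<inter> P -` T \<and> (\<forall>u\<in>v. openin (top_of_set (- L)) u) \<and>
        pairwise disjnt v \<and> (\<forall>u\<in>v. \<exists>q. homeomorphism u T P q))"
    by blast
qed

section \<open>Lifting paths and integrating along them\<close>

lemma lift_path:
  fixes a b :: real and \<gamma> :: "real \<Rightarrow> complex \<times> complex"
  assumes ab: "a < b" and \<gamma>: "continuous_on {a..b} \<gamma>" "\<gamma> ` {a..b} \<subseteq> E" and v: "v \<notin> L" "P v = \<gamma> b"
  obtains h where "continuous_on {a..b} h" "h ` {a..b} \<subseteq> - L" "h b = v" "\<And>t. t \<in> {a..b} \<Longrightarrow> P (h t) = \<gamma> t"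
proof -
  \<comment> \<open>Time is reversed, because the lift is prescribed at the end b: paths coming from
    infinity have a known end but no affine start.\<close>
  define g where "g = (\<lambda>s. \<gamma> (b + (a - b) * s))"
  have rng: "b + (a - b) * s \<in> {a..b}" if "s \<in> {0..1}" for s
  proof -
    have "(b - a) * s \<le> (b - a) * 1" "0 \<le> (b - a) * s" using that ab by (auto intro: mult_left_mono)
    then show ?thesis by (auto simp: algebra_simps)
  qed
  have "path g" unfolding path_def g_def
    by (rule continuous_on_compose2[OF \<gamma>(1)]) (use rng in \<open>auto intro!: continuous_intros\<close>)
  moreover have "path_image g \<subseteq> E" using rng \<gamma>(2) unfolding path_image_def g_def by blast
  moreover have "pathstart g = P v" using v by (simp add: pathstart_def g_def)
  ultimately obtain h' where h': "path h'" "path_image h' \<subseteq> - L" "pathstart h' = v" "\<And>s. s \<in> {0..1} \<Longrightarrow> P (h' s) = g s"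
    using covering_space_lift_path_strong[OF P_covering, of v g] v by auto
  have rng': "(b - t) / (b - a) \<in> {0..1}" if "t \<in> {a..b}" for t using that ab by (auto simp: divide_simps)
  show ?thesis
  proof (rule that[of "\<lambda>t. h' ((b - t) / (b - a))"])
    show "continuous_on {a..b} (\<lambda>t. h' ((b - t) / (b - a)))"
      by (rule continuous_on_compose2[of "{0..1}" h']) (use h'(1) rng' ab in \<open>auto simp: path_def intro!: continuous_intros\<close>)
    show "(\<lambda>t. h' ((b - t) / (b - a))) ` {a..b} \<subseteq> - L" using h'(2) rng' unfolding path_image_def by blast
    show "h' ((b - b) / (b - a)) = v" using h'(3) by (simp add: pathstart_def)
    fix t assume t: "t \<in> {a..b}"
    have "b + (a - b) * ((b - t) / (b - a)) = t" using ab by (simp add: divide_simps) (simp add: algebra_simps)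
    then show "P (h' ((b - t) / (b - a))) = \<gamma> t" using h'(4)[OF rng'[OF t]] by (simp add: g_def)
  qed
qed

text \<open>The pullback of \<open>omega1\<close> by P is du. Away from branch points this is read
  off in the coordinate x, at branch points in the derivative of x.\<close>

lemma lift_derivative:
  assumes h: "isCont h t" "h t \<notin> L" and T: "open T" "t \<in> T" "\<And>s. s \<in> T \<Longrightarrow> P (h s) = \<gamma> s"
    and \<gamma>: "(\<gamma> has_vector_derivative D) (at t)"
  shows "(h has_vector_derivative omega1 \<mu> (\<gamma> t) D) (at t)"
proof -
  obtain dx dy where D: "D = (dx, dy)" by force
  have pt: "P (h t) = \<gamma> t" using T by blast
  have d1: "((\<lambda>s. fst (\<gamma> s)) has_vector_derivative dx) (at t)"
    using bounded_linear.has_vector_derivative[OF bounded_linear_fst \<gamma>] D by simp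
  have d2: "((\<lambda>s. snd (\<gamma> s)) has_vector_derivative dy) (at t)"
    using bounded_linear.has_vector_derivative[OF bounded_linear_snd \<gamma>] D by simp
  have xh: "x (h s) = fst (\<gamma> s)" "deriv x (h s) = eta (\<gamma> s)" if "s \<in> T" for s
    using T(3)[OF that] by (metis fst_P, metis eta_P)
  have om: "omega1 \<mu> (\<gamma> t) D = (if eta (\<gamma> t) \<noteq> 0 then dx / eta (\<gamma> t) else dy / (3 * fst (\<gamma> t)^2 + 2 * \<mu> 2 * fst (\<gamma> t) + \<mu> 4 - \<mu> 1 * snd (\<gamma> t)))"
    by (simp add: omega1_def D eta_def case_prod_unfold)
  show ?thesis
  proof (cases "eta (\<gamma> t) = 0")
    case False
    have nz: "deriv x (h t) \<noteq> 0" using False xh T by simp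
    have "(h has_vector_derivative (dx / deriv x (h t))) (at t)"
      by (rule has_vector_derivative_inverse_branch[OF hol L_open h(1) _ nz d1 T(1,2) xh(1)]) (use h(2) in auto)
    then show ?thesis using False xh(2)[OF T(2)] om by simp
  next
    case True
    have Y0: "deriv x (h t) = 0" using True xh T by simp
    then have c0: "cubic (x (h t)) = 0" using ode1[OF h(2)] by simp
    then have q0: "quad (x (h t)) \<noteq> 0" using no_double_root[of "x (h t)"] by (simp add: cubic_def quad_def)
    have dY: "deriv (deriv x) (h t) = quad (x (h t))" by (rule ode2[OF h(2)])
    have e: "((\<lambda>s. eta (\<gamma> s)) has_vector_derivative (2 * dy + \<mu> 1 * dx)) (at t)"
    proof -
      have "((\<lambda>s. 2 * snd (\<gamma> s) + \<mu> 1 * fst (\<gamma> s) + \<mu> 3) has_vector_derivative (2 * dy + \<mu> 1 * dx + 0)) (at t)"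
        by (intro has_vector_derivative_add has_vector_derivative_const bounded_linear.has_vector_derivative[OF bounded_linear_mult_right] d1 d2)
      then show ?thesis by (simp add: eta_def)
    qed
    have hd: "(h has_vector_derivative ((2 * dy + \<mu> 1 * dx) / quad (x (h t)))) (at t)"
      using has_vector_derivative_inverse_branch[OF Y_hol L_open h(1) _ _ e T(1,2) xh(2)] h(2) q0 by (simp add: dY)
    have "((x \<circ> h) has_vector_derivative ((2 * dy + \<mu> 1 * dx) / quad (x (h t)) * deriv x (h t))) (at t)"
      by (rule field_vector_diff_chain_at[OF hd x_deriv[OF h(2)]])
    then have "((\<lambda>s. fst (\<gamma> s)) has_vector_derivative ((2 * dy + \<mu> 1 * dx) / quad (x (h t)) * deriv x (h t))) (at t)"
      by (rule has_vector_derivative_transform_within_open[OF _ T(1,2)]) (simp add: xh)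
    \<comment> \<open>By the chain rule dx contains the factor \<open>deriv x (h t)\<close>, which
      is 0 at a branch point; the tangent vector is vertical, as the second expression in
      \<open>omega1\<close> presupposes.\<close>
    then have dx0: "dx = 0" using vector_derivative_unique_at[OF d1] Y0 by simp
    have "quad (x (h t)) = 2 * (3 * fst (\<gamma> t)^2 + 2 * \<mu> 2 * fst (\<gamma> t) + \<mu> 4 - \<mu> 1 * snd (\<gamma> t))"
    proof -
      have "2 * snd (\<gamma> t) + \<mu> 1 * fst (\<gamma> t) + \<mu> 3 = 0" using True by (simp add: eta_def)
      then show ?thesis unfolding xh(1)[OF T(2)] quad_def unfolding b2 b4 by algebra
    qed
    note qq = this
    have two: "(2::complex) \<noteq> 0" by simp
    have "(2 * dy + \<mu> 1 * dx) / quad (x (h t)) = omega1 \<mu> (\<gamma> t) D"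
      by (simp only: om dx0 qq True mult_zero_right add_0_right simp_thms if_False mult_divide_mult_cancel_left[OF two])
    then show ?thesis using hd by simp
  qed
qed

lemma lift_integral:
  assumes ab: "a < b" and \<gamma>: "\<gamma> piecewise_C1_differentiable_on {a..b}"
    and h: "continuous_on {a..b} h" "h ` {a..b} \<subseteq> - L" "\<And>t. t \<in> {a..b} \<Longrightarrow> P (h t) = \<gamma> t"
  shows "form_integral (omega1 \<mu>) a b \<gamma> = h b - h a"
proof -
  obtain S where S: "finite S" "\<gamma> C1_differentiable_on ({a..b} - S)"
    using \<gamma> unfolding piecewise_C1_differentiable_on_def by blast
  have "((\<lambda>t. omega1 \<mu> (\<gamma> t) (vector_derivative \<gamma> (at t))) has_integral (h b - h a)) {a..b}"
  proof (rule fundamental_theorem_of_calculus_interior_strong[OF S(1) _ _ h(1)])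
    fix t assume t: "t \<in> {a<..<b} - S"
    then have "\<gamma> differentiable at t" using S(2) unfolding C1_differentiable_on_eq by auto
    then have d: "(\<gamma> has_vector_derivative vector_derivative \<gamma> (at t)) (at t)" by (simp add: vector_derivative_works)
    have "isCont h t" using h(1) t by (metis DiffD1 continuous_on_interior interior_atLeastAtMost_real)
    then show "(h has_vector_derivative omega1 \<mu> (\<gamma> t) (vector_derivative \<gamma> (at t))) (at t)"
      by (rule lift_derivative[where T = "{a<..<b}"]) (use t h d in \<open>auto simp: image_subset_iff\<close>)
  qed (use ab in simp)
  then show ?thesis unfolding form_integral_def by (rule integral_unique)
qed

lemma loop_period:
  assumes "affine_loop \<mu> \<gamma>" and v: "v \<notin> L" "P v = \<gamma> 1"
  obtains h where "continuous_on {0..1} h" "h ` {0..1} \<subseteq> - L" "h 1 = v" "\<And>t. t \<in> {0..1} \<Longrightarrow> P (h t) = \<gamma> t"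
    "h 1 - h 0 = form_integral (omega1 \<mu>) 0 1 \<gamma>" "form_integral (omega1 \<mu>) 0 1 \<gamma> \<in> L"
proof -
  have \<gamma>: "\<gamma> piecewise_C1_differentiable_on {0..1}" "\<gamma> ` {0..1} \<subseteq> E" "\<gamma> 1 = \<gamma> 0"
    using assms(1) by (auto simp: affine_loop_def)
  have c: "continuous_on {0..1} \<gamma>" using \<gamma>(1) by (simp add: piecewise_C1_differentiable_on_def)
  obtain h where h: "continuous_on {0..1} h" "h ` {0..1} \<subseteq> - L" "h 1 = v" "\<And>t. t \<in> {0..1} \<Longrightarrow> P (h t) = \<gamma> t"
    by (rule lift_path[OF _ c \<gamma>(2) v]) auto
  have i: "form_integral (omega1 \<mu>) 0 1 \<gamma> = h 1 - h 0" by (rule lift_integral[OF _ \<gamma>(1) h(1,2,4)]) auto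
  have "P (h 1) = P (h 0)" using h(4)[of 1] h(4)[of 0] \<gamma>(3) by simp
  moreover have "h 1 \<notin> L" "h 0 \<notin> L" using h(2) by (auto simp: image_subset_iff)
  ultimately have "h 1 - h 0 \<in> L" using P_eq_iff by blast
  then show ?thesis using that[OF h] i by simp
qed

section \<open>The projective curve and its group law\<close>

definition phat :: "complex \<Rightarrow> (complex \<times> complex) option" where
  "phat u = (if u \<in> L then None else Some (P u))"

lemma topspace_curve: "topspace (curve_topology \<mu>) = insert None (Some ` E)"
  by (simp add: curve_topology_def)

lemma phat_eq_iff: "phat u = phat v \<longleftrightarrow> u - v \<in> L"
proof (cases "u \<in> L")
  case u: True
  show ?thesis
  proof (cases "v \<in> L")
    case True
    then show ?thesis using u L_diff by (simp add: phat_def)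
  next
    case False
    then show ?thesis using u L_diff[of u "u - v"] by (auto simp: phat_def)
  qed
next
  case u: False
  show ?thesis
  proof (cases "v \<in> L")
    case True
    then show ?thesis using u L_add[of v "u - v"] by (auto simp: phat_def)
  next
    case False
    then show ?thesis using u P_eq_iff by (auto simp: phat_def)
  qed
qed

lemma phat_image: "phat ` UNIV = topspace (curve_topology \<mu>)"
proof -
  have "phat u \<in> insert None (Some ` E)" for u using P_in_E by (auto simp: phat_def)
  moreover have "None \<in> range phat" using zero_in by (auto simp: phat_def intro!: image_eqI[of _ _ 0])
  moreover have "Some p \<in> range phat" if "p \<in> E" for p
    using P_onto[OF that] by (metis phat_def rangeI)
  ultimately show ?thesis unfolding topspace_curve by (intro equalityI image_subsetI subsetI) auto
qed

lemma open_iff_eventually: "open (S :: complex set) \<longleftrightarrow> (\<forall>z\<in>S. \<forall>\<^sub>F w in nhds z. w \<in> S)"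
  by (subst open_subopen) (simp add: eventually_nhds subset_eq)

text \<open>Neighbourhoods of the point at infinity are complements of compact sets. Near a pole
  \<open>x\<close> exceeds any bound, so the affine point leaves each compact set.\<close>

lemma continuous_phat: "continuous_map euclidean (curve_topology \<mu>) phat"
  unfolding continuous_map_def
proof (intro conjI allI impI)
  show "phat \<in> topspace euclidean \<rightarrow> topspace (curve_topology \<mu>)" using phat_image by auto
  fix V assume "openin (curve_topology \<mu>) V"
  then consider (fin) U where "openin (top_of_set E) U" "V = Some ` U"
    | (inf) C where "compactin (top_of_set E) C" "closedin (top_of_set E) C" "V = insert None (Some ` (E - C))"
    unfolding curve_topology_def openin_Alexandroff_compactification by auto
  then have "open {u. phat u \<in> V}"
  proof cases
    case fin
    have "openin (top_of_set (- L)) (- L \<inter> P -` U)"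
      by (rule continuous_openin_preimage[OF P_cont _ fin(1)]) (use P_in_E in auto)
    then have "open (- L \<inter> P -` U)" using L_open by (rule openin_open_trans)
    moreover have "{u. phat u \<in> V} = - L \<inter> P -` U" using fin(2) by (auto simp: phat_def)
    ultimately show ?thesis by simp
  next
    case inf
    have C: "compact C" "C \<subseteq> E" using inf(1) by (auto simp: compactin_subtopology)
    have V: "phat u \<in> V \<longleftrightarrow> (u \<in> L \<or> P u \<notin> C)" for u using inf(3) P_in_E by (auto simp: phat_def)
    obtain R where R: "\<And>p. p \<in> C \<Longrightarrow> norm p \<le> R" using compact_imp_bounded[OF C(1)] by (auto simp: bounded_iff)
    show ?thesis
      unfolding open_iff_eventually
    proof
      fix u assume u: "u \<in> {u. phat u \<in> V}"
      show "\<forall>\<^sub>F w in nhds u. w \<in> {u. phat u \<in> V}"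
      proof (cases "u \<in> L")
        case True
        have "\<forall>\<^sub>F w in at u. norm (x w) > R"
          using filterlim_at_infinity_imp_norm_at_top[OF pole[OF True]] by (simp add: filterlim_at_top_dense)
        then have "\<forall>\<^sub>F w in at u. P w \<notin> C"
        proof eventually_elim
          case (elim w)
          have "norm (x w) \<le> norm (P w)" using norm_fst_le[of "x w" "(deriv x w - \<mu> 1 * x w - \<mu> 3) / 2"] by (simp add: P_def)
          then show ?case using R[of "P w"] elim by force
        qed
        then show ?thesis using True by (auto simp: eventually_at_filter V elim!: eventually_mono)
      next
        case False
        have "open (- L \<inter> P -` (- C))"
          by (rule continuous_open_preimage[OF P_cont L_open]) (use C compact_imp_closed in auto)
        then have "\<forall>\<^sub>F w in nhds u. w \<in> - L \<inter> P -` (- C)"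
          by (rule eventually_nhds_in_open) (use False u V in auto)
        then show ?thesis by eventually_elim (simp add: V)
      qed
    qed
  qed
  then show "openin euclidean {u \<in> topspace euclidean. phat u \<in> V}" by simp
qed

lemma Hausdorff_curve: "Hausdorff_space (curve_topology \<mu>)"
proof -
  have "closed E"
  proof -
    have "E = {p. snd p ^ 2 + (\<mu> 1 * fst p + \<mu> 3) * snd p = fst p ^ 3 + \<mu> 2 * fst p ^ 2 + \<mu> 4 * fst p + \<mu> 6}"
      by (auto simp: affine_curve_def)
    also have "closed \<dots>" by (intro closed_Collect_eq continuous_intros)
    finally show ?thesis .
  qed
  then have "locally_compact_space (top_of_set E)"
    by (intro locally_compact_space_closed_subset locally_compact_space_euclidean) auto
  then show ?thesis
    unfolding curve_topology_def by (simp add: Hausdorff_space_Alexandroff_compactification Hausdorff_space_subtopology)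
qed

lemma point_add_phat: "point_add \<mu> (phat u) (phat v) = phat (u + v)"
proof (cases "u \<in> L \<or> v \<in> L")
  case True
  then show ?thesis
  proof
    assume u: "u \<in> L"
    then have "phat (u + v) = phat v" by (simp add: phat_eq_iff)
    then show ?thesis using u by (simp add: phat_def)
  next
    assume v: "v \<in> L"
    then have "phat (u + v) = phat u" by (simp add: phat_eq_iff)
    moreover have "phat v = None" using v by (simp add: phat_def)
    ultimately show ?thesis by (cases "phat u") simp_all
  qed
next
  case False
  then have u: "u \<notin> L" and v: "v \<notin> L" by auto
  define x1 x2 Y1 Y2 where "x1 = x u" "x2 = x v" "Y1 = deriv x u" "Y2 = deriv x v"
  note defs = this
  define y1 y2 where "y1 = (Y1 - \<mu> 1 * x1 - \<mu> 3) / 2" "y2 = (Y2 - \<mu> 1 * x2 - \<mu> 3) / 2"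
  note ydefs = this
  have ph: "phat u = Some (x1, y1)" "phat v = Some (x2, y2)" using u v by (simp_all add: phat_def P_def defs ydefs)
  have zero: "x1 = x2 \<and> y1 + y2 + \<mu> 1 * x2 + \<mu> 3 = 0 \<longleftrightarrow> u + v \<in> L"
  proof -
    have "y1 + y2 + \<mu> 1 * x2 + \<mu> 3 = (Y1 + Y2) / 2" if "x1 = x2" using that by (simp add: ydefs field_simps)
    then have "x1 = x2 \<and> y1 + y2 + \<mu> 1 * x2 + \<mu> 3 = 0 \<longleftrightarrow> x1 = x2 \<and> (Y1 + Y2) / 2 = 0"
      by (metis (no_types))
    also have "\<dots> \<longleftrightarrow> x1 = x2 \<and> Y1 = - Y2" by (simp add: eq_neg_iff_add_eq_0)
    also have "\<dots> \<longleftrightarrow> phat u = phat (- v)"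
      using u v minus_in_iff[of v] even[of v] Y_minus[OF v] by (simp add: phat_def eq_P_iff fst_P eta_P defs)
    finally show ?thesis by (simp add: phat_eq_iff)
  qed
  show ?thesis
  proof (cases "u + v \<in> L")
    case True
    then have z: "x1 = x2 \<and> y1 + y2 + \<mu> 1 * x2 + \<mu> 3 = 0" using zero by simp
    have "point_add \<mu> (phat u) (phat v) = None" unfolding ph point_add.simps if_P[OF z] ..
    then show ?thesis using True by (simp add: phat_def)
  next
    case False
    then have nz: "\<not> (x1 = x2 \<and> y1 + y2 + \<mu> 1 * x2 + \<mu> 3 = 0)" using zero by simp
    define l where "l = (if x1 = x2 then (3 * x1^2 + 2 * \<mu> 2 * x1 + \<mu> 4 - \<mu> 1 * y1) / (2 * y1 + \<mu> 1 * x1 + \<mu> 3)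
                 else (y2 - y1) / (x2 - x1))"
    \<comment> \<open>The slope l refers to y; the addition formulas use the slope in the completed
      coordinate \<open>2 y + \<mu> 1 x + \<mu> 3\<close>.\<close>
    define m where "m = 2 * l + \<mu> 1"
    have key: "x (u + v) = m^2 / 4 - b2 / 4 - x1 - x2" "deriv x (u + v) = - Y1 - m * (x (u + v) - x1)"
    proof -
      have "x (u + v) = m^2 / 4 - b2 / 4 - x1 - x2 \<and> deriv x (u + v) = - Y1 - m * (x (u + v) - x1)"
      proof (cases "x1 = x2")
        case True
        then have uv: "u - v \<in> L" using x_eq_cases[OF u v] False by (simp add: defs)
        have s: "u + v + (u - v) = 2 * u" by simp
        have t: "x (u + v) = x (2 * u)" "deriv x (u + v) = deriv x (2 * u)"
          using translate(2)[OF uv False] translate_Y[OF uv False] by (simp_all add: s)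
        have "2 * u \<notin> L" using L_add_iff[OF uv, of "u + v"] False by (simp add: s)
        then have Y: "Y1 \<noteq> 0" using Y_zero_iff[OF u] by (simp add: defs)
        have Yy: "2 * y1 + \<mu> 1 * x1 + \<mu> 3 = Y1" by (simp add: ydefs diff_divide_distrib)
        have "quad x1 = 2 * (3 * x1^2 + 2 * \<mu> 2 * x1 + \<mu> 4 - \<mu> 1 * y1) + \<mu> 1 * Y1"
          unfolding quad_def Yy[symmetric] unfolding b2 b4 by algebra
        moreover have "l * Y1 = 3 * x1^2 + 2 * \<mu> 2 * x1 + \<mu> 4 - \<mu> 1 * y1" unfolding l_def if_P[OF True] Yy using Y by simp
        ultimately have "quad x1 = m * Y1" unfolding m_def by algebra
        then have "quad x1 / Y1 = m" using Y by simp
        then have m: "quad (x u) / deriv x u = m" by (simp add: defs)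
        show ?thesis using duplication[OF u] Y unfolding m t by (simp add: defs[symmetric] True[symmetric] algebra_simps)
      next
        case ne: False
        have e: "2 * (y2 - y1) = Y2 - Y1 - \<mu> 1 * (x2 - x1)" by (simp add: ydefs field_simps)
        have d: "x2 - x1 \<noteq> 0" "x1 - x2 \<noteq> 0" using ne by auto
        have "l * (x2 - x1) = y2 - y1" using ne d by (simp add: l_def)
        then have "m * (x1 - x2) = Y1 - Y2" using e unfolding m_def by algebra
        then have m: "(deriv x u - deriv x v) / (x u - x v) = m" using d by (simp add: defs[symmetric] divide_simps)
        have ne': "x u \<noteq> x v" using ne by (simp add: defs)
        show ?thesis using addition[OF u v False ne'] addition_Y[OF u v False ne'] unfolding m by (simp add: defs[symmetric] algebra_simps)
      qed
      then show "x (u + v) = m^2 / 4 - b2 / 4 - x1 - x2" "deriv x (u + v) = - Y1 - m * (x (u + v) - x1)" by auto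
    qed
    define x3 where "x3 = l^2 + \<mu> 1 * l - \<mu> 2 - x1 - x2"
    have x3: "x (u + v) = x3" unfolding key(1) x3_def m_def unfolding b2 by (simp add: power2_eq_square field_simps)
    have Y3: "deriv x (u + v) = - Y1 - m * (x3 - x1)" using key(2) x3 by simp
    have "(deriv x (u + v) - \<mu> 1 * x3 - \<mu> 3) / 2 = - (l + \<mu> 1) * x3 - (y1 - l * x1) - \<mu> 3"
      unfolding Y3 m_def ydefs by (simp add: field_simps)
    then have "phat (u + v) = Some (x3, - (l + \<mu> 1) * x3 - (y1 - l * x1) - \<mu> 3)"
      using False by (simp add: phat_def P_def x3)
    moreover have "point_add \<mu> (phat u) (phat v) = Some (x3, - (l + \<mu> 1) * x3 - (y1 - l * x1) - \<mu> 3)"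
      unfolding ph point_add.simps if_not_P[OF nz] Let_def l_def[symmetric] x3_def[symmetric] ..
    ultimately show ?thesis by simp
  qed
qed

lemma point_mult_phat: "point_mult \<mu> n (phat u) = phat (of_nat n * u)"
proof (induction n)
  case 0
  then show ?case using zero_in by (simp add: point_mult_def phat_def)
next
  case (Suc n)
  then show ?case using point_add_phat[of u "of_nat n * u"] by (simp add: point_mult_def algebra_simps)
qed

section \<open>Integrals from infinity\<close>

text \<open>The lift of the path that ends at a parameter v of p is v minus the integral still to be
  run. Its limit v - u must lie in \<open>L\<close>: at a regular point the path would converge in
  the affine curve instead of leaving to infinity.\<close>

lemma integral_from_infinity_unique:
  assumes int: "integral_from_infinity \<mu> p u" and u: "u \<notin> L"
  shows "p = P u"
proof -
  obtain \<gamma> where \<gamma>: "\<gamma> ` {0<..1} \<subseteq> E" "\<gamma> 1 = p" "\<And>\<epsilon>. \<epsilon> \<in> {0<..<1} \<Longrightarrow> \<gamma> piecewise_C1_differentiable_on {\<epsilon>..1}"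
    "filterlim \<gamma> at_infinity (at_right 0)" "((\<lambda>\<epsilon>. form_integral (omega1 \<mu>) \<epsilon> 1 \<gamma>) \<longlongrightarrow> u) (at_right 0)"
    using int unfolding integral_from_infinity_def by blast
  have "p \<in> E" using \<gamma>(1,2) by force
  then obtain v where v: "v \<notin> L" "P v = p" using P_onto by blast
  define I where "I = (\<lambda>\<epsilon>. form_integral (omega1 \<mu>) \<epsilon> 1 \<gamma>)"
  have lift: "P (v - I \<epsilon>) = \<gamma> \<epsilon>" if \<epsilon>: "\<epsilon> \<in> {0<..<1}" for \<epsilon>
  proof -
    have cont: "continuous_on {\<epsilon>..1} \<gamma>" using \<gamma>(3)[OF \<epsilon>] by (simp add: piecewise_C1_differentiable_on_def)
    have sub: "\<gamma> ` {\<epsilon>..1} \<subseteq> E" using \<gamma>(1) \<epsilon> by (auto simp: image_subset_iff)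
    obtain h where h: "continuous_on {\<epsilon>..1} h" "h ` {\<epsilon>..1} \<subseteq> - L" "h 1 = v" "\<And>t. t \<in> {\<epsilon>..1} \<Longrightarrow> P (h t) = \<gamma> t"
      by (rule lift_path[OF _ cont sub v(1)])
         (use \<epsilon> v \<gamma>(2) in auto)
    have "I \<epsilon> = h 1 - h \<epsilon>" unfolding I_def by (rule lift_integral[OF _ \<gamma>(3)[OF \<epsilon>] h(1,2,4)]) (use \<epsilon> in auto)
    then have "v - I \<epsilon> = h \<epsilon>" using h(3) by simp
    then show ?thesis using h(4)[of \<epsilon>] \<epsilon> by simp
  qed
  have ev: "\<forall>\<^sub>F \<epsilon> in at_right 0. \<epsilon> \<in> {0<..<(1::real)}" by (rule eventually_at_right_real) simp
  have "v - u \<in> L"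
  proof (rule ccontr)
    assume vu: "v - u \<notin> L"
    have "isCont P (v - u)" using P_cont vu continuous_on_eq_continuous_at[OF L_open] by blast
    moreover have "((\<lambda>\<epsilon>. v - I \<epsilon>) \<longlongrightarrow> v - u) (at_right 0)" using \<gamma>(5) unfolding I_def by (intro tendsto_intros)
    ultimately have "((\<lambda>\<epsilon>. P (v - I \<epsilon>)) \<longlongrightarrow> P (v - u)) (at_right 0)" by (rule isCont_tendsto_compose)
    then have "(\<gamma> \<longlongrightarrow> P (v - u)) (at_right 0)"
      by (rule Lim_transform_eventually) (use ev in \<open>eventually_elim, simp add: lift\<close>)
    then show False using \<gamma>(4) not_tendsto_and_filterlim_at_infinity[of "at_right (0::real)"] by auto
  qed
  then show ?thesis using P_eq_iff[OF v(1) u] v by simp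
qed

text \<open>The path is the image of an arc from 0 to u. It leaves infinity because 0 is a pole, and
  its integral telescopes by \<open>lift_integral\<close>.\<close>

lemma integral_from_infinity_exists:
  assumes u: "u \<notin> L"
  shows "integral_from_infinity \<mu> (P u) u"
proof -
  have u0: "u \<noteq> 0" using u zero_in by auto
  \<comment> \<open>The arcs \<open>c\<close> from 0 to \<open>u\<close> for different \<open>s\<close> meet only at their ends, so all but countably many avoid \<open>L\<close>.\<close>
  define bad where "bad = (\<lambda>l. Im (l / u) / (Re (l / u) * (1 - Re (l / u)))) ` L"
  have "countable bad" unfolding bad_def using sparse_imp_countable[OF open_UNIV sparse] by (intro countable_image) auto
  then obtain s where s: "s \<notin> bad" using uncountable_UNIV_real by (metis UNIV_eq_I)
  define c where "c = (\<lambda>t::real. u * (of_real t + \<i> * of_real (s * t * (1 - t))))"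
  have c01: "c 0 = 0" "c 1 = u" by (simp_all add: c_def)
  have cL: "c t \<notin> L" if t: "t \<in> {0<..1}" for t
  proof (cases "t = 1")
    case True
    then show ?thesis using c01 u by simp
  next
    case False
    show ?thesis
    proof
      assume l: "c t \<in> L"
      have q: "c t / u = of_real t + \<i> * of_real (s * t * (1 - t))" using u0 by (simp add: c_def)
      have "s = Im (c t / u) / (Re (c t / u) * (1 - Re (c t / u)))" using t False unfolding q by simp
      then have "s \<in> bad" using l unfolding bad_def by blast
      then show False using s by simp
    qed
  qed
  define c' where "c' = (\<lambda>t::real. u * (1 + \<i> * of_real (s * (1 - 2 * t))))"
  have cd: "(c has_vector_derivative c' t) (at t)" for t
  proof -
    have "((\<lambda>z. u * (z + \<i> * (of_real s * z * (1 - z)))) has_field_derivative c' t) (at (of_real t))"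
      unfolding c'_def by (rule derivative_eq_intros refl)+ (simp add: algebra_simps)
    from has_vector_derivative_real_field[OF this] show ?thesis by (simp add: c_def)
  qed
  have cc: "continuous_on S c" for S unfolding c_def by (intro continuous_intros)
  define \<gamma> where "\<gamma> = (\<lambda>t. P (c t))"
  define D where "D = (\<lambda>t. (c' t * deriv x (c t), (c' t * quad (x (c t)) - \<mu> 1 * (c' t * deriv x (c t))) / 2))"
  have \<gamma>d: "(\<gamma> has_vector_derivative D t) (at t)" if t: "t \<in> {0<..1}" for t
  proof -
    have 1: "((\<lambda>s. x (c s)) has_vector_derivative c' t * deriv x (c t)) (at t)"
      using field_vector_diff_chain_at[OF cd x_deriv[OF cL[OF t]]] by (simp add: o_def)
    have 2: "((\<lambda>s. deriv x (c s)) has_vector_derivative c' t * quad (x (c t))) (at t)"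
      using field_vector_diff_chain_at[OF cd Y_deriv[OF cL[OF t]]] by (simp add: o_def)
    have "((\<lambda>s. (deriv x (c s) - \<mu> 1 * x (c s) - \<mu> 3) / 2) has_vector_derivative (c' t * quad (x (c t)) - \<mu> 1 * (c' t * deriv x (c t)) - 0) / 2) (at t)"
      by (intro has_vector_derivative_divide has_vector_derivative_diff has_vector_derivative_const has_vector_derivative_mult_right 1 2)
    from has_vector_derivative_Pair[OF 1 this] show ?thesis by (simp add: \<gamma>_def P_def D_def)
  qed
  have C1: "\<gamma> piecewise_C1_differentiable_on {\<epsilon>..1}" if \<epsilon>: "\<epsilon> \<in> {0<..<1}" for \<epsilon>
  proof (rule C1_differentiable_imp_piecewise)
    have sub: "c ` {\<epsilon>..1} \<subseteq> - L" using cL \<epsilon> by auto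
    have x: "continuous_on {\<epsilon>..1} (\<lambda>t. x (c t))" "continuous_on {\<epsilon>..1} (\<lambda>t. deriv x (c t))"
      using continuous_on_compose2[OF holomorphic_on_imp_continuous_on[OF hol] cc sub]
        continuous_on_compose2[OF holomorphic_on_imp_continuous_on[OF Y_hol] cc sub] by auto
    have "continuous_on {\<epsilon>..1} D" unfolding D_def c'_def quad_def by (intro continuous_intros x) simp_all
    moreover have "\<forall>t\<in>{\<epsilon>..1}. (\<gamma> has_vector_derivative D t) (at t)" using \<gamma>d \<epsilon> by auto
    ultimately show "\<gamma> C1_differentiable_on {\<epsilon>..1}" unfolding C1_differentiable_on_def by blast
  qed
  have int: "form_integral (omega1 \<mu>) \<epsilon> 1 \<gamma> = u - c \<epsilon>" if \<epsilon>: "\<epsilon> \<in> {0<..<1}" for \<epsilon>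
    using lift_integral[OF _ C1[OF \<epsilon>] cc] cL \<epsilon> by (auto simp: \<gamma>_def c01 image_subset_iff)
  have ev: "\<forall>\<^sub>F \<epsilon> in at_right 0. \<epsilon> \<in> {0<..<(1::real)}" by (rule eventually_at_right_real) simp
  have c0: "(c \<longlongrightarrow> 0) (at_right 0)"
    using cc[of UNIV] c01 by (metis continuous_on_eq_continuous_at isCont_def open_UNIV UNIV_I tendsto_within_subset top_greatest)
  have cat: "filterlim c (at 0) (at_right 0)"
    unfolding filterlim_at by (intro conjI c0, use ev in eventually_elim) (use cL zero_in in fastforce)
  have "filterlim \<gamma> at_infinity (at_right 0)"
  proof (rule filterlim_norm_at_top_imp_at_infinity)
    have "filterlim (\<lambda>t. norm (x (c t))) at_top (at_right 0)"
      by (rule filterlim_compose[OF filterlim_at_infinity_imp_norm_at_top[OF pole[OF zero_in]] cat])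
    then show "filterlim (\<lambda>t. norm (\<gamma> t)) at_top (at_right 0)"
      by (rule filterlim_at_top_mono) (simp add: \<gamma>_def P_def norm_fst_le)
  qed
  moreover have "((\<lambda>\<epsilon>. form_integral (omega1 \<mu>) \<epsilon> 1 \<gamma>) \<longlongrightarrow> u) (at_right 0)"
  proof (rule Lim_transform_eventually)
    show "((\<lambda>\<epsilon>. u - c \<epsilon>) \<longlongrightarrow> u) (at_right 0)" using tendsto_diff[OF tendsto_const c0, of u] by simp
    show "\<forall>\<^sub>F \<epsilon> in at_right 0. u - c \<epsilon> = form_integral (omega1 \<mu>) \<epsilon> 1 \<gamma>" using ev by eventually_elim (simp add: int)
  qed
  moreover have "\<gamma> ` {0<..1} \<subseteq> E" using cL P_in_E by (auto simp: \<gamma>_def)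
  ultimately show ?thesis unfolding integral_from_infinity_def using C1 by (intro exI[of _ \<gamma>]) (simp add: \<gamma>_def c01)
qed

lemma coordinates_eq: "u \<notin> L \<Longrightarrow> coordinates \<mu> u = P u"
  unfolding coordinates_def using integral_from_infinity_exists integral_from_infinity_unique by blast

end

section \<open>The period lattice\<close>

locale weierstrass_loops = weierstrass_curve +
  fixes \<alpha> \<beta> :: "real \<Rightarrow> complex \<times> complex" and w1 w2 :: complex
  assumes loops: "affine_loop \<mu> \<alpha>" "affine_loop \<mu> \<beta>" and generate: "generate_fundamental_group \<mu> \<alpha> \<beta>"
    and w1: "w1 = form_integral (omega1 \<mu>) 0 1 \<alpha>" and w2: "w2 = form_integral (omega1 \<mu>) 0 1 \<beta>"
    and Im_pos: "Im (w2 / w1) > 0"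
begin

abbreviation "\<Lambda> \<equiv> period_lattice w1 w2"

definition coord2 :: "complex \<Rightarrow> real" where "coord2 u = Im (u / w1) / Im (w2 / w1)"
definition coord1 :: "complex \<Rightarrow> real" where "coord1 u = Re (u / w1) - coord2 u * Re (w2 / w1)"

lemma w1_nz: "w1 \<noteq> 0" using Im_pos by auto

lemma coord_sum: "u = of_real (coord1 u) * w1 + of_real (coord2 u) * w2"
proof -
  have "z = of_real (Re z - Im z / Im t * Re t) + of_real (Im z / Im t) * t" if "Im t > 0" for z t
    using that by (simp add: complex_eq_iff)
  from this[OF Im_pos, of "u / w1"] have "u / w1 = of_real (coord1 u) + of_real (coord2 u) * (w2 / w1)"
    by (simp only: coord1_def coord2_def)
  then show ?thesis using w1_nz by (simp add: field_simps)
qed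

lemma coord_unique:
  fixes a b :: real
  assumes "u = of_real a * w1 + of_real b * w2"
  shows "coord1 u = a" "coord2 u = b"
proof -
  have *: "Im z / Im t = b \<and> Re z - Im z / Im t * Re t = a" if "Im t > 0" "z = of_real a + of_real b * t" for z t
    using that by simp
  have "u / w1 = of_real a + of_real b * (w2 / w1)" using w1_nz assms by (simp add: field_simps)
  from *[OF Im_pos this] show "coord1 u = a" "coord2 u = b" unfolding coord1_def coord2_def by blast+
qed

lemma coord_add: "coord1 (u + v) = coord1 u + coord1 v" "coord2 (u + v) = coord2 u + coord2 v"
  by (simp_all add: coord1_def coord2_def add_divide_distrib algebra_simps)

lemma coord_diff: "coord1 (u - v) = coord1 u - coord1 v" "coord2 (u - v) = coord2 u - coord2 v"
  by (simp_all add: coord1_def coord2_def diff_divide_distrib algebra_simps)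

lemma coord_scale: "coord1 (of_real t * u) = t * coord1 u" "coord2 (of_real t * u) = t * coord2 u"
proof -
  have "of_real t * u / w1 = of_real t * (u / w1)" by simp
  then show "coord1 (of_real t * u) = t * coord1 u" "coord2 (of_real t * u) = t * coord2 u"
    unfolding coord1_def coord2_def by (simp_all only: Re_complex_of_real Im_complex_of_real times_complex.sel) (simp_all add: algebra_simps)
qed

lemma coord_cont: "continuous_on S coord1" "continuous_on S coord2"
  unfolding coord1_def coord2_def using w1_nz Im_pos by (auto intro!: continuous_intros)

lemma lattice_iff: "u \<in> \<Lambda> \<longleftrightarrow> coord1 u \<in> \<int> \<and> coord2 u \<in> \<int>"
proof
  assume "u \<in> \<Lambda>"
  then obtain a b where u: "u = of_int a * w1 + of_int b * w2" unfolding period_lattice_def by blast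
  then show "coord1 u \<in> \<int> \<and> coord2 u \<in> \<int>" using coord_unique[of u "of_int a" "of_int b"] by simp
next
  assume "coord1 u \<in> \<int> \<and> coord2 u \<in> \<int>"
  then obtain a b where ab: "coord1 u = of_int a" "coord2 u = of_int b" by (auto elim!: Ints_cases)
  have "u = of_int a * w1 + of_int b * w2" using coord_sum[of u] unfolding ab by simp
  then show "u \<in> \<Lambda>" unfolding period_lattice_def by blast
qed

lemma lattice_group: "0 \<in> \<Lambda>" "u \<in> \<Lambda> \<Longrightarrow> v \<in> \<Lambda> \<Longrightarrow> u + v \<in> \<Lambda>" "u \<in> \<Lambda> \<Longrightarrow> v \<in> \<Lambda> \<Longrightarrow> u - v \<in> \<Lambda>" "w1 \<in> \<Lambda>" "w2 \<in> \<Lambda>"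
  using coord_unique[of 0 0 0] coord_unique[of w1 1 0] coord_unique[of w2 0 1]
  by (auto simp: lattice_iff coord_add coord_diff)

lemma base_point: obtains u where "u \<notin> L" "P u = \<alpha> 0"
  using P_onto[of "\<alpha> 0"] loops(1) by (force simp: affine_loop_def)

lemma lattice_subset: "\<Lambda> \<subseteq> L"
proof -
  obtain u where u: "u \<notin> L" "P u = \<alpha> 0" by (rule base_point)
  have a: "P u = \<alpha> 1" "P u = \<beta> 1"
    using u loops generate by (auto simp: affine_loop_def generate_fundamental_group_def)
  have "w1 \<in> L" unfolding w1 by (rule loop_period[OF loops(1) u(1) a(1)])
  moreover have "w2 \<in> L" unfolding w2 by (rule loop_period[OF loops(2) u(1) a(2)])
  ultimately show ?thesis using L_of_int L_add by (auto simp: period_lattice_def)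
qed

section \<open>Comparison of the poles with the period lattice\<close>

definition cell :: "complex set" where "cell = (\<lambda>(a, b). of_real a * w1 + of_real b * w2) ` ({0..1} \<times> {0..1::real})"

lemma compact_cell: "compact cell"
  unfolding cell_def case_prod_unfold by (intro compact_continuous_image compact_Times compact_Icc continuous_intros)

lemma cell_reduce: obtains v where "v \<in> cell" "u - v \<in> \<Lambda>"
proof -
  define v where "v = of_real (frac (coord1 u)) * w1 + of_real (frac (coord2 u)) * w2"
  have "v \<in> cell" unfolding cell_def v_def
    by (rule image_eqI[of _ _ "(frac (coord1 u), frac (coord2 u))"]) (auto simp: less_imp_le[OF frac_lt_1])
  moreover have "u - v \<in> \<Lambda>"
    using coord_unique[OF v_def] by (simp add: lattice_iff coord_diff frac_def)
  ultimately show ?thesis using that by blast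
qed

text \<open>A continuous map from a compact space to a Hausdorff space is closed. The cell already
  covers the curve because the periods lie in \<open>L\<close>; functions on the plane that are
  invariant under \<open>L\<close> thus descend continuously.\<close>

lemma quotient_phat: "quotient_map (top_of_set cell) (curve_topology \<mu>) phat"
proof (rule continuous_closed_imp_quotient_map)
  show c: "continuous_map (top_of_set cell) (curve_topology \<mu>) phat"
    using continuous_phat by (rule continuous_map_from_subtopology)
  have "compact_space (top_of_set cell)" using compact_cell by (simp add: compact_space_subtopology)
  then show "closed_map (top_of_set cell) (curve_topology \<mu>) phat"
    using Hausdorff_imp_kc_space[OF Hausdorff_curve] c by (rule continuous_imp_closed_map_gen)
  have "phat u \<in> phat ` cell" for u
  proof -
    obtain v where "v \<in> cell" "u - v \<in> \<Lambda>" by (rule cell_reduce)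
    then show ?thesis using lattice_subset phat_eq_iff[of u v] by blast
  qed
  then show "phat ` topspace (top_of_set cell) = topspace (curve_topology \<mu>)" unfolding phat_image[symmetric] by auto
qed

text \<open>Pigeonhole: the multiples 0, ..., N of l, reduced into the cell, fall among its N points
  of \<open>L\<close>, so some j - i with 0 < j - i <= N takes l into the period lattice. The
  factorial of N serves all l at once.\<close>

lemma finite_index: obtains M :: nat where "M > 0" "\<And>l. l \<in> L \<Longrightarrow> of_nat M * l \<in> \<Lambda>"
proof -
  define N where "N = card (cell \<inter> L)"
  have fin: "finite (cell \<inter> L)" using sparse compact_cell by (metis sparse_in_compact_finite sparse_in_subset top_greatest)
  have "of_nat (fact N) * l \<in> \<Lambda>" if l: "l \<in> L" for l
  proof -
    have "\<exists>v. v \<in> cell \<and> of_nat j * l - v \<in> \<Lambda>" for j by (metis cell_reduce)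
    then obtain r where r: "\<And>j. r j \<in> cell" "\<And>j. of_nat j * l - r j \<in> \<Lambda>" by metis
    have "r j \<in> L" for j
      using L_diff[OF L_of_int[OF l, of "int j"], of "of_nat j * l - r j"] r(2)[of j] lattice_subset by auto
    then have "r ` {..N} \<subseteq> cell \<inter> L" using r(1) by auto
    then have "card (r ` {..N}) \<le> N" unfolding N_def by (rule card_mono[OF fin])
    then have "\<not> inj_on r {..N}" using card_image[of r "{..N}"] by auto
    then obtain i j where ij: "i < j" "j \<le> N" "r i = r j" unfolding inj_on_def by (metis atMost_iff linorder_neqE_nat)
    have "of_nat (j - i) * l = (of_nat j * l - r j) - (of_nat i * l - r i)" using ij by (simp add: of_nat_diff algebra_simps)
    then have 1: "of_nat (j - i) * l \<in> \<Lambda>" using lattice_group(3)[OF r(2) r(2)] by metis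
    have "j - i dvd fact N" using ij by (intro dvd_fact) auto
    then obtain k where k: "fact N = k * (j - i)" by (metis dvd_def mult.commute)
    have m: "of_nat m * u \<in> \<Lambda>" if "u \<in> \<Lambda>" for m u
      by (induction m) (use lattice_group that in \<open>auto simp: distrib_right\<close>)
    show ?thesis using m[OF 1, of k] unfolding k by (simp add: mult.assoc)
  qed
  then show ?thesis using that[of "fact N"] by simp
qed

text \<open>Each generator lifts with one of the two periods as displacement; inverses and products
  of words only negate and add displacements.\<close>

lemma word_lift:
  assumes "\<delta> \<in> loop_words \<alpha> \<beta>"
  shows "\<exists>h. path h \<and> path_image h \<subseteq> - L \<and> (\<forall>t\<in>{0..1}. P (h t) = \<delta> t) \<and> h 1 - h 0 \<in> \<Lambda> \<and> \<delta> 0 = \<alpha> 0 \<and> \<delta> 1 = \<alpha> 0"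
  using assms
proof induction
  case 1
  obtain u where "u \<notin> L" "P u = \<alpha> 0" by (rule base_point)
  then show ?case
    by (intro exI[of _ "\<lambda>t. u"]) (auto simp: path_def path_image_def lattice_group)
next
  case 2
  obtain u where u: "u \<notin> L" "P u = \<alpha> 0" by (rule base_point)
  then have a: "P u = \<alpha> 1" "\<alpha> 1 = \<alpha> 0" using loops by (auto simp: affine_loop_def)
  show ?case
    by (rule loop_period[OF loops(1) u(1) a(1)], rule exI)
       (use a lattice_group in \<open>auto simp: path_def path_image_def w1[symmetric]\<close>)
next
  case 3
  obtain u where u: "u \<notin> L" "P u = \<alpha> 0" by (rule base_point)
  then have a: "P u = \<beta> 1" "\<beta> 1 = \<alpha> 0" "\<beta> 0 = \<alpha> 0" using loops generate by (auto simp: affine_loop_def generate_fundamental_group_def)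
  show ?case
    by (rule loop_period[OF loops(2) u(1) a(1)], rule exI)
       (use a lattice_group in \<open>auto simp: path_def path_image_def w2[symmetric]\<close>)
next
  case (4 \<gamma>)
  then obtain h where h: "path h" "path_image h \<subseteq> - L" "\<And>t. t \<in> {0..1} \<Longrightarrow> P (h t) = \<gamma> t" "h 1 - h 0 \<in> \<Lambda>" "\<gamma> 0 = \<alpha> 0" "\<gamma> 1 = \<alpha> 0" by blast
  have "h 0 - h 1 \<in> \<Lambda>" using lattice_group(3)[OF lattice_group(1) h(4)] by simp
  then show ?case using h by (intro exI[of _ "reversepath h"]) (auto simp: reversepath_def path_image_reversepath[unfolded reversepath_def] path_reversepath[unfolded reversepath_def])
next
  case (5 \<gamma> \<delta>)
  then obtain h where h: "path h" "path_image h \<subseteq> - L" "\<And>t. t \<in> {0..1} \<Longrightarrow> P (h t) = \<gamma> t" "h 1 - h 0 \<in> \<Lambda>" "\<gamma> 0 = \<alpha> 0" "\<gamma> 1 = \<alpha> 0" by blast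
  from 5 obtain k where k: "path k" "path_image k \<subseteq> - L" "\<And>t. t \<in> {0..1} \<Longrightarrow> P (k t) = \<delta> t" "k 1 - k 0 \<in> \<Lambda>" "\<delta> 0 = \<alpha> 0" "\<delta> 1 = \<alpha> 0" by blast
  \<comment> \<open>The second lift starts over the same point but possibly on another sheet;
    translation by l attaches it to the first without changing its displacement.\<close>
  define l where "l = h 1 - k 0"
  have nL: "h t \<notin> L" "k t \<notin> L" if "t \<in> {0..1}" for t using h(2) k(2) that by (auto simp: path_image_def image_subset_iff)
  have "P (h 1) = P (k 0)" using h(3,6) k(3,5) by simp
  then have l: "l \<in> L" using P_eq_iff nL by (simp add: l_def)
  define k' where "k' = (\<lambda>t. k t + l)"
  have k': "path k'" "path_image k' \<subseteq> - L" "\<And>t. t \<in> {0..1} \<Longrightarrow> P (k' t) = \<delta> t" "k' 0 = h 1" "k' 1 = k 1 + l"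
    using k nL(2) translate(1)[OF l] P_translate[OF l]
    by (auto simp: path_def path_image_def k'_def l_def image_subset_iff intro!: continuous_intros)
  have j: "path (h +++ k')" "path_image (h +++ k') \<subseteq> - L"
    using h(1,2) k' path_image_join_subset[of h k'] by (auto simp: pathfinish_def pathstart_def intro!: path_join_imp)
  have "(h +++ k') 1 - (h +++ k') 0 = (k 1 - k 0) + (h 1 - h 0)" by (simp add: joinpaths_def k'(5) l_def)
  then have "(h +++ k') 1 - (h +++ k') 0 \<in> \<Lambda>" using lattice_group(2)[OF k(4) h(4)] by simp
  moreover have "\<forall>t\<in>{0..1}. P ((h +++ k') t) = (\<gamma> +++ \<delta>) t" using h(3) k'(3) by (auto simp: joinpaths_def)
  moreover have "(\<gamma> +++ \<delta>) 0 = \<alpha> 0" "(\<gamma> +++ \<delta>) 1 = \<alpha> 0" using h(5) k(6) by (simp_all add: joinpaths_def)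
  ultimately show ?case using j by blast
qed

text \<open>A continuous homomorphism \<open>\<phi>\<close> to the reals that is integral on \<open>L\<close> makes \<open>exp (2 \<pi> \<i> \<phi>)\<close> a nowhere
  vanishing function on the projective curve; homotopic loops on the curve have images with the same
  winding number around 0.\<close>
lemma character_homotopy:
  fixes \<phi> :: "complex \<Rightarrow> real"
  assumes cont: "continuous_on UNIV \<phi>" and add: "\<And>u v. \<phi> (u + v) = \<phi> u + \<phi> v" and int: "\<And>l. l \<in> L \<Longrightarrow> \<phi> l \<in> \<int>"
    and p: "path p" and q: "path q" and hom: "homotopic_with (\<lambda>h. h 1 = h 0) (top_of_set {0..1}) (curve_topology \<mu>) (phat \<circ> p) (phat \<circ> q)"
  shows "\<phi> (p 1) - \<phi> (p 0) = \<phi> (q 1) - \<phi> (q 0)"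
proof -
  define e where "e = (\<lambda>u. 2 * of_real pi * \<i> * of_real (\<phi> u))"
  define g where "g = (\<lambda>u. exp (e u))"
  have per: "g u = g v" if "phat u = phat v" for u v
  proof -
    have "u - v \<in> L" using that phat_eq_iff by simp
    then obtain k :: int where k: "\<phi> (u - v) = of_int k" using int by (auto elim: Ints_cases)
    have "\<phi> u = \<phi> v + of_int k" using add[of v "u - v"] k by simp
    then have "e u = e v + of_int (2 * k) * (of_real pi * \<i>)" by (simp add: e_def algebra_simps)
    then show ?thesis unfolding g_def exp_eq by (intro exI[of _ k]) (simp add: algebra_simps)
  qed
  \<comment> \<open>The choice of preimage is immaterial by \<open>per\<close>; continuity of G on
    the curve comes from the quotient map.\<close>
  define G where "G = (\<lambda>z. g (SOME u. phat u = z))"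
  have G: "G (phat u) = g u" for u
    unfolding G_def by (rule per, rule someI[of "\<lambda>w. phat w = phat u"]) simp
  have "continuous_on S e" for S unfolding e_def by (intro continuous_intros continuous_on_subset[OF cont]) simp
  note ec = this
  have "continuous_map (top_of_set cell) (top_of_set (- {0})) (G \<circ> phat)"
    by (auto simp: o_def G g_def intro!: continuous_intros ec)
  from continuous_compose_quotient_map[OF quotient_phat this]
  have "continuous_map (curve_topology \<mu>) (top_of_set (- {0})) G" .
  from homotopic_with_compose_continuous_map_left[OF hom this, where q = "\<lambda>r. pathfinish r = pathstart r"]
  have "homotopic_loops (- {0}) (G \<circ> (phat \<circ> p)) (G \<circ> (phat \<circ> q))"
    unfolding homotopic_loops_def by (simp add: pathfinish_def pathstart_def)
  from winding_number_homotopic_loops[OF this]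
  have "winding_number (exp \<circ> (e \<circ> p)) 0 = winding_number (exp \<circ> (e \<circ> q)) 0" by (simp add: o_def G g_def)
  moreover have "path (e \<circ> p)" "path (e \<circ> q)" using p q ec by (auto intro: path_continuous_image)
  ultimately have "e (p 1) - e (p 0) = e (q 1) - e (q 0)"
    by (simp add: winding_number_compose_exp pathfinish_def pathstart_def)
  then have "of_real (\<phi> (p 1) - \<phi> (p 0)) = (of_real (\<phi> (q 1) - \<phi> (q 0)) :: complex)"
    unfolding e_def right_diff_distrib[symmetric] of_real_diff[symmetric] by simp
  then show ?thesis unfolding of_real_eq_iff .
qed

text \<open>For l in \<open>L\<close> a segment from u to u + l becomes a loop on the curve,
  homotopic to a word in the generators. The lift of the word has displacement in the period
  lattice, and the two integral characters see that this displacement is l.\<close>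

theorem L_eq_lattice: "L = \<Lambda>"
proof
  show "L \<subseteq> \<Lambda>"
  proof
    fix l assume l: "l \<in> L"
    obtain M :: nat where M: "M > 0" "\<And>l. l \<in> L \<Longrightarrow> of_nat M * l \<in> \<Lambda>" by (metis finite_index)
    have M': "real M * coord1 l \<in> \<int>" "real M * coord2 l \<in> \<int>" if "l \<in> L" for l
      using M(2)[OF that] coord_scale[of "real M" l] by (simp_all add: lattice_iff)
    obtain u where u: "u \<notin> L" "P u = \<alpha> 0" by (rule base_point)
    define p where "p = (\<lambda>t. u + of_real t * l)"
    have p: "path p" unfolding p_def path_def by (intro continuous_intros)
    have "continuous_map (top_of_set {0..1}) (curve_topology \<mu>) (phat \<circ> p)"
      by (rule continuous_map_compose[OF _ continuous_phat]) (use p in \<open>simp add: path_def\<close>)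
    moreover have "(phat \<circ> p) 0 = Some (\<alpha> 0)" "(phat \<circ> p) 1 = Some (\<alpha> 0)"
      using u translate(1)[OF l u(1)] P_translate[OF l u(1)] by (simp_all add: p_def phat_def)
    ultimately obtain \<delta> where \<delta>: "\<delta> \<in> loop_words \<alpha> \<beta>"
      "homotopic_with (\<lambda>h. h 0 = Some (\<alpha> 0) \<and> h 1 = Some (\<alpha> 0)) (top_of_set {0..1}) (curve_topology \<mu>) (phat \<circ> p) (Some \<circ> \<delta>)"
      using generate unfolding generate_fundamental_group_def by blast
    obtain q where q: "path q" "path_image q \<subseteq> - L" "\<And>t. t \<in> {0..1} \<Longrightarrow> P (q t) = \<delta> t" "q 1 - q 0 \<in> \<Lambda>"
      using word_lift[OF \<delta>(1)] by blast
    have pq: "(phat \<circ> q) t = (Some \<circ> \<delta>) t" if "t \<in> {0..1}" for t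
      using q(2,3) that by (auto simp: phat_def path_image_def image_subset_iff)
    have "homotopic_with (\<lambda>h. h 1 = h 0) (top_of_set {0..1}) (curve_topology \<mu>) (phat \<circ> p) (Some \<circ> \<delta>)"
      by (rule homotopic_with_mono[OF \<delta>(2)]) auto
    then have "homotopic_with (\<lambda>h. h 1 = h 0) (top_of_set {0..1}) (curve_topology \<mu>) (phat \<circ> p) (phat \<circ> q)"
      by (rule homotopic_with_eq) (use pq in auto)
    \<comment> \<open>The coordinates are so far known only to be rational on \<open>L\<close>;
      multiplied by M they are integral there, as a character must be. M cancels at the end.\<close>
    note H = character_homotopy[OF _ _ _ p q(1) this]
    have "real M * coord1 (p 1) - real M * coord1 (p 0) = real M * coord1 (q 1) - real M * coord1 (q 0)"
      by (rule H) (use M' in \<open>auto intro!: continuous_intros coord_cont simp: coord_add distrib_left\<close>)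
    moreover have "real M * coord2 (p 1) - real M * coord2 (p 0) = real M * coord2 (q 1) - real M * coord2 (q 0)"
      by (rule H) (use M' in \<open>auto intro!: continuous_intros coord_cont simp: coord_add distrib_left\<close>)
    ultimately have "coord1 (p 1 - p 0) = coord1 (q 1 - q 0)" "coord2 (p 1 - p 0) = coord2 (q 1 - q 0)"
      using M(1) unfolding coord_diff by (simp_all add: right_diff_distrib[symmetric])
    then have "p 1 - p 0 = q 1 - q 0" by (metis coord_sum)
    then show "l \<in> \<Lambda>" using q(4) by (simp add: p_def)
  qed
qed (rule lattice_subset)

end

section \<open>The division polynomials of the curve\<close>

lemma nonsingular_imp_weierstrass_cubic:
  assumes "nonsingular \<mu>"
  shows "weierstrass_cubic (\<mu> 1^2 + 4 * \<mu> 2) (2 * \<mu> 4 + \<mu> 1 * \<mu> 3) (\<mu> 3^2 + 4 * \<mu> 6)"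
proof
  fix e
  assume e: "4 * e^3 + (\<mu> 1^2 + 4 * \<mu> 2) * e^2 + 2 * (2 * \<mu> 4 + \<mu> 1 * \<mu> 3) * e + (\<mu> 3^2 + 4 * \<mu> 6) = 0"
  \<comment> \<open>This is the ordinate at which the first partial derivative vanishes: (e, y) is
    the 2-torsion point over the root e, and a double root makes the other partial derivative vanish
    there too.\<close>
  define y where "y = - (\<mu> 1 * e + \<mu> 3) / 2"
  have y: "2 * y + \<mu> 1 * e + \<mu> 3 = 0" by (simp add: y_def field_simps)
  have "4 * (y^2 + (\<mu> 1 * e + \<mu> 3) * y) = 4 * (e^3 + \<mu> 2 * e^2 + \<mu> 4 * e + \<mu> 6)"
    using e y by algebra
  then have "(e, y) \<in> affine_curve \<mu>" unfolding mult_cancel_left by (simp add: affine_curve_def)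
  then have "3 * e^2 + 2 * \<mu> 2 * e + \<mu> 4 - \<mu> 1 * y \<noteq> 0" using assms y unfolding nonsingular_def by blast
  moreover have "6 * e^2 + (\<mu> 1^2 + 4 * \<mu> 2) * e + (2 * \<mu> 4 + \<mu> 1 * \<mu> 3) = 2 * (3 * e^2 + 2 * \<mu> 2 * e + \<mu> 4 - \<mu> 1 * y)"
    using y by algebra
  ultimately show "6 * e^2 + (\<mu> 1^2 + 4 * \<mu> 2) * e + (2 * \<mu> 4 + \<mu> 1 * \<mu> 3) \<noteq> 0"
    by (metis mult_eq_0_iff zero_neq_numeral)
qed

context weierstrass_loops
begin

sublocale lattice: weierstrass_lattice b2 b4 b6 x L w1 w2
  by unfold_locales (simp_all add: L_eq_lattice period_lattice_def Im_pos)

lemma psi_eq_division_form: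
  assumes "n \<ge> 2" "u \<notin> L"
  shows "psi w1 w2 \<eta> n u = division_form n (\<lambda>j. divcoeff n j \<mu>) (fst (P u)) (snd (P u))"
proof -
  interpret weierstrass_sigma b2 b4 b6 x L "sigma w1 w2 \<eta>" by (rule lattice.sigma_sigma_locale)
  \<comment> \<open>The division by 4 in \<open>b8\<close> is exact over the integers in the \<mu>;
    this is why the integral expression can be used in \<open>divpoly\<close>.\<close>
  have b8: "b8 = \<mu> 1^2 * \<mu> 6 + 4 * \<mu> 2 * \<mu> 6 - \<mu> 1 * \<mu> 3 * \<mu> 4 + \<mu> 2 * \<mu> 3^2 - \<mu> 4^2"
    unfolding b8_def unfolding b2 b4 b6 by (simp add: power2_eq_square field_simps)
  have "psi w1 w2 \<eta> n u = W n u" by (simp add: psi_def W_def)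
  also have "\<dots> = (if odd n then 1 else - deriv x u) * eds (cubic (x u)) (psi3 (x u)) (psi4 (x u)) n"
    by (rule W_eq_eds) (use assms in auto)
  also have "\<dots> = division_form n (\<lambda>j. divcoeff n j \<mu>) (fst (P u)) (snd (P u))"
    unfolding division_form_eq_eds[OF assms(1)] b2[symmetric] b4[symmetric] b6[symmetric] b8[symmetric] fst_P
      cubic_def psi3_def psi4_def eta_P[of u, unfolded eta_def fst_P] ..
  finally show ?thesis .
qed

text \<open>Writing the point as \<open>P u\<close>, both sides say that n u lies in
  \<open>L\<close>: the left through the zeros of sigma, the right through the group law on
  parameters.\<close>

lemma division_form_zero_iff:
  assumes n: "n \<ge> 2" and p: "(a, b) \<in> E"
  shows "division_form n (\<lambda>j. divcoeff n j \<mu>) a b = 0 \<longleftrightarrow> point_mult \<mu> n (Some (a, b)) = None"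
proof -
  \<comment> \<open>The claim mentions no sigma function, so any one with these zeros serves; the
    constant in the exponent is taken to be 0.\<close>
  interpret weierstrass_sigma b2 b4 b6 x L "sigma w1 w2 0" by (rule lattice.sigma_sigma_locale)
  obtain u where u: "u \<notin> L" "P u = (a, b)" using P_onto[OF p] by blast
  have "division_form n (\<lambda>j. divcoeff n j \<mu>) a b = W n u"
    using psi_eq_division_form[OF n u(1), of 0] u(2) by (simp add: psi_def W_def)
  moreover have "phat u = Some (a, b)" using u by (simp add: phat_def)
  then have "point_mult \<mu> n (Some (a, b)) = phat (of_nat n * u)" using point_mult_phat[of n u] by simp
  ultimately show ?thesis using W_zero_iff[OF u(1)] by (simp add: phat_def)
qed

end

theorem mainTheorem3:
  fixes n :: nat and N :: complex
  assumes n: "n \<ge> 2" and N: "N = of_nat n"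
  shows "\<exists>C :: nat \<Rightarrow> (nat \<Rightarrow> complex) \<Rightarrow> complex.
    (\<forall>j. C j \<in> int_polynomials) \<and>
    (odd n \<longrightarrow> (\<forall>\<mu>.
       C 1 \<mu> = 0 \<and> C 3 \<mu> = 0 \<and> C 5 \<mu> = 0 \<and>
       C 2 \<mu> = 1/24 * N * (N^2 - 1) * \<mu> 1 ^ 2 + 1/6 * N * (N^2 - 1) * \<mu> 2 \<and>
       C 4 \<mu> = 1/1920 * N * (N^2 - 1) * (N^2 - 9) * \<mu> 1 ^ 4
             + 1/240 * N * (N^2 - 1) * (N^2 - 9) * \<mu> 2 * \<mu> 1 ^ 2
             + 1/120 * N * (N^2 - 1) * (N^2 + 6) * \<mu> 3 * \<mu> 1
             + 1/120 * N * (N^2 - 1) * (N^2 - 9) * \<mu> 2 ^ 2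
             + 1/60 * N * (N^2 - 1) * (N^2 + 6) * \<mu> 4 \<and>
       C 6 \<mu> = 1/322560 * N * (N^2 - 1) * (N^2 - 3^2) * (N^2 - 5^2) * \<mu> 1 ^ 6
             + 1/26880 * N * (N^2 - 1) * (N^2 - 3^2) * (N^2 - 5^2) * \<mu> 2 * \<mu> 1 ^ 4
             + 1/6720 * N * (N^2 - 1) * (N^2 - 3^2) * (N^2 + 10) * \<mu> 3 * \<mu> 1 ^ 3
             + 1/6720 * N * (N^2 - 1) * (N^2 - 3^2) * (N^2 - 5^2) * \<mu> 2 ^ 2 * \<mu> 1 ^ 2
             + 1/3360 * N * (N^2 - 1) * (N^2 - 3^2) * (N^2 + 10) * \<mu> 4 * \<mu> 1 ^ 2
             + 1/1680 * N * (N^2 - 1) * (N^2 - 3^2) * (N^2 + 10) * \<mu> 3 * \<mu> 2 * \<mu> 1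
             + 1/5040 * N * (N^2 - 1) * (N^2 - 3^2) * (N^2 - 5^2) * \<mu> 2 ^ 3
             + 1/840 * N * (N^2 - 1) * (N^2 - 3^2) * (N^2 + 10) * \<mu> 4 * \<mu> 2
             + 1/840 * N * (N^2 - 1) * (N^4 + N^2 + 15) * \<mu> 3 ^ 2
             + 1/210 * N * (N^2 - 1) * (N^4 + N^2 + 15) * \<mu> 6)) \<and>
    (even n \<longrightarrow> (\<forall>\<mu>.
       C 1 \<mu> = - 1/2 * N * \<mu> 1 \<and>
       C 2 \<mu> = - 1/24 * N * (N^2 - 2^2) * \<mu> 1 ^ 2 - 1/6 * N * (N^2 - 2^2) * \<mu> 2 \<and>
       C 3 \<mu> = - 1/48 * N * (N^2 - 2^2) * \<mu> 1 ^ 3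
             - 1/12 * N * (N^2 - 2^2) * \<mu> 2 * \<mu> 1
             - 1/2 * N * \<mu> 3 \<and>
       C 4 \<mu> = - 1/1920 * N * (N^2 - 2^2) * (N^2 - 4^2) * \<mu> 1 ^ 4
             - 1/240 * N * (N^2 - 2^2) * (N^2 - 4^2) * \<mu> 2 * \<mu> 1 ^ 2
             - 1/120 * N * (N^2 - 2^2) * (N^2 + 9) * \<mu> 3 * \<mu> 1
             - 1/120 * N * (N^2 - 2^2) * (N^2 - 4^2) * \<mu> 2 ^ 2
             - 1/60 * N * (N^2 - 2^2) * (N^2 + 9) * \<mu> 4 \<and>
       C 5 \<mu> = - 1/3840 * N * (N^2 - 2^2) * (N^2 - 4^2) * \<mu> 1 ^ 5
             - 1/480 * N * (N^2 - 2^2) * (N^2 - 4^2) * \<mu> 2 * \<mu> 1 ^ 3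
             - 1/240 * N * (N^2 - 2^2) * (N^2 + 14) * \<mu> 3 * \<mu> 1 ^ 2
             - 1/240 * N * (N^2 - 2^2) * (N^2 - 4^2) * \<mu> 2 ^ 2 * \<mu> 1
             - 1/120 * N * (N^2 - 2^2) * (N^2 + 9) * \<mu> 4 * \<mu> 1
             - 1/12 * N * (N^2 - 2^2) * \<mu> 3 * \<mu> 2)) \<and>
    (\<forall>\<mu> \<alpha> \<beta> \<omega>' \<omega>'' \<eta>'.
       nonsingular \<mu> \<and> affine_loop \<mu> \<alpha> \<and> affine_loop \<mu> \<beta> \<and>
       generate_fundamental_group \<mu> \<alpha> \<beta> \<and> has_intersection_number \<mu> \<alpha> \<beta> 1 \<and>
       \<omega>' = form_integral (omega1 \<mu>) 0 1 \<alpha> \<and>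
       \<omega>'' = form_integral (omega1 \<mu>) 0 1 \<beta> \<and>
       \<eta>' = form_integral (eta1 \<mu>) 0 1 \<alpha> \<and>
       Im (\<omega>'' / \<omega>') > 0 \<longrightarrow>
         (\<forall>u x y. u \<notin> period_lattice \<omega>' \<omega>'' \<and> (x, y) = coordinates \<mu> u \<longrightarrow>
            psi \<omega>' \<omega>'' \<eta>' n u = division_form n (\<lambda>j. C j \<mu>) x y) \<and>
         {(x, y) \<in> affine_curve \<mu>. division_form n (\<lambda>j. C j \<mu>) x y = 0} =
         {(x, y) \<in> affine_curve \<mu>. point_mult \<mu> n (Some (x, y)) = None})"
\<comment> \<open>The coefficients are functions of \<mu> given by the recursion alone, so they can
  be fixed before any curve or pair of loops is chosen.\<close>
proof (intro exI[of _ "divcoeff n"] conjI allI impI)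
  fix j show "divcoeff n j \<in> int_polynomials" by (rule divcoeff_int) (use n in simp)
next
  fix \<mu> \<alpha> \<beta> \<omega>' \<omega>'' \<eta>'
  assume a: "nonsingular \<mu> \<and> affine_loop \<mu> \<alpha> \<and> affine_loop \<mu> \<beta> \<and>
       generate_fundamental_group \<mu> \<alpha> \<beta> \<and> has_intersection_number \<mu> \<alpha> \<beta> 1 \<and>
       \<omega>' = form_integral (omega1 \<mu>) 0 1 \<alpha> \<and>
       \<omega>'' = form_integral (omega1 \<mu>) 0 1 \<beta> \<and>
       \<eta>' = form_integral (eta1 \<mu>) 0 1 \<alpha> \<and>
       Im (\<omega>'' / \<omega>') > 0"
  interpret weierstrass_cubic "\<mu> 1^2 + 4 * \<mu> 2" "2 * \<mu> 4 + \<mu> 1 * \<mu> 3" "\<mu> 3^2 + 4 * \<mu> 6"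
    using a nonsingular_imp_weierstrass_cubic by blast
  obtain X L where "weierstrass_function (\<mu> 1^2 + 4 * \<mu> 2) (2 * \<mu> 4 + \<mu> 1 * \<mu> 3) (\<mu> 3^2 + 4 * \<mu> 6) X L"
    using ex_weierstrass_function by blast
  then interpret weierstrass_function "\<mu> 1^2 + 4 * \<mu> 2" "2 * \<mu> 4 + \<mu> 1 * \<mu> 3" "\<mu> 3^2 + 4 * \<mu> 6" X L .
  interpret weierstrass_loops "\<mu> 1^2 + 4 * \<mu> 2" "2 * \<mu> 4 + \<mu> 1 * \<mu> 3" "\<mu> 3^2 + 4 * \<mu> 6" X L \<mu> \<alpha> \<beta> \<omega>' \<omega>''
    by unfold_locales (use a in auto)
  show "{(x, y) \<in> affine_curve \<mu>. division_form n (\<lambda>j. divcoeff n j \<mu>) x y = 0} =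
         {(x, y) \<in> affine_curve \<mu>. point_mult \<mu> n (Some (x, y)) = None}"
    using division_form_zero_iff[OF n] by auto
  fix u x y
  assume u: "u \<notin> period_lattice \<omega>' \<omega>'' \<and> (x, y) = coordinates \<mu> u"
  then have "u \<notin> L" by (simp add: L_eq_lattice)
  then show "psi \<omega>' \<omega>'' \<eta>' n u = division_form n (\<lambda>j. divcoeff n j \<mu>) x y"
    using psi_eq_division_form[OF n, of u \<eta>'] coordinates_eq[of u] u by (metis fst_conv snd_conv)
qed (rule divcoeff_odd[OF _ N] divcoeff_even[OF _ n N], assumption)+

end
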